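(* The Signed Domination problem is fixed-parameter tractable when parameterized by the neighbourhood diversity of the input graph.
   Context: All graphs are finite, simple and undirected. For a graph $G=(V,E)$ and $u\in V$, $N(u)=\{v:(u,v)\in E\}$ and $N[u]=N(u)\cup\{u\}$. A signed dominating function of $G$ is a function $f:V\to\{-1,1\}$ such that $\sum_{v\in N[u]}f(v)\ge 1$ for every $u\in V$; its weight is $\sum_{u\in V}f(u)$. Signed Domination: the input is a pair $(G,k)$, where $G$ is a graph and $k$ is an integer; the question is whether $G$ has a signed dominating function of weight at most $k$. Two vertices $u,v$ are of the same type if $N(u)\setminus\{v\}=N(v)\setminus\{u\}$. The neighbourhood diversity of $G=(V,E)$ is the smallest $t$ such that $V$ can be partitioned into $t$ sets $V_1,\dots,V_t$ with all vertices in each $V_i$ of the same type. A problem is fixed-parameter tractable (FPT) with respect to a parameter $p$ if it can be solved by an algorithm running in time $g(p)\cdot n^{O(1)}$, where $g$ is a computable function and $n$ is the input size. *)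

theory Defs
  imports
    "HOL-Library.Disjoint_Sets"
    "HOL-Library.Log_Nat"
    "Graph_Theory.Pair_Digraph"
begin

section \<open>Random access machines\<close>

text \<open>
  The model of computation is a random access machine over the integers, programmed in structured
  form. Besides its finitely many registers a program has a memory with indirect addressing.
  The arithmetic operations are addition and subtraction only; in particular there is no
  multiplication. Each evaluation of an operator, operand or memory access takes one time unit, and
  so does each assignment, store, no-op or test. A time unit therefore increases the bit length of
  the largest number present by at most a constant depending on the program, which makes this
  uniform cost measure polynomially equivalent to the running time of Turing machines.
\<close>

datatype expr =
    Const int
  | Reg nat
  | Load expr
  | Add expr expr
  | Sub expr expr

datatype com =
    Skip
  | Assign nat expr
  | Store expr expr
  | Seq com com
  | IfPos expr com com
  | WhilePos expr com

type_synonym config = "(nat \<Rightarrow> int) \<times> (int \<Rightarrow> int)"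

primrec expr_val :: "expr \<Rightarrow> config \<Rightarrow> int" where
  "expr_val (Const c) s = c"
| "expr_val (Reg x) s = fst s x"
| "expr_val (Load a) s = snd s (expr_val a s)"
| "expr_val (Add a b) s = expr_val a s + expr_val b s"
| "expr_val (Sub a b) s = expr_val a s - expr_val b s"

primrec expr_cost :: "expr \<Rightarrow> nat" where
  "expr_cost (Const c) = 1"
| "expr_cost (Reg x) = 1"
| "expr_cost (Load a) = expr_cost a + 1"
| "expr_cost (Add a b) = expr_cost a + expr_cost b + 1"
| "expr_cost (Sub a b) = expr_cost a + expr_cost b + 1"

text \<open>\<open>exec c s t s'\<close>: started in \<open>s\<close>, the program \<open>c\<close> halts in \<open>s'\<close> after \<open>t\<close> time units.\<close>

inductive exec :: "com \<Rightarrow> config \<Rightarrow> nat \<Rightarrow> config \<Rightarrow> bool" where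
  Skip: "exec Skip s 1 s"
| Assign: "exec (Assign x a) s (expr_cost a + 1) ((fst s)(x := expr_val a s), snd s)"
| Store: "exec (Store a b) s (expr_cost a + expr_cost b + 1)
            (fst s, (snd s)(expr_val a s := expr_val b s))"
| Seq: "exec c\<^sub>1 s\<^sub>1 t\<^sub>1 s\<^sub>2 \<Longrightarrow> exec c\<^sub>2 s\<^sub>2 t\<^sub>2 s\<^sub>3 \<Longrightarrow> exec (Seq c\<^sub>1 c\<^sub>2) s\<^sub>1 (t\<^sub>1 + t\<^sub>2) s\<^sub>3"
| IfTrue: "expr_val b s > 0 \<Longrightarrow> exec c\<^sub>1 s t s' \<Longrightarrow>
            exec (IfPos b c\<^sub>1 c\<^sub>2) s (expr_cost b + 1 + t) s'"
| IfFalse: "\<not> expr_val b s > 0 \<Longrightarrow> exec c\<^sub>2 s t s' \<Longrightarrow>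
            exec (IfPos b c\<^sub>1 c\<^sub>2) s (expr_cost b + 1 + t) s'"
| WhileFalse: "\<not> expr_val b s > 0 \<Longrightarrow> exec (WhilePos b c) s (expr_cost b + 1) s"
| WhileTrue: "expr_val b s\<^sub>1 > 0 \<Longrightarrow> exec c s\<^sub>1 t\<^sub>1 s\<^sub>2 \<Longrightarrow> exec (WhilePos b c) s\<^sub>2 t\<^sub>2 s\<^sub>3 \<Longrightarrow>
            exec (WhilePos b c) s\<^sub>1 (expr_cost b + 1 + t\<^sub>1 + t\<^sub>2) s\<^sub>3"

lemma exec_deterministic:
  "exec c s t s' \<Longrightarrow> exec c s u s'' \<Longrightarrow> u = t \<and> s'' = s'"
proof (induction arbitrary: u s'' rule: exec.induct)
  case (Skip s)
  then show ?case by (cases rule: exec.cases) auto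
next
  case (Assign x a s)
  then show ?case by (cases rule: exec.cases) auto
next
  case (Store a b s)
  then show ?case by (cases rule: exec.cases) auto
next
  case (Seq c\<^sub>1 s\<^sub>1 t\<^sub>1 s\<^sub>2 c\<^sub>2 t\<^sub>2 s\<^sub>3)
  from Seq.prems obtain v\<^sub>1 v\<^sub>2 r where
    "exec c\<^sub>1 s\<^sub>1 v\<^sub>1 r" "exec c\<^sub>2 r v\<^sub>2 s''" "u = v\<^sub>1 + v\<^sub>2"
    by (cases rule: exec.cases) auto
  with Seq.IH show ?case by metis
next
  case (IfTrue b s c\<^sub>1 t s' c\<^sub>2)
  from IfTrue.prems IfTrue.hyps(1) obtain v where
    "exec c\<^sub>1 s v s''" "u = expr_cost b + 1 + v"
    by (cases rule: exec.cases) auto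
  with IfTrue.IH show ?case by metis
next
  case (IfFalse b s c\<^sub>2 t s' c\<^sub>1)
  from IfFalse.prems IfFalse.hyps(1) obtain v where
    "exec c\<^sub>2 s v s''" "u = expr_cost b + 1 + v"
    by (cases rule: exec.cases) auto
  with IfFalse.IH show ?case by metis
next
  case (WhileFalse b s c)
  from WhileFalse.prems WhileFalse.hyps show ?case
    by (cases rule: exec.cases) auto
next
  case (WhileTrue b s\<^sub>1 c t\<^sub>1 s\<^sub>2 t\<^sub>2 s\<^sub>3)
  from WhileTrue.prems WhileTrue.hyps(1) obtain v\<^sub>1 v\<^sub>2 r where
    "exec c s\<^sub>1 v\<^sub>1 r" "exec (WhilePos b c) r v\<^sub>2 s''" "u = expr_cost b + 1 + v\<^sub>1 + v\<^sub>2"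
    by (cases rule: exec.cases) auto
  with WhileTrue.IH show ?case by metis
qed

text \<open>
  The input word is in the memory cells with addresses \<open>0, 1, 2, \<dots>\<close>; everything else is \<open>0\<close>.
  The output is in register \<open>0\<close>.
\<close>

definition initial_config :: "int list \<Rightarrow> config" where
  "initial_config w =
     (\<lambda>x. 0, \<lambda>a. if 0 \<le> a \<and> a < int (length w) then w ! nat a else 0)"

definition outputs_within :: "com \<Rightarrow> int list \<Rightarrow> int \<Rightarrow> nat \<Rightarrow> bool" where
  "outputs_within c w r T \<longleftrightarrow>
     (\<exists>t s. exec c (initial_config w) t s \<and> fst s 0 = r \<and> t \<le> T)"

definition computable :: "(nat \<Rightarrow> nat) \<Rightarrow> bool" where
  "computable g \<longleftrightarrow> (\<exists>c. \<forall>n. \<exists>T. outputs_within c [int n] (int (g n)) T)"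

text \<open>The number of bits of a word, with one extra bit per entry for its sign.\<close>

definition input_size :: "int list \<Rightarrow> nat" where
  "input_size w = (\<Sum>z\<leftarrow>w. floorlog 2 (nat \<bar>z\<bar>) + 1)"


section \<open>Fixed-parameter tractability\<close>

text \<open>
  A parameterized problem is given by its set of instances, their encoding as input words, the set
  of yes-instances and the parameter. The parameter is not part of the input.
\<close>

definition fixed_parameter_tractable ::
    "'i set \<Rightarrow> ('i \<Rightarrow> int list) \<Rightarrow> 'i set \<Rightarrow> ('i \<Rightarrow> nat) \<Rightarrow> bool" where
  "fixed_parameter_tractable inst enc yes param \<longleftrightarrow>
     (\<exists>c g d. computable g \<and>
        (\<forall>I\<in>inst. outputs_within c (enc I) (if I \<in> yes then 1 else 0)
                    (g (param I) * input_size (enc I) ^ d)))"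


section \<open>Signed domination and neighbourhood diversity\<close>

text \<open>
  The locale \<^locale>\<open>pair_graph\<close> describes finite simple undirected graphs: a finite vertex set
  \<^term>\<open>pverts G\<close> and a symmetric irreflexive adjacency relation \<^term>\<open>parcs G\<close> on it.
\<close>

definition neighbourhood :: "'a pair_pre_digraph \<Rightarrow> 'a \<Rightarrow> 'a set" where
  "neighbourhood G u = {v. (u, v) \<in> parcs G}"

definition closed_neighbourhood :: "'a pair_pre_digraph \<Rightarrow> 'a \<Rightarrow> 'a set" where
  "closed_neighbourhood G u = neighbourhood G u \<union> {u}"

definition signed_dominating :: "'a pair_pre_digraph \<Rightarrow> ('a \<Rightarrow> int) \<Rightarrow> bool" where
  "signed_dominating G f \<longleftrightarrow>
     (\<forall>u\<in>pverts G. f u \<in> {-1, 1}) \<and>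
     (\<forall>u\<in>pverts G. (\<Sum>v\<in>closed_neighbourhood G u. f v) \<ge> 1)"

definition weight :: "'a pair_pre_digraph \<Rightarrow> ('a \<Rightarrow> int) \<Rightarrow> int" where
  "weight G f = (\<Sum>u\<in>pverts G. f u)"

definition same_type :: "'a pair_pre_digraph \<Rightarrow> 'a \<Rightarrow> 'a \<Rightarrow> bool" where
  "same_type G u v \<longleftrightarrow> neighbourhood G u - {v} = neighbourhood G v - {u}"

text \<open>
  The blocks of \<^const>\<open>partition_on\<close> are nonempty; allowing empty sets would not change the minimum.
\<close>

definition neighbourhood_diversity :: "'a pair_pre_digraph \<Rightarrow> nat" where
  "neighbourhood_diversity G =
     (LEAST t. \<exists>P. partition_on (pverts G) P \<and> card P = t \<and>
                   (\<forall>A\<in>P. \<forall>u\<in>A. \<forall>v\<in>A. same_type G u v))"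

type_synonym sd_instance = "nat pair_pre_digraph \<times> int"

definition sd_instances :: "sd_instance set" where
  "sd_instances = {(G, k). pair_graph G}"

definition sd_yes_instances :: "sd_instance set" where
  "sd_yes_instances =
     {(G, k). pair_graph G \<and> (\<exists>f. signed_dominating G f \<and> weight G f \<le> k)}"

text \<open>
  The number of vertices, the integer \<open>k\<close>, and the adjacency matrix row by row, with the vertices
  in increasing order.
\<close>

definition sd_encode :: "sd_instance \<Rightarrow> int list" where
  "sd_encode = (\<lambda>(G, k).
     let vs = sorted_list_of_set (pverts G) in
       int (length vs) # k #
         concat (map (\<lambda>u. map (\<lambda>v. if (u, v) \<in> parcs G then 1 else 0) vs) vs))"

end

theory Submission
  imports Defs
begin

text \<open>
  Choose one representative in each class of twins. Whether a sign function is dominating depends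
  only on the number \<open>y\<^sub>c\<close> of negative vertices in each class \<open>c\<close>, and once the set of classes with
  \<open>y\<^sub>c > 0\<close> is fixed (by guessing the signs of the representatives), the conditions are linear in
  \<open>y\<close>, with one inequality per class and coefficients \<open>0\<close> and \<open>1\<close>. If a feasible \<open>y\<close> is not of least
  weight, then its difference to a better feasible vector decomposes conformally, also with respect
  to the slacks, into integer vectors whose norm is bounded in terms of the number \<open>t\<close> of classes.
  One of these summands improves the weight and keeps feasibility. Hence local search over all
  moves of bounded norm reaches an optimum after at most \<open>n + 1\<close> rounds. With \<open>H = 3 ^ 2 ^ t\<close> a
  bound for the moves, the guesses and the moves are enumerated as numbers with \<open>t\<close> digits in base
  \<open>2 H\<close>; there are at most \<open>K = 3 ^ 2 ^ (2 t + 1)\<close> of them.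
\<close>

text \<open>Guessing the support removes the only nonlinearity: in an independent class the worst
  vertex contributes -1 or 1 according to whether the class has a negative vertex at all, and this
  is a constant once the support is fixed. The norm bound comes from cutting the difference vector
  into unit steps and unit slacks and grouping them into blocks that are balanced in every row. The
  rows are treated one after another, each roughly squaring the block size, whence the double
  exponential. Weights have the parity of \<open>n\<close> and lie between \<open>- n\<close> and
  \<open>n\<close>, so there are at most \<open>n\<close> strict improvements in a row. The bounds
  are iterated squares of 3 because the machine cannot multiply and is not told \<open>t\<close>: a
  number is squared by repeated addition, once for each representative that has been found. Every
  candidate is checked by recomputing its closed neighbourhood sums, so soundness does not rest on
  the enumeration of moves; the norm bound serves completeness.\<close>

section \<open>Conformal decompositions\<close>

text \<open>One-dimensional Steinitz argument: elements can be picked one by one with all partial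
  sums in \<open>[- M, M]\<close>, because the rest sums to minus the current partial sum and so
  contains an element of a favourable sign. Among the first \<open>2 * M + 2\<close> partial sums
  two coincide, and the elements picked between them sum to zero.\<close>

lemma zero_sum_subset:
  fixes w :: "'a \<Rightarrow> int" and M :: nat
  assumes fin: "finite P" and ne: "P \<noteq> {}" and zero: "sum w P = 0"
    and bound: "\<And>x. x \<in> P \<Longrightarrow> \<bar>w x\<bar> \<le> int M"
  shows "\<exists>S\<subseteq>P. S \<noteq> {} \<and> sum w S = 0 \<and> card S \<le> 2 * M + 1"
proof (cases "card P \<le> 2 * M + 1")
  case True
  then show ?thesis using ne zero by blast
next
  case False
  have step: "\<exists>x\<in>P - S. \<bar>sum w S + w x\<bar> \<le> int M"
    if S: "S \<subseteq> P" "card S < card P" "\<bar>sum w S\<bar> \<le> int M" for S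
  proof -
    have rest: "sum w (P - S) = - sum w S"
      using sum_diff[OF fin S(1), of w] zero by simp
    have nempty: "P - S \<noteq> {}" using S by auto
    show ?thesis
    proof (cases "sum w S \<le> 0")
      case True
      have "\<exists>x\<in>P - S. w x \<ge> 0"
      proof (rule ccontr)
        assume "\<not> ?thesis"
        then have "sum w (P - S) < 0"
          using sum_strict_mono[OF finite_Diff[OF fin] nempty, of w "\<lambda>_. 0"] by (simp add: not_le)
        then show False using rest True by linarith
      qed
      then obtain x where "x \<in> P - S" "w x \<ge> 0" by blast
      then show ?thesis using bound[of x] True S(3) by (intro bexI[of _ x]) auto
    next
      case False
      have "\<exists>x\<in>P - S. w x < 0"
      proof (rule ccontr)
        assume "\<not> ?thesis"
        then have "sum w (P - S) \<ge> 0" by (intro sum_nonneg) force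
        then show False using rest False by linarith
      qed
      then obtain x where "x \<in> P - S" "w x < 0" by blast
      then show ?thesis using bound[of x] False S(3) by (intro bexI[of _ x]) auto
    qed
  qed
  define pick where "pick S = (SOME x. x \<in> P - S \<and> \<bar>sum w S + w x\<bar> \<le> int M)" for S
  have pick: "pick S \<in> P - S \<and> \<bar>sum w S + w (pick S)\<bar> \<le> int M"
    if "S \<subseteq> P" "card S < card P" "\<bar>sum w S\<bar> \<le> int M" for S
    unfolding pick_def by (rule someI_ex) (use step[OF that] in blast)
  define F where "F i = ((\<lambda>S. insert (pick S) S) ^^ i) {}" for i
  have F_Suc: "F (Suc i) = insert (pick (F i)) (F i)" for i by (simp add: F_def)
  have F: "F i \<subseteq> P \<and> card (F i) = i \<and> \<bar>sum w (F i)\<bar> \<le> int M" if "i \<le> card P" for i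
    using that
  proof (induction i)
    case 0
    show ?case by (simp add: F_def)
  next
    case (Suc i)
    then have IH: "F i \<subseteq> P" "card (F i) = i" "\<bar>sum w (F i)\<bar> \<le> int M" by auto
    have fF: "finite (F i)" using IH(1) fin finite_subset by blast
    note p = pick[OF IH(1) _ IH(3)]
    show ?case using p Suc.prems IH fF by (simp add: F_Suc add.commute)
  qed
  have F_mono: "F i \<subseteq> F j" if "i \<le> j" for i j
    using that by (induction rule: dec_induct) (auto simp: F_Suc)
  have "\<not> inj_on (\<lambda>i. sum w (F i)) {..2 * M + 1}"
  proof (rule pigeonhole)
    have "(\<lambda>i. sum w (F i)) ` {..2 * M + 1} \<subseteq> {- int M..int M}"
    proof (rule image_subsetI)
      fix i assume "i \<in> {..2 * M + 1}"
      then have "\<bar>sum w (F i)\<bar> \<le> int M" using F[of i] False by auto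
      then show "sum w (F i) \<in> {- int M..int M}" by auto
    qed
    then have "card ((\<lambda>i. sum w (F i)) ` {..2 * M + 1}) \<le> card {- int M..int M}"
      by (intro card_mono) auto
    then show "card ((\<lambda>i. sum w (F i)) ` {..2 * M + 1}) < card {..2 * M + 1}" by simp
  qed
  then obtain i j where ij: "i < j" "j \<le> 2 * M + 1" "sum w (F i) = sum w (F j)"
    unfolding inj_on_def by (metis atMost_iff linorder_neqE_nat)
  have Fi: "F i \<subseteq> P" "card (F i) = i" and Fj: "F j \<subseteq> P" "card (F j) = j"
    using F[of i] F[of j] ij False by auto
  have fj: "finite (F j)" using Fj(1) fin finite_subset by blast
  have sub: "F i \<subseteq> F j" using F_mono ij by simp
  have "card (F j - F i) = j - i"
    using card_Diff_subset[OF finite_subset[OF sub fj] sub] Fi Fj by simp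
  moreover have "sum w (F j - F i) = 0" using sum_diff[OF fj sub, of w] ij by simp
  moreover from calculation have "F j - F i \<noteq> {}" using ij by (metis card.empty zero_less_diff less_irrefl)
  ultimately show ?thesis using Fj(1) ij by (intro exI[of _ "F j - F i"]) auto
qed

text \<open>Zero-sum subsets are split off until nothing is left; the remainder keeps sum zero and
  the bound on its weights.\<close>

lemma zero_sum_partition:
  fixes w :: "'a \<Rightarrow> int" and M :: nat
  assumes "finite P" "sum w P = 0" "\<And>x. x \<in> P \<Longrightarrow> \<bar>w x\<bar> \<le> int M"
  shows "\<exists>Q. partition_on P Q \<and> (\<forall>S\<in>Q. sum w S = 0 \<and> card S \<le> 2 * M + 1)"
  using assms
proof (induction P rule: finite_psubset_induct)
  case (psubset P)
  show ?case
  proof (cases "P = {}")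
    case True
    then show ?thesis by (intro exI[of _ "{}"]) (simp add: partition_on_empty)
  next
    case False
    obtain S where S: "S \<subseteq> P" "S \<noteq> {}" "sum w S = 0" "card S \<le> 2 * M + 1"
      using zero_sum_subset[OF psubset.hyps False psubset.prems] by blast
    have "sum w (P - S) = 0" using sum_diff[OF psubset.hyps S(1), of w] S psubset.prems by simp
    moreover have "P - S \<subset> P" using S by auto
    ultimately obtain Q where Q: "partition_on (P - S) Q"
        "\<forall>S\<in>Q. sum w S = 0 \<and> card S \<le> 2 * M + 1"
      using psubset.IH[of "P - S"] psubset.prems(2) by auto
    have "partition_on P (insert S Q)"
      using Q(1) S by (subst partition_on_insert[of "S"]) (auto simp: disjnt_def partition_on_def)
    then show ?thesis using Q S by blast
  qed
qed

text \<open>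
  Rows are treated one at a time: a block that is balanced for the first \<open>k\<close> rows has at most
  \<open>block_bound k\<close> elements, hence weight at most \<open>block_bound k\<close> in the next row, and at most
  \<open>2 * block_bound k + 1\<close> such blocks are merged to balance that row.
\<close>

fun block_bound :: "nat \<Rightarrow> nat" where
  "block_bound 0 = 1"
| "block_bound (Suc k) = (2 * block_bound k + 1) * block_bound k"

lemma sum_partition_on:
  assumes "finite E" "partition_on E Q"
  shows "sum f E = (\<Sum>S\<in>Q. sum f S)"
proof -
  have "\<forall>S\<in>Q. finite S" using assms finite_elements
    by (metis Sup_upper finite_subset partition_onD1)
  moreover have "\<forall>A\<in>Q. \<forall>B\<in>Q. A \<noteq> B \<longrightarrow> A \<inter> B = {}"
    using partition_onD2[OF assms(2)] by (auto simp: disjoint_def)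
  ultimately show ?thesis
    using partition_onD1[OF assms(2)] sum.Union_disjoint[of Q f] by (simp add: o_def)
qed

lemma zero_sum_partition_multi:
  fixes \<phi> :: "'i \<Rightarrow> 'a \<Rightarrow> int"
  assumes "finite I" "finite E" "\<And>i. i \<in> I \<Longrightarrow> sum (\<phi> i) E = 0"
    "\<And>i x. i \<in> I \<Longrightarrow> x \<in> E \<Longrightarrow> \<bar>\<phi> i x\<bar> \<le> 1"
  shows "\<exists>Q. partition_on E Q \<and>
    (\<forall>S\<in>Q. card S \<le> block_bound (card I) \<and> (\<forall>i\<in>I. sum (\<phi> i) S = 0))"
  using assms
proof (induction I rule: finite_induct)
  case empty
  show ?case by (intro exI[of _ "(\<lambda>x. {x}) ` E"]) (auto simp: partition_on_singletons)
next
  case (insert i I)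
  let ?B = "block_bound (card I)"
  obtain Q where Q: "partition_on E Q"
    "\<And>S. S \<in> Q \<Longrightarrow> card S \<le> ?B" "\<And>S j. S \<in> Q \<Longrightarrow> j \<in> I \<Longrightarrow> sum (\<phi> j) S = 0"
    using insert.IH insert.prems by (metis insertCI)
  have finQ: "finite Q" using finite_elements insert.prems(1) Q(1) by blast
  have finS: "finite S" if "S \<in> Q" for S
    using that insert.prems(1) Q(1) by (metis Sup_upper finite_subset partition_onD1)
  \<comment> \<open>The blocks of \<open>Q\<close> now play the role of the elements: a block has
    its total in row \<open>i\<close> as weight, which is at most its size.\<close>
  have "\<bar>sum (\<phi> i) S\<bar> \<le> int ?B" if "S \<in> Q" for S
  proof -
    have "S \<subseteq> E" using that partition_onD1[OF Q(1)] by blast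
    then have "\<bar>sum (\<phi> i) S\<bar> \<le> (\<Sum>x\<in>S. 1)"
      using insert.prems(3) by (intro order_trans[OF sum_abs] sum_mono) auto
    then show ?thesis using Q(2)[OF that] by simp
  qed
  moreover have "(\<Sum>S\<in>Q. sum (\<phi> i) S) = 0"
    using sum_partition_on[OF insert.prems(1) Q(1), of "\<phi> i"] insert.prems(2) by simp
  ultimately obtain P where P: "partition_on Q P"
    "\<And>T. T \<in> P \<Longrightarrow> (\<Sum>S\<in>T. sum (\<phi> i) S) = 0" "\<And>T. T \<in> P \<Longrightarrow> card T \<le> 2 * ?B + 1"
    using zero_sum_partition[OF finQ, of "sum (\<phi> i)" ?B] by blast
  have TQ: "T \<subseteq> Q" if "T \<in> P" for T using that partition_onD1[OF P(1)] by blast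
  have part: "partition_on (\<Union>T) T" if "T \<in> P" for T
    using TQ[OF that] Q(1) by (auto simp: partition_on_def disjoint_def)
  have finU: "finite (\<Union>T)" if "T \<in> P" for T
    using TQ[OF that] finQ finS finite_subset by (metis finite_Union subset_iff)
  have "partition_on E (Union ` P)"
  proof (rule partition_onI)
    show "\<Union> (Union ` P) = E"
      using partition_onD1[OF P(1)] partition_onD1[OF Q(1)] by auto
    show "{} \<notin> Union ` P"
    proof
      assume "{} \<in> Union ` P"
      then obtain T where T: "T \<in> P" "{} = \<Union>T" by (elim imageE)
      have "T \<noteq> {}" using partition_onD3[OF P(1)] T(1) by auto
      then obtain S where "S \<in> T" by auto
      then have "S = {}" "S \<in> Q" using T TQ by auto
      then show False using partition_onD3[OF Q(1)] by simp
    qed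
  next
    fix p p' assume p: "p \<in> Union ` P" and p': "p' \<in> Union ` P" and "p \<noteq> p'"
    obtain T where T: "T \<in> P" "p = \<Union>T" using p by (elim imageE)
    obtain T' where T': "T' \<in> P" "p' = \<Union>T'" using p' by (elim imageE)
    have "T \<noteq> T'" using \<open>p \<noteq> p'\<close> T T' by auto
    then have TT: "T \<inter> T' = {}" using partition_onD2[OF P(1)] T T' by (simp add: disjoint_def)
    have "A \<inter> B = {}" if AB: "A \<in> T" "B \<in> T'" for A B
    proof -
      have "A \<noteq> B" using AB TT by auto
      moreover have "A \<in> Q" "B \<in> Q" using AB TQ T(1) T'(1) by auto
      ultimately show ?thesis using partition_onD2[OF Q(1)] by (simp add: disjoint_def)
    qed
    then show "disjnt p p'" unfolding T(2) T'(2) disjnt_def by blast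
  qed
  moreover have "card (\<Union>T) \<le> block_bound (card (insert i I))"
      "\<And>j. j \<in> insert i I \<Longrightarrow> sum (\<phi> j) (\<Union>T) = 0" if T: "T \<in> P" for T
  proof -
    have "card (\<Union>T) \<le> (\<Sum>S\<in>T. card S)" by (rule card_Union_le_sum_card)
    also have "\<dots> \<le> of_nat (card T) * ?B" by (rule sum_bounded_above) (use Q(2) TQ T in blast)
    also have "\<dots> \<le> (2 * ?B + 1) * ?B" using P(3)[OF T] by (intro mult_right_mono) auto
    finally show "card (\<Union>T) \<le> block_bound (card (insert i I))" using insert.hyps by simp
    show "sum (\<phi> j) (\<Union>T) = 0" if "j \<in> insert i I" for j
    proof -
      have "sum (\<phi> j) (\<Union>T) = (\<Sum>S\<in>T. sum (\<phi> j) S)"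
        by (rule sum_partition_on[OF finU[OF T] part[OF T]])
      also have "\<dots> = 0"
      proof (cases "j = i")
        case False
        then have "sum (\<phi> j) S = 0" if "S \<in> T" for S
          using Q(3)[of S j] TQ[OF T] that \<open>j \<in> insert i I\<close> by auto
        then show ?thesis by (rule sum.neutral[OF ballI])
      qed (use P(2)[OF T] in simp)
      finally show ?thesis .
    qed
  qed
  ultimately show ?case by (intro exI[of _ "Union ` P"]) auto
qed

text \<open>The factor 3 makes the induction close: with \<open>b \<ge> 1\<close> one has
  \<open>2 * b + 1 \<le> 3 * b\<close>, so the tripled bound is at most squared in each step. The
  factor also makes the bound itself strictly smaller than \<open>3 ^ 2 ^ k\<close>, so that digits
  of absolute value below \<open>H\<close> cover all moves.\<close>

lemma block_bound_le: "3 * block_bound k \<le> 3 ^ 2 ^ k"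
proof (induction k)
  case (Suc k)
  let ?b = "block_bound k"
  have "?b \<ge> 1" by (induction k) auto
  then have "3 * block_bound (Suc k) \<le> (3 * ?b) * (3 * ?b)"
    by (simp add: mult_le_mono)
  also have "\<dots> \<le> 3 ^ 2 ^ k * 3 ^ 2 ^ k" by (intro mult_le_mono Suc.IH)
  also have "\<dots> = 3 ^ 2 ^ Suc k" by (simp add: power_add[symmetric] mult_2)
  finally show ?case .
qed simp

text \<open>The conformal order of integer programming, for a single coordinate.\<close>

definition between0 :: "int \<Rightarrow> int \<Rightarrow> bool" where
  "between0 x d \<longleftrightarrow> 0 \<le> x \<and> x \<le> d \<or> d \<le> x \<and> x \<le> 0"

lemma between0_sgn_mult: "j \<le> nat \<bar>d\<bar> \<Longrightarrow> between0 (sgn d * int j) d"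
  by (cases d "0::int" rule: linorder_cases) (auto simp: between0_def)

text \<open>The vectors of the blocks of a balanced partition add up to \<open>d\<close>, so their
  coordinate sums add up to \<open>sum d R > 0\<close> and one of them is positive. The condition on
  rows is what preserves feasibility: each row value of the step lies between that of no step and
  that of the full step \<open>d\<close>.\<close>

lemma conformal_step:
  fixes d :: "'c \<Rightarrow> int" and e :: "'c \<Rightarrow> 'c \<Rightarrow> bool"
  assumes fin: "finite R" and pos: "sum d R > 0"
  shows "\<exists>z. (\<forall>c\<in>R. \<bar>z c\<bar> \<le> int (block_bound (card R)) \<and> between0 (z c) (d c)) \<and> sum z R > 0 \<and>
    (\<forall>r\<in>R. between0 (\<Sum>c\<in>{c\<in>R. e r c}. z c) (\<Sum>c\<in>{c\<in>R. e r c}. d c))"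
proof -
  \<comment> \<open>\<open>V c\<close> holds the unit steps of coordinate \<open>c\<close>, and \<open>W r\<close> the unit slacks of row \<open>r\<close> with opposite
    sign; every block of a zero-sum partition then moves each slack in the direction of \<open>s r\<close>.\<close>
  define s where "s r = (\<Sum>c\<in>{c\<in>R. e r c}. d c)" for r
  define V where "V c = {(True, c, i) | i. i < nat \<bar>d c\<bar>}" for c
  define W where "W r = {(False, r, i) | i. i < nat \<bar>s r\<bar>}" for r
  have V_img: "V c = (\<lambda>i. (True, c, i)) ` {..<nat \<bar>d c\<bar>}"
    and W_img: "W c = (\<lambda>i. (False, c, i)) ` {..<nat \<bar>s c\<bar>}" for c
    by (auto simp: V_def W_def)
  have finV: "finite (V c)" and finW: "finite (W c)" for c
    by (simp_all add: V_img W_img)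
  have cardV: "card (V c) = nat \<bar>d c\<bar>" and cardW: "card (W c) = nat \<bar>s c\<bar>" for c
    by (simp_all add: V_img W_img card_image inj_on_def)
  define E where "E = (\<Union>c\<in>R. V c) \<union> (\<Union>r\<in>R. W r)"
  have finE: "finite E" using fin finV finW by (simp add: E_def)
  define \<phi> where "\<phi> r = (\<lambda>(b, c, i::nat).
    if b then (if e r c then sgn (d c) else 0) else if c = r then - sgn (s r) else 0)" for r
  \<comment> \<open>In row \<open>r\<close> the weight of \<open>S\<close> is the row value of the
    unit steps in \<open>S\<close> minus the signed number of slack units in \<open>S\<close>;
    weight zero says that the two agree.\<close>
  have sum_\<phi>: "sum (\<phi> r) S =
      (\<Sum>c\<in>{c\<in>R. e r c}. sgn (d c) * int (card (S \<inter> V c))) - sgn (s r) * int (card (S \<inter> W r))"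
    if "S \<subseteq> E" "r \<in> R" for S r
  proof -
    have finS: "finite S" using that(1) finE finite_subset by blast
    have "S = (\<Union>c\<in>R. S \<inter> V c) \<union> (\<Union>c\<in>R. S \<inter> W c)" using that(1) by (auto simp: E_def)
    then have "sum (\<phi> r) S = sum (\<phi> r) ((\<Union>c\<in>R. S \<inter> V c) \<union> (\<Union>c\<in>R. S \<inter> W c))" by simp
    also have "\<dots> = sum (\<phi> r) (\<Union>c\<in>R. S \<inter> V c) + sum (\<phi> r) (\<Union>c\<in>R. S \<inter> W c)"
      using fin finS by (intro sum.union_disjoint) (auto simp: V_def W_def)
    also have "sum (\<phi> r) (\<Union>c\<in>R. S \<inter> V c) = (\<Sum>c\<in>R. sum (\<phi> r) (S \<inter> V c))"
      using fin finS by (intro sum.UNION_disjoint) (auto simp: V_def)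
    also have "\<dots> = (\<Sum>c\<in>R. if e r c then sgn (d c) * int (card (S \<inter> V c)) else 0)"
    proof (rule sum.cong[OF refl])
      fix c
      have "sum (\<phi> r) (S \<inter> V c) = (\<Sum>x\<in>S \<inter> V c. if e r c then sgn (d c) else 0)"
        by (rule sum.cong) (auto simp: V_def \<phi>_def)
      then show "sum (\<phi> r) (S \<inter> V c) = (if e r c then sgn (d c) * int (card (S \<inter> V c)) else 0)"
        by simp
    qed
    also have "\<dots> = (\<Sum>c\<in>{c\<in>R. e r c}. sgn (d c) * int (card (S \<inter> V c)))"
      using fin by (simp add: sum.inter_filter)
    also have "sum (\<phi> r) (\<Union>c\<in>R. S \<inter> W c) = (\<Sum>c\<in>R. sum (\<phi> r) (S \<inter> W c))"
      using fin finS by (intro sum.UNION_disjoint) (auto simp: W_def)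
    also have "\<dots> = (\<Sum>c\<in>R. if c = r then - sgn (s r) * int (card (S \<inter> W r)) else 0)"
    proof (rule sum.cong[OF refl])
      fix c
      have "sum (\<phi> r) (S \<inter> W c) = (\<Sum>x\<in>S \<inter> W c. if c = r then - sgn (s r) else 0)"
        by (rule sum.cong) (auto simp: W_def \<phi>_def)
      then show "sum (\<phi> r) (S \<inter> W c) = (if c = r then - sgn (s r) * int (card (S \<inter> W r)) else 0)"
        by simp
    qed
    also have "\<dots> = - sgn (s r) * int (card (S \<inter> W r))" using fin that(2) by simp
    finally show ?thesis by simp
  qed
  have EV: "E \<inter> V c = V c" and EW: "E \<inter> W c = W c" if "c \<in> R" for c
    using that by (auto simp: E_def)
  have zero: "sum (\<phi> r) E = 0" if "r \<in> R" for r
  proof -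
    have "(\<Sum>c\<in>{c\<in>R. e r c}. sgn (d c) * int (card (E \<inter> V c))) = s r"
      unfolding s_def by (rule sum.cong) (auto simp: EV cardV sgn_mult_abs)
    then show ?thesis
      using sum_\<phi>[of E r] that by (simp add: EW cardW sgn_mult_abs)
  qed
  have unit: "\<bar>\<phi> r x\<bar> \<le> 1" for r x
    by (cases x) (simp add: \<phi>_def sgn_if)
  obtain Q where Q: "partition_on E Q" "\<And>S. S \<in> Q \<Longrightarrow> card S \<le> block_bound (card R)"
      "\<And>S r. S \<in> Q \<Longrightarrow> r \<in> R \<Longrightarrow> sum (\<phi> r) S = 0"
    using zero_sum_partition_multi[of R E \<phi>, OF fin finE zero unit] by blast
  have QE: "S \<subseteq> E" if "S \<in> Q" for S using that partition_onD1[OF Q(1)] by auto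
  define z where "z S c = sgn (d c) * int (card (S \<inter> V c))" for S c
  \<comment> \<open>Each unit step of coordinate \<open>c\<close> lies in exactly one block, so the
    vectors \<open>z S\<close> add up to \<open>d\<close> on \<open>R\<close>.\<close>
  have "(\<Sum>S\<in>Q. sum (z S) R) = (\<Sum>c\<in>R. \<Sum>S\<in>Q. z S c)" by (rule sum.swap)
  also have "\<dots> = sum d R"
  proof (rule sum.cong[OF refl])
    fix c assume "c \<in> R"
    have "int (card (S \<inter> V c)) = (\<Sum>x\<in>S. if x \<in> V c then 1 else 0)" if "S \<in> Q" for S
      using finite_subset[OF QE[OF that] finE] by (simp add: sum.If_cases)
    then have "(\<Sum>S\<in>Q. int (card (S \<inter> V c))) = (\<Sum>S\<in>Q. \<Sum>x\<in>S. if x \<in> V c then 1 else 0)"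
      by (rule sum.cong[OF refl])
    also have "\<dots> = (\<Sum>x\<in>E. if x \<in> V c then 1 else 0)"
      by (rule sum_partition_on[OF finE Q(1), symmetric])
    also have "\<dots> = \<bar>d c\<bar>" using finE EV[OF \<open>c \<in> R\<close>] by (simp add: sum.If_cases cardV)
    finally show "(\<Sum>S\<in>Q. z S c) = d c"
      by (simp add: z_def sum_distrib_left[symmetric] sgn_mult_abs)
  qed
  finally have "(\<Sum>S\<in>Q. sum (z S) R) > 0" using pos by simp
  then obtain S where S: "S \<in> Q" "sum (z S) R > 0"
    by (meson sum_nonpos not_le)
  have finS: "finite S" using finite_subset[OF QE[OF S(1)] finE] .
  have "\<bar>z S c\<bar> \<le> int (block_bound (card R))" for c
  proof -
    have "\<bar>z S c\<bar> \<le> int (card (S \<inter> V c))" by (simp add: z_def abs_mult sgn_if)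
    also have "\<dots> \<le> int (card S)" using finS by (simp add: card_mono)
    finally show ?thesis using Q(2)[OF S(1)] by simp
  qed
  moreover have "between0 (z S c) (d c)" for c
    unfolding z_def by (rule between0_sgn_mult) (metis card_mono finV cardV inf_le2)
  \<comment> \<open>Balance turns the row value into a number of slack units, all of sign
    \<open>sgn (s r)\<close> and at most \<open>\<bar>s r\<bar>\<close> many.\<close>
  moreover have "between0 (\<Sum>c\<in>{c\<in>R. e r c}. z S c) (s r)" if "r \<in> R" for r
  proof -
    have "(\<Sum>c\<in>{c\<in>R. e r c}. z S c) = sgn (s r) * int (card (S \<inter> W r))"
      using sum_\<phi>[OF QE[OF S(1)] that] Q(3)[OF S(1) that] by (simp add: z_def)
    moreover have "card (S \<inter> W r) \<le> nat \<bar>s r\<bar>" by (metis card_mono finW cardW inf_le2)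
    ultimately show ?thesis by (simp add: between0_sgn_mult)
  qed
  ultimately show ?thesis using S(2) unfolding s_def by blast
qed

section \<open>Twin classes and local search\<close>

text \<open>In increasing order the elements with \<open>P\<close> have ranks 0, 1, 2, ..., so the
  ranks below \<open>m\<close> belong to the first \<open>m\<close> of them, or to all if there are
  fewer. This is how the values -1 of a canonical sign function are counted.\<close>

lemma card_rank_less:
  fixes P :: "nat \<Rightarrow> bool" and m :: int
  assumes "0 \<le> m"
  shows "int (card {v. v < n \<and> P v \<and> int (card {u. u < v \<and> P u}) < m}) = min m (int (card {v. v < n \<and> P v}))"
proof (induction n)
  case (Suc n)
  let ?Q = "\<lambda>v. P v \<and> int (card {u. u < v \<and> P u}) < m"
  have *: "{v. v < Suc n \<and> Q v} = (if Q n then insert n {v. v < n \<and> Q v} else {v. v < n \<and> Q v})" for Q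
    by (auto simp: less_Suc_eq)
  show ?case using Suc.IH by (subst *[of ?Q], subst *[of P]) auto
qed (use assms in simp)

text \<open>The step function receives its index, as the body of a counting loop does; the abstract
  search and the semantics of programs are thus terms of the same kind.\<close>

fun iter :: "(nat \<Rightarrow> 's \<Rightarrow> 's) \<Rightarrow> nat \<Rightarrow> 's \<Rightarrow> 's" where
  "iter g 0 s = s"
| "iter g (Suc m) s = g m (iter g m s)"

lemma iter_invariant:
  assumes "P 0 s" "\<And>j s. P j s \<Longrightarrow> P (Suc j) (g j s)"
  shows "P m (iter g m s)"
  by (induction m) (use assms in auto)

locale index_graph =
  fixes n :: nat and a :: "nat \<Rightarrow> nat \<Rightarrow> bool"
  assumes a_sym: "a u v \<Longrightarrow> a v u" and a_irrefl: "\<not> a u u"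
begin

text \<open>The same-type relation for numbered vertices. Only third vertices are compared, so twins
  may or may not be adjacent.\<close>

definition twin :: "nat \<Rightarrow> nat \<Rightarrow> bool" where
  "twin u v \<longleftrightarrow> (\<forall>w<n. w \<noteq> u \<longrightarrow> w \<noteq> v \<longrightarrow> (a u w \<longleftrightarrow> a v w))"

definition rep :: "nat \<Rightarrow> nat" where "rep v = (LEAST u. twin u v)"

definition reps :: "nat set" where "reps = {v. v < n \<and> rep v = v}"

lemma twin_refl [simp]: "twin u u" by (simp add: twin_def)

lemma twin_sym: "twin u v \<Longrightarrow> twin v u" by (auto simp: twin_def)

text \<open>The delicate test vertex is \<open>x = v\<close>, of which neither hypothesis speaks
  directly. There the adjacency is carried round the triangle, by \<open>twin v w\<close> at
  \<open>u\<close> and \<open>twin u v\<close> at \<open>w\<close>, joined by symmetry of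
  \<open>a\<close>.\<close>

lemma twin_trans:
  assumes "twin u v" "twin v w" "u < n" "v < n" "w < n"
  shows "twin u w"
  unfolding twin_def
proof (intro allI impI)
  fix x assume x: "x < n" "x \<noteq> u" "x \<noteq> w"
  show "a u x \<longleftrightarrow> a w x"
  proof (cases "x = v")
    case False
    then show ?thesis using assms x by (simp add: twin_def)
  next
    case True
    show ?thesis
    proof (cases "u = w")
      case False
      then have "a v u \<longleftrightarrow> a w u" "a u w \<longleftrightarrow> a v w" using assms True x by (auto simp: twin_def)
      then show ?thesis using True a_sym by blast
    qed simp
  qed
qed

lemma rep_le: "rep v \<le> v" by (simp add: rep_def Least_le)

lemma twin_rep: "twin (rep v) v" unfolding rep_def by (rule LeastI[of _ v]) simp

lemma rep_less [simp]: "v < n \<Longrightarrow> rep v < n" using rep_le le_less_trans by blast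

lemma rep_eq:
  assumes "twin u v" "u < n" "v < n"
  shows "rep u = rep v"
proof -
  have "rep u \<le> rep v" if "twin v u" "u < n" "v < n" for u v
    using twin_trans[OF twin_rep[of v] that(1)] that by (simp add: rep_def[of u] Least_le)
  then show ?thesis using assms twin_sym by (metis le_antisym)
qed

lemma twin_iff_rep:
  assumes "u < n" "v < n"
  shows "twin u v \<longleftrightarrow> rep u = rep v"
proof
  assume "rep u = rep v"
  then have "twin u (rep v)" using twin_sym[OF twin_rep[of u]] by simp
  then show "twin u v" using twin_trans[OF _ twin_rep] assms by simp
qed (use assms rep_eq in blast)

lemma rep_rep [simp]: "v < n \<Longrightarrow> rep (rep v) = rep v"
  by (rule rep_eq[OF twin_rep rep_less])

lemma rep_in_reps [simp]: "v < n \<Longrightarrow> rep v \<in> reps"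
  by (simp add: reps_def)

lemma finite_reps [simp]: "finite reps" by (simp add: reps_def)

lemma reps_less: "c \<in> reps \<Longrightarrow> c < n" and rep_reps: "c \<in> reps \<Longrightarrow> rep c = c"
  by (simp_all add: reps_def)

text \<open>
  For \<open>r = c\<close> this says that the class is a clique with at least two vertices.
\<close>

definition class_adj :: "nat \<Rightarrow> nat \<Rightarrow> bool" where
  "class_adj r c \<longleftrightarrow> (\<exists>w<n. w \<noteq> r \<and> rep w = c \<and> a r w)"

text \<open>The endpoints are replaced one at a time. If \<open>u' = w\<close>, replacing
  \<open>u\<close> first would produce a loop, so \<open>w\<close> goes first; if moreover
  \<open>u = w'\<close>, the edge is merely reversed.\<close>

lemma adj_twins:
  assumes "twin u u'" "twin w w'" "u < n" "u' < n" "w < n" "w' < n" "u \<noteq> w" "u' \<noteq> w'" "a u w"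
  shows "a u' w'"
proof (cases "u' = w")
  case False
  then have "a u' w" using assms by (auto simp: twin_def)
  then have "a w u'" using a_sym by blast
  then have "a w' u'" using assms False by (auto simp: twin_def)
  then show ?thesis using a_sym by blast
next
  case True
  show ?thesis
  proof (cases "u = w'")
    case False
    have "a w u" using assms a_sym by blast
    then have "a w' u" using assms False by (auto simp: twin_def)
    then have "a u w'" using a_sym by blast
    then show ?thesis using assms False by (auto simp: twin_def)
  next
    case T: True
    then show ?thesis using True assms a_sym by blast
  qed
qed

lemma adj_iff_class_adj:
  assumes "u < n" "w < n" "w \<noteq> u"
  shows "a u w \<longleftrightarrow> class_adj (rep u) (rep w)"
proof
  assume L: "a u w"
  show "class_adj (rep u) (rep w)"
  proof (cases "rep u = rep w")
    case False
    then have "a (rep u) w"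
      using adj_twins[of u "rep u" w w] L assms twin_rep twin_sym rep_less rep_eq by (metis twin_refl)
    then show ?thesis unfolding class_adj_def using assms False a_irrefl by metis
  next
    case True
    \<comment> \<open>Within one class the representative needs a second vertex; \<open>w'\<close>
      is one of \<open>u\<close> and \<open>w\<close> that differs from it.\<close>
    define w' where "w' = (if rep u = u then w else u)"
    have w': "rep w' = rep u" "w' < n" "w' \<noteq> rep u" "w' \<noteq> w \<or> rep u \<noteq> w"
      using assms True by (auto simp: w'_def)
    have "twin u (rep u)" "twin w w'"
      using w' True assms by (simp_all add: twin_iff_rep twin_sym[OF twin_rep])
    then have "a (rep u) w'" using adj_twins[of u "rep u" w w'] L assms w' by auto
    then show ?thesis using w' True unfolding class_adj_def by metis
  qed
next
  assume "class_adj (rep u) (rep w)"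
  then obtain w' where w': "w' < n" "w' \<noteq> rep u" "rep w' = rep w" "a (rep u) w'"
    unfolding class_adj_def by blast
  have "twin w' w" using w' assms twin_iff_rep by auto
  then show "a u w" using adj_twins[of "rep u" u w' w] w' assms twin_rep by auto
qed

section \<open>Signed domination in terms of counts per class\<close>

definition signs :: "(nat \<Rightarrow> int) \<Rightarrow> bool" where "signs f \<longleftrightarrow> (\<forall>v<n. f v = -1 \<or> f v = 1)"

definition closed_sum :: "(nat \<Rightarrow> int) \<Rightarrow> nat \<Rightarrow> int" where
  "closed_sum f u = (\<Sum>v<n. if v = u \<or> a u v then f v else 0)"

definition sd :: "(nat \<Rightarrow> int) \<Rightarrow> bool" where
  "sd f \<longleftrightarrow> signs f \<and> (\<forall>u<n. closed_sum f u \<ge> 1)"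

definition total_sign :: "(nat \<Rightarrow> int) \<Rightarrow> int" where "total_sign f = (\<Sum>v<n. f v)"

definition negs :: "(nat \<Rightarrow> int) \<Rightarrow> nat \<Rightarrow> int" where
  "negs f c = int (card {v. v < n \<and> rep v = c \<and> f v = -1})"

definition csize :: "nat \<Rightarrow> int" where "csize c = int (card {v. v < n \<and> rep v = c})"

lemma class_sum:
  assumes "signs f"
  shows "(\<Sum>v\<in>{v. v < n \<and> rep v = c}. f v) = csize c - 2 * negs f c"
proof -
  have "(\<Sum>v\<in>{v. v < n \<and> rep v = c}. f v) = (\<Sum>v\<in>{v. v < n \<and> rep v = c}. 1 - (if f v = -1 then 2 else 0))"
    using assms by (intro sum.cong) (auto simp: signs_def)
  also have "\<dots> = csize c - (\<Sum>v\<in>{v. v < n \<and> rep v = c}. if f v = -1 then 2 else 0)"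
    by (simp add: sum_subtractf csize_def)
  also have "(\<Sum>v\<in>{v. v < n \<and> rep v = c}. if f v = -1 then 2 else (0::int)) = 2 * negs f c"
    by (simp add: sum.If_cases negs_def Int_def conj_assoc)
  finally show ?thesis .
qed

lemma sum_by_class:
  "(\<Sum>v<n. g v) = (\<Sum>c\<in>reps. \<Sum>v\<in>{v. v < n \<and> rep v = c}. g v)"
  using sum.group[of "{..<n}" reps rep g] by (simp add: image_subset_iff)

lemma closed_sum_eq:
  assumes "signs f" "u < n"
  shows "closed_sum f u = (\<Sum>c\<in>{c\<in>reps. class_adj (rep u) c}. csize c - 2 * negs f c) +
    (if class_adj (rep u) (rep u) then 0 else f u)"
proof -
  let ?e = "class_adj (rep u)"
  \<comment> \<open>If the class of \<open>u\<close> is a clique with at least two vertices, the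
    first summand already counts \<open>u\<close>; the second one supplies \<open>f u\<close> in the
    other case.\<close>
  have "closed_sum f u = (\<Sum>v<n. (if ?e (rep v) then f v else 0) +
      (if v = u then (if ?e (rep u) then 0 else f u) else 0))"
    unfolding closed_sum_def
    by (rule sum.cong) (auto simp: adj_iff_class_adj[OF \<open>u < n\<close>])
  also have "\<dots> = (\<Sum>v<n. if ?e (rep v) then f v else 0) + (if ?e (rep u) then 0 else f u)"
    using assms(2) by (simp add: sum.distrib)
  also have "(\<Sum>v<n. if ?e (rep v) then f v else 0) =
      (\<Sum>c\<in>reps. \<Sum>v\<in>{v. v < n \<and> rep v = c}. if ?e (rep v) then f v else 0)"
    by (rule sum_by_class)
  also have "\<dots> = (\<Sum>c\<in>reps. if ?e c then csize c - 2 * negs f c else 0)"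
  proof (rule sum.cong[OF refl])
    fix c
    have "(\<Sum>v\<in>{v. v < n \<and> rep v = c}. if ?e (rep v) then f v else 0) =
        (\<Sum>v\<in>{v. v < n \<and> rep v = c}. if ?e c then f v else 0)"
      by (rule sum.cong) auto
    then show "(\<Sum>v\<in>{v. v < n \<and> rep v = c}. if ?e (rep v) then f v else 0) =
        (if ?e c then csize c - 2 * negs f c else 0)"
      using class_sum[OF assms(1)] by simp
  qed
  also have "\<dots> = (\<Sum>c\<in>{c\<in>reps. ?e c}. csize c - 2 * negs f c)"
    by (simp add: sum.inter_filter)
  finally show ?thesis .
qed

text \<open>
  A row is the domination condition at a vertex of the class with the smallest sign. In an
  independent class that sign enters on its own, whereas in a clique it is part of the class sum.
\<close>

definition feasible :: "(nat \<Rightarrow> int) \<Rightarrow> bool" where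
  "feasible y \<longleftrightarrow> (\<forall>r\<in>reps. (\<Sum>c\<in>{c\<in>reps. class_adj r c}. csize c - 2 * y c) +
     (if class_adj r r then 0 else if y r > 0 then -1 else 1) \<ge> 1)"

lemma negs_pos_iff: "negs f c > 0 \<longleftrightarrow> (\<exists>v<n. rep v = c \<and> f v = -1)"
  by (auto simp: negs_def card_gt_0_iff)

lemma sd_iff_feasible:
  assumes "signs f"
  shows "sd f \<longleftrightarrow> feasible (negs f)"
proof
  assume sd: "sd f"
  show "feasible (negs f)"
    unfolding feasible_def
  proof
    fix r assume r: "r \<in> reps"
    \<comment> \<open>A vertex of the class with the smallest sign: a negative one if there is any,
      and otherwise the representative.\<close>
    obtain u where u: "u < n" "rep u = r" "negs f r > 0 \<longrightarrow> f u = -1"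
      using r reps_less rep_reps negs_pos_iff by metis
    have "f u \<le> (if negs f r > 0 then -1 else 1)"
      using assms u by (auto simp: signs_def)
    moreover have "closed_sum f u \<ge> 1" using sd u by (simp add: sd_def)
    ultimately show "1 \<le> (\<Sum>c\<in>{c\<in>reps. class_adj r c}. csize c - 2 * negs f c) +
        (if class_adj r r then 0 else if negs f r > 0 then -1 else 1)"
      using closed_sum_eq[OF assms u(1)] u(2) by (auto split: if_splits)
  qed
next
  assume fe: "feasible (negs f)"
  have "closed_sum f u \<ge> 1" if u: "u < n" for u
  proof -
    have "f u \<ge> (if negs f (rep u) > 0 then -1 else 1)"
      using assms u negs_pos_iff[of f "rep u"] by (auto simp: signs_def)
    then show ?thesis
      using closed_sum_eq[OF assms u] bspec[OF fe[unfolded feasible_def] rep_in_reps[OF u]]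
      by (auto split: if_splits)
  qed
  then show "sd f" using assms by (simp add: sd_def)
qed

lemma total_sign_eq:
  assumes "signs f"
  shows "total_sign f = int n - 2 * sum (negs f) reps"
proof -
  have "int n = (\<Sum>v<n. 1)" by simp
  also have "\<dots> = sum csize reps" by (subst sum_by_class) (simp add: csize_def)
  finally have "int n = sum csize reps" .
  moreover have "total_sign f = (\<Sum>c\<in>reps. csize c - 2 * negs f c)"
    unfolding total_sign_def by (subst sum_by_class) (simp add: class_sum[OF assms])
  ultimately show ?thesis by (simp add: sum_subtractf sum_distrib_left)
qed

text \<open>Within each class the values \<open>-1\<close> come first.\<close>

definition canon :: "(nat \<Rightarrow> int) \<Rightarrow> nat \<Rightarrow> int" where
  "canon y v = (if int (card {u. u < v \<and> rep u = rep v}) < y (rep v) then -1 else 1)"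

lemma signs_canon [simp]: "signs (canon y)" by (simp add: signs_def canon_def)

lemma negs_canon:
  assumes "0 \<le> y c" "y c \<le> csize c"
  shows "negs (canon y) c = y c"
proof -
  have "{v. v < n \<and> rep v = c \<and> canon y v = -1} =
      {v. v < n \<and> rep v = c \<and> int (card {u. u < v \<and> rep u = c}) < y c}"
    by (auto simp: canon_def)
  then show ?thesis
    using card_rank_less[of "y c" n "\<lambda>v. rep v = c"] assms by (simp add: negs_def csize_def)
qed

text \<open>The representative is the least vertex of its class and so has rank 0.\<close>

lemma canon_rep: "c \<in> reps \<Longrightarrow> canon y c = (if y c > 0 then -1 else 1)"
proof -
  assume c: "c \<in> reps"
  have "u \<notin> {u. u < c \<and> rep u = c}" for u using rep_le[of u] by auto
  then have empty: "{u. u < c \<and> rep u = c} = {}" by auto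
  show ?thesis unfolding canon_def rep_reps[OF c] empty by simp
qed

lemma negs_bounds: "0 \<le> negs f c" "negs f c \<le> csize c"
  unfolding negs_def csize_def by (auto simp only: of_nat_le_iff of_nat_0_le_iff intro!: card_mono)

text \<open>The representative shows whether its class has any negative vertex. For such functions,
  equal signs on \<open>reps\<close> mean equal supports, which turns the condition on the support
  into a test that a program can perform.\<close>

definition led :: "(nat \<Rightarrow> int) \<Rightarrow> bool" where
  "led f \<longleftrightarrow> (\<forall>c\<in>reps. f c = (if negs f c > 0 then -1 else 1))"

lemma led_canon: "led (canon y)"
  unfolding led_def
proof
  fix c assume c: "c \<in> reps"
  show "canon y c = (if negs (canon y) c > 0 then -1 else 1)"
  proof (cases "y c > 0")
    case True
    then have "negs (canon y) c > 0"
      using c canon_rep[OF c, of y] reps_less rep_reps by (auto simp: negs_pos_iff)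
    then show ?thesis using True canon_rep[OF c] by simp
  next
    case False
    then have "\<not> negs (canon y) c > 0" by (auto simp: negs_pos_iff canon_def)
    then show ?thesis using False canon_rep[OF c] by simp
  qed
qed

definition move :: "(nat \<Rightarrow> int) \<Rightarrow> (nat \<Rightarrow> int) \<Rightarrow> nat \<Rightarrow> int" where
  "move f z = canon (\<lambda>c. negs f c + z c)"

definition acceptable :: "(nat \<Rightarrow> int) \<Rightarrow> (nat \<Rightarrow> int) \<Rightarrow> bool" where
  "acceptable f f' \<longleftrightarrow> sd f' \<and> (\<forall>c\<in>reps. f' c = f c)"

definition same_support :: "(nat \<Rightarrow> int) \<Rightarrow> (nat \<Rightarrow> int) \<Rightarrow> bool" where
  "same_support f g \<longleftrightarrow> (\<forall>c\<in>reps. negs f c > 0 \<longleftrightarrow> negs g c > 0)"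

lemma feasible_cong:
  assumes "\<And>c. c \<in> reps \<Longrightarrow> y c = y' c"
  shows "feasible y \<longleftrightarrow> feasible y'"
proof -
  have "(\<Sum>c\<in>{c\<in>reps. class_adj r c}. csize c - 2 * y c) = (\<Sum>c\<in>{c\<in>reps. class_adj r c}. csize c - 2 * y' c)" for r
    by (rule sum.cong) (simp_all add: assms)
  then show ?thesis using assms by (simp add: feasible_def)
qed

lemma acceptable_move:
  assumes "led f" "feasible (\<lambda>c. negs f c + z c)"
    "\<And>c. c \<in> reps \<Longrightarrow> 0 \<le> negs f c + z c \<and> negs f c + z c \<le> csize c"
    "\<And>c. c \<in> reps \<Longrightarrow> negs f c + z c > 0 \<longleftrightarrow> negs f c > 0"
  shows "acceptable f (move f z)" "sum (negs (move f z)) reps = sum (negs f) reps + sum z reps"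
proof -
  have n: "negs (move f z) c = negs f c + z c" if "c \<in> reps" for c
    unfolding move_def using assms(3)[OF that] by (intro negs_canon) auto
  have "sd (move f z)"
    using assms(2) feasible_cong[OF n] sd_iff_feasible[of "move f z"] by (simp add: move_def)
  moreover have "move f z c = f c" if "c \<in> reps" for c
    using assms(1,4) that by (simp add: move_def canon_rep led_def)
  ultimately show "acceptable f (move f z)" by (simp add: acceptable_def)
  show "sum (negs (move f z)) reps = sum (negs f) reps + sum z reps"
    using n by (simp add: sum.distrib)
qed

text \<open>Let \<open>d\<close> be the difference of the counts of \<open>g\<close> and
  \<open>f\<close>, and \<open>z\<close> a conformal summand with positive sum. In each class the
  new count lies between those of \<open>f\<close> and \<open>g\<close>; so it is in range, and it
  is positive exactly when both are. Equal supports also give \<open>f\<close>, \<open>g\<close> and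
  the new function the same constant term in each row.\<close>

lemma improving_move:
  assumes f: "sd f" "led f" and g: "sd g" and supp: "same_support f g" and less: "total_sign g < total_sign f"
  shows "\<exists>z. (\<forall>c\<in>reps. \<bar>z c\<bar> \<le> int (block_bound (card reps))) \<and>
    acceptable f (move f z) \<and> total_sign (move f z) < total_sign f"
proof -
  have signs: "signs f" "signs g" using f g by (auto simp: sd_def)
  define d where "d c = negs g c - negs f c" for c
  have "sum d reps > 0" using less signs by (simp add: total_sign_eq d_def sum_subtractf)
  then obtain z where z: "\<And>c. c \<in> reps \<Longrightarrow> \<bar>z c\<bar> \<le> int (block_bound (card reps))"
      "\<And>c. c \<in> reps \<Longrightarrow> between0 (z c) (d c)" "sum z reps > 0"
      "\<And>r. r \<in> reps \<Longrightarrow> between0 (\<Sum>c\<in>{c\<in>reps. class_adj r c}. z c) (\<Sum>c\<in>{c\<in>reps. class_adj r c}. d c)"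
    using conformal_step[of reps d class_adj] by auto
  have supp': "negs f c + z c > 0 \<longleftrightarrow> negs f c > 0" if "c \<in> reps" for c
  proof -
    have "negs f c > 0 \<longleftrightarrow> negs g c > 0" using supp that by (simp add: same_support_def)
    then show ?thesis
      using z(2)[OF that] negs_bounds(1)[of f c] negs_bounds(1)[of g c]
      unfolding d_def between0_def by linarith
  qed
  have "feasible (\<lambda>c. negs f c + z c)"
    unfolding feasible_def
  proof
    fix r assume r: "r \<in> reps"
    let ?C = "{c\<in>reps. class_adj r c}"
    have eq: "(\<Sum>c\<in>?C. csize c - 2 * (y c + x c)) = (\<Sum>c\<in>?C. csize c - 2 * y c) - 2 * (\<Sum>c\<in>?C. x c)" for y x
      by (simp add: sum_subtractf sum_distrib_left sum.distrib algebra_simps)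
    have "(\<Sum>c\<in>?C. csize c - 2 * negs g c) = (\<Sum>c\<in>?C. csize c - 2 * negs f c) - 2 * (\<Sum>c\<in>?C. d c)"
      using eq[of "negs f" d] by (simp add: d_def)
    moreover have "(\<Sum>c\<in>?C. csize c - 2 * (negs f c + z c)) = (\<Sum>c\<in>?C. csize c - 2 * negs f c) - 2 * (\<Sum>c\<in>?C. z c)"
      by (rule eq)
    moreover have "(\<Sum>c\<in>?C. csize c - 2 * negs h c) +
        (if class_adj r r then 0 else if negs h r > 0 then -1 else 1) \<ge> 1" if "sd h" for h
      using that r sd_iff_feasible[of h] by (simp add: sd_def feasible_def)
    note this[OF f(1)] this[OF g]
    moreover have "negs f r > 0 \<longleftrightarrow> negs g r > 0" using supp r by (simp add: same_support_def)
    note facts = calculation this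
    show "1 \<le> (\<Sum>c\<in>?C. csize c - 2 * (negs f c + z c)) +
        (if class_adj r r then 0 else if negs f r + z r > 0 then -1 else 1)"
    \<comment> \<open>If the row value of \<open>z\<close> is at most 0, the row is no tighter than
      for \<open>f\<close>; otherwise it is at most that of \<open>d\<close>, and the row is no
      tighter than for \<open>g\<close>.\<close>
    proof (cases "(\<Sum>c\<in>?C. z c) \<le> 0")
      case False
      then have "(\<Sum>c\<in>?C. z c) \<le> (\<Sum>c\<in>?C. d c)" using z(4)[OF r] unfolding between0_def by linarith
      then show ?thesis using facts supp'[OF r] by (simp split: if_splits)
    qed (use facts supp'[OF r] in \<open>simp split: if_splits\<close>)
  qed
  moreover have "0 \<le> negs f c + z c \<and> negs f c + z c \<le> csize c" if "c \<in> reps" for c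
    using z(2)[OF that] negs_bounds[of f c] negs_bounds[of g c] unfolding d_def between0_def by linarith
  ultimately have "acceptable f (move f z)" "sum (negs (move f z)) reps = sum (negs f) reps + sum z reps"
    using acceptable_move[OF f(2)] supp' by blast+
  then have "total_sign (move f z) < total_sign f"
    using z(3) signs by (simp add: total_sign_eq acceptable_def sd_def)
  then show ?thesis using z(1) \<open>acceptable f (move f z)\<close> by blast
qed

lemma
  assumes "\<And>v. v < n \<Longrightarrow> f v = f' v"
  shows total_sign_cong: "total_sign f = total_sign f'" and sd_cong: "sd f \<longleftrightarrow> sd f'"
proof -
  show "total_sign f = total_sign f'" unfolding total_sign_def by (rule sum.cong) (use assms in auto)
  have "closed_sum f u = closed_sum f' u" for u
    unfolding closed_sum_def by (rule sum.cong) (use assms in auto)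
  then show "sd f \<longleftrightarrow> sd f'" using assms by (simp add: sd_def signs_def)
qed

lemma acceptable_cong:
  assumes "\<And>v. v < n \<Longrightarrow> f v = g v" "\<And>v. v < n \<Longrightarrow> f' v = g' v"
  shows "acceptable f f' \<longleftrightarrow> acceptable g g'"
  using assms sd_cong[of f' g'] reps_less by (simp add: acceptable_def)

lemma acceptable_led:
  assumes "acceptable f f'" "led f" "led f'"
  shows "same_support f f'"
  unfolding same_support_def
proof
  fix c assume "c \<in> reps"
  then have "f' c = f c" "f c = (if negs f c > 0 then -1 else 1)" "f' c = (if negs f' c > 0 then -1 else 1)"
    using assms by (simp_all add: acceptable_def led_def)
  then show "negs f c > 0 \<longleftrightarrow> negs f' c > 0" by (simp split: if_splits)
qed

lemma led_move: "led (move f z)" by (simp add: move_def led_canon)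

section \<open>The local search and its correctness\<close>

fun step :: "int \<Rightarrow> (nat \<Rightarrow> int) \<Rightarrow> (nat \<Rightarrow> int) \<times> bool \<Rightarrow> (nat \<Rightarrow> int) \<times> bool" where
  "step k z (f, b) = (let f' = move f z in
     if acceptable f f' then (if total_sign f' < total_sign f then f' else f, b \<or> total_sign f' \<le> k) else (f, b))"

text \<open>A guessed support is given by the positive entries of a vector, so one enumeration
  \<open>D\<close> serves for the guesses and for the moves.\<close>

definition start :: "(nat \<Rightarrow> int) \<Rightarrow> nat \<Rightarrow> int" where
  "start z v = (if rep v = v \<and> z v > 0 then -1 else 1)"

definition search_round :: "int \<Rightarrow> (nat \<Rightarrow> nat \<Rightarrow> int) \<Rightarrow> nat \<Rightarrow> (nat \<Rightarrow> int) \<times> bool \<Rightarrow> (nat \<Rightarrow> int) \<times> bool" where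
  "search_round k D K = iter (\<lambda>j. step k (D j)) K"

definition search :: "int \<Rightarrow> (nat \<Rightarrow> nat \<Rightarrow> int) \<Rightarrow> nat \<Rightarrow> bool" where
  "search k D K = iter (\<lambda>i b. snd (iter (\<lambda>_. search_round k D K) (Suc n) (start (D i), b))) K False"

text \<open>The flag is raised only after \<open>acceptable\<close> has verified \<open>sd\<close>
  for the candidate, so this holds for every enumeration \<open>D\<close>.\<close>

lemma search_round_sound:
  assumes "snd st \<longrightarrow> (\<exists>f. sd f \<and> total_sign f \<le> k)"
  shows "snd (search_round k D K st) \<longrightarrow> (\<exists>f. sd f \<and> total_sign f \<le> k)"
  unfolding search_round_def
proof (rule iter_invariant[where P = "\<lambda>_ st. snd st \<longrightarrow> (\<exists>f. sd f \<and> total_sign f \<le> k)", OF assms])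
  fix j and st :: "(nat \<Rightarrow> int) \<times> bool" assume *: "snd st \<longrightarrow> (\<exists>f. sd f \<and> total_sign f \<le> k)"
  show "snd (step k (D j) st) \<longrightarrow> (\<exists>f. sd f \<and> total_sign f \<le> k)"
    using * by (cases st) (auto simp: Let_def acceptable_def split: if_splits)
qed

text \<open>Invariant of the completeness proof: the search stays within the support of a fixed
  solution \<open>g\<close>.\<close>

definition good_for :: "(nat \<Rightarrow> int) \<Rightarrow> (nat \<Rightarrow> int) \<Rightarrow> bool" where
  "good_for g f \<longleftrightarrow> sd f \<and> led f \<and> same_support f g"

lemma step_good:
  assumes "good_for g f" "step k z (f, b) = (f', b')"
  shows "good_for g f' \<and> (b \<longrightarrow> b') \<and> (f' = f \<or> total_sign f' < total_sign f)"
proof (cases "acceptable f (move f z)")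
  case True
  then have "good_for g (move f z)"
    using assms(1) acceptable_led[OF True _ led_move]
    by (simp add: good_for_def acceptable_def led_move same_support_def)
  then show ?thesis using assms by (auto simp: Let_def split: if_splits)
qed (use assms in \<open>auto simp: Let_def\<close>)

text \<open>A useful move for \<open>f\<close> exists: the zero move if \<open>f\<close> meets the
  budget, since \<open>step\<close> compares only candidates with \<open>k\<close>, and otherwise
  one from \<open>improving_move\<close>. If \<open>f\<close> is still current when this move comes
  up, the move does its work; if not, \<open>f\<close> has been replaced before, which happens only
  for a strict improvement.\<close>

lemma search_round_progress:
  assumes D: "\<And>d. (\<forall>c\<in>reps. \<bar>d c\<bar> \<le> int (block_bound (card reps))) \<Longrightarrow> \<exists>j<K. \<forall>c\<in>reps. D j c = d c"
    and g: "sd g" "total_sign g \<le> k" and f: "good_for g f"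
    and res: "search_round k D K (f, b) = (f', b')"
  shows "good_for g f' \<and> (b \<longrightarrow> b') \<and> (b' \<or> total_sign f' < total_sign f)"
proof -
  have "\<exists>z. (\<forall>c\<in>reps. \<bar>z c\<bar> \<le> int (block_bound (card reps))) \<and> acceptable f (move f z) \<and>
      (total_sign (move f z) \<le> k \<or> total_sign (move f z) < total_sign f)"
  proof (cases "total_sign f \<le> k")
    case True
    have "acceptable f (move f (\<lambda>_. 0))" "sum (negs (move f (\<lambda>_. 0))) reps = sum (negs f) reps"
      using acceptable_move[of f "\<lambda>_. 0"] f negs_bounds[of f] sd_iff_feasible[of f]
      by (auto simp: good_for_def sd_def)
    then have "acceptable f (move f (\<lambda>_. 0)) \<and> total_sign (move f (\<lambda>_. 0)) = total_sign f"
      using f by (auto simp: total_sign_eq good_for_def sd_def acceptable_def)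
    then show ?thesis using True by (intro exI[of _ "\<lambda>_. 0"]) simp
  next
    case False
    then show ?thesis using improving_move[of f g] f g by (auto simp: good_for_def)
  qed
  then obtain z where z: "\<forall>c\<in>reps. \<bar>z c\<bar> \<le> int (block_bound (card reps))"
      "acceptable f (move f z)" "total_sign (move f z) \<le> k \<or> total_sign (move f z) < total_sign f" by blast
  obtain i where i: "i < K" "\<forall>c\<in>reps. D i c = z c" using D[OF z(1)] by blast
  define P where "P j st \<longleftrightarrow> good_for g (fst st) \<and> (b \<longrightarrow> snd st) \<and> (fst st = f \<or> total_sign (fst st) < total_sign f) \<and>
      (i < j \<longrightarrow> snd st \<or> total_sign (fst st) < total_sign f)" for j st
  \<comment> \<open>\<open>D i\<close> and \<open>z\<close> are known to agree on
    \<open>reps\<close>, and at vertices below \<open>n\<close> this is all that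
    \<open>canon\<close> reads.\<close>
  have move_eq: "move f (D i) v = move f z v" if "v < n" for v
    using i(2) that by (simp add: move_def canon_def)
  have acc: "acceptable f (move f (D i))" "total_sign (move f (D i)) = total_sign (move f z)"
    using z(2) acceptable_cong[of f f "move f (D i)" "move f z"] total_sign_cong[of "move f (D i)" "move f z"] move_eq by auto
  have "P K (iter (\<lambda>j. step k (D j)) K (f, b))"
  proof (rule iter_invariant)
    show "P 0 (f, b)" using f by (simp add: P_def)
  next
    fix j st assume P: "P j st"
    obtain h c where st: "st = (h, c)" by force
    obtain h' c' where st': "step k (D j) st = (h', c')" by force
    have st_eq: "step k (D j) (h, c) = (h', c')" using st st' by simp
    have 1: "good_for g h' \<and> (c \<longrightarrow> c') \<and> (h' = h \<or> total_sign h' < total_sign h)"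
      using step_good[OF _ st_eq, of g] P st by (simp add: P_def)
    have "c' \<or> total_sign h' < total_sign f" if "j = i" "h = f"
      using st_eq acc z(3) that by (auto simp: Let_def split: if_splits)
    then show "P (Suc j) (step k (D j) st)"
      using 1 P[unfolded P_def st fst_conv snd_conv] unfolding P_def st' fst_conv snd_conv
      by (auto simp: less_Suc_eq)
  qed
  then show ?thesis using i(1) res by (auto simp: P_def search_round_def)
qed

text \<open>One negative vertex per guessed class is the smallest vector of counts with the support
  of \<open>g\<close>. So each row is at least as loose as for \<open>g\<close>, with the same
  constant term.\<close>

lemma good_for_start:
  assumes g: "sd g" and z: "\<And>c. c \<in> reps \<Longrightarrow> z c > 0 \<longleftrightarrow> negs g c > 0"
  shows "good_for g (start z)"
proof -
  have sg: "signs (start z)" by (simp add: signs_def start_def)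
  have neg: "negs (start z) c = (if z c > 0 then 1 else 0)" if c: "c \<in> reps" for c
  proof -
    have "{v. v < n \<and> rep v = c \<and> start z v = -1} = (if z c > 0 then {c} else {})"
      using c reps_less rep_reps by (auto simp: start_def split: if_splits)
    then show ?thesis by (simp add: negs_def)
  qed
  have "feasible (negs (start z))"
    unfolding feasible_def
  proof
    fix r assume r: "r \<in> reps"
    have le: "negs (start z) c \<le> negs g c" if "c \<in> reps" for c
      using neg[OF that] z[OF that] negs_bounds(1)[of g c] by simp
    have "(\<Sum>c\<in>{c\<in>reps. class_adj r c}. csize c - 2 * negs g c) \<le>
        (\<Sum>c\<in>{c\<in>reps. class_adj r c}. csize c - 2 * negs (start z) c)"
      using le by (intro sum_mono) simp
    moreover have "negs g r > 0 \<longleftrightarrow> negs (start z) r > 0" using neg[OF r] z[OF r] by simp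
    moreover have "feasible (negs g)" using g sd_iff_feasible[of g] by (simp add: sd_def)
    ultimately show "1 \<le> (\<Sum>c\<in>{c\<in>reps. class_adj r c}. csize c - 2 * negs (start z) c) +
        (if class_adj r r then 0 else if negs (start z) r > 0 then -1 else 1)"
      using r by (fastforce simp: feasible_def)
  qed
  then have "sd (start z)" using sd_iff_feasible sg by simp
  moreover have "led (start z)" using neg rep_reps by (simp add: led_def start_def)
  moreover have "same_support (start z) g" using neg z by (simp add: same_support_def)
  ultimately show ?thesis by (simp add: good_for_def)
qed

theorem search_correct:
  assumes D: "\<And>d. (\<forall>c\<in>reps. \<bar>d c\<bar> \<le> int (block_bound (card reps))) \<Longrightarrow> \<exists>j<K. \<forall>c\<in>reps. D j c = d c"
  shows "search k D K \<longleftrightarrow> (\<exists>f. sd f \<and> total_sign f \<le> k)"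
proof
  assume "search k D K"
  moreover have "search k D K \<longrightarrow> (\<exists>f. sd f \<and> total_sign f \<le> k)"
    unfolding search_def
  proof (rule iter_invariant[where P = "\<lambda>_ b. b \<longrightarrow> (\<exists>f. sd f \<and> total_sign f \<le> k)"])
    fix j b assume *: "b \<longrightarrow> (\<exists>f. sd f \<and> total_sign f \<le> k)"
    show "snd (iter (\<lambda>_. search_round k D K) (Suc n) (start (D j), b)) \<longrightarrow> (\<exists>f. sd f \<and> total_sign f \<le> k)"
      by (rule iter_invariant[where P = "\<lambda>_ st. snd st \<longrightarrow> (\<exists>f. sd f \<and> total_sign f \<le> k)"])
        (use * search_round_sound[of _ k D K] in \<open>simp_all only: snd_conv\<close>)
  qed simp
  ultimately show "\<exists>f. sd f \<and> total_sign f \<le> k" by blast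
next
  assume "\<exists>f. sd f \<and> total_sign f \<le> k"
  then obtain g where g: "sd g" "total_sign g \<le> k" by blast
  \<comment> \<open>This puts the 0/1 vector of the support of \<open>g\<close> among the enumerated
    vectors.\<close>
  have "block_bound m \<ge> 1" for m by (induction m) auto
  then have "\<forall>c\<in>reps. \<bar>if negs g c > 0 then 1 else 0 :: int\<bar> \<le> int (block_bound (card reps))"
    by (metis abs_0 abs_1 of_nat_0_le_iff of_nat_1 of_nat_mono)
  then obtain i where i: "i < K" "\<forall>c\<in>reps. D i c = (if negs g c > 0 then 1 else 0)"
    using D[of "\<lambda>c. if negs g c > 0 then 1 else 0"] by auto
  have start: "good_for g (start (D i))" using g(1) i(2) by (intro good_for_start) auto
  have all: "b \<longrightarrow> snd (iter (\<lambda>_. search_round k D K) m (start (D j), b))" for b m j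
  proof (induction m)
    case (Suc m)
    have "b \<longrightarrow> snd (search_round k D K st)" if "b \<longrightarrow> snd st" for st
      unfolding search_round_def
      by (rule iter_invariant[where P = "\<lambda>_ st. b \<longrightarrow> snd st"]) (use that in \<open>auto simp: Let_def\<close>)
    then show ?case using Suc.IH by simp
  qed simp
  have found: "snd (iter (\<lambda>_. search_round k D K) (Suc n) (start (D i), b))" for b
  proof -
    \<comment> \<open>By parity a strict improvement lowers the weight by at least 2. Starting from
      at most \<open>n\<close>, \<open>n + 1\<close> rounds without raising the flag would lead to
      weight at most \<open>- n - 2\<close>, which no sign function has.\<close>
    define P where "P m st \<longleftrightarrow> good_for g (fst st) \<and> (snd st \<or> total_sign (fst st) \<le> int n - 2 * int m)" for m st
    have "P (Suc n) (iter (\<lambda>_. search_round k D K) (Suc n) (start (D i), b))"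
    proof (rule iter_invariant)
      have "total_sign (start (D i)) \<le> (\<Sum>v<n. 1)" unfolding total_sign_def by (rule sum_mono) (simp add: start_def)
      then show "P 0 (start (D i), b)" using start by (simp add: P_def)
    next
      fix m st assume P: "P m st"
      obtain f c where st: "st = (f, c)" by force
      obtain f' c' where st': "search_round k D K st = (f', c')" by force
      show "P (Suc m) (search_round k D K st)"
      proof -
        have f: "good_for g f" using P st by (simp add: P_def)
        have *: "good_for g f' \<and> (c \<longrightarrow> c') \<and> (c' \<or> total_sign f' < total_sign f)"
          by (rule search_round_progress[OF D g f st'[unfolded st]])
        have eqs: "total_sign f = int n - 2 * sum (negs f) reps" "total_sign f' = int n - 2 * sum (negs f') reps"
          using f * by (simp_all add: good_for_def sd_def total_sign_eq)
        then have "total_sign f' < total_sign f \<Longrightarrow> sum (negs f) reps < sum (negs f') reps" by linarith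
        with eqs have "total_sign f' < total_sign f \<Longrightarrow> total_sign f' \<le> total_sign f - 2" by linarith
        then show ?thesis using * P st st' by (auto simp: P_def)
      qed
    qed
    moreover have "total_sign f \<ge> - int n" if "good_for g f" for f
    proof -
      have "(\<Sum>v<n. -1) \<le> total_sign f"
        unfolding total_sign_def by (rule sum_mono) (use that in \<open>auto simp: good_for_def sd_def signs_def\<close>)
      then show ?thesis by simp
    qed
    ultimately show ?thesis by (force simp: P_def simp del: iter.simps)
  qed
  \<comment> \<open>Guess \<open>i\<close> raises the flag, and by \<open>all\<close> the later
    guesses keep it.\<close>
  have "i < j \<longrightarrow> iter (\<lambda>i b. snd (iter (\<lambda>_. search_round k D K) (Suc n) (start (D i), b))) j False" for j
    by (rule iter_invariant[where P = "\<lambda>j b. i < j \<longrightarrow> b"]) (use found all in \<open>auto simp: less_Suc_eq simp del: iter.simps\<close>)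
  then show "search k D K" using i(1) by (simp add: search_def)
qed

end

section \<open>Programs with bounded loops\<close>

text \<open>Every loop has a number of iterations fixed on entry, so final state and exact cost are
  recursive functions of the initial state, and derivations of \<open>exec\<close> are needed only
  in the proof that compilation is correct.\<close>

datatype prog =
    Nop
  | Set nat expr
  | Put nat expr expr
  | Then prog prog (infixr ";;" 60)
  | When expr prog prog
  | Times nat nat prog

text \<open>Eight arrays are interleaved at the negative addresses, away from the input word.\<close>

definition loc :: "nat \<Rightarrow> int \<Rightarrow> int" where "loc j v = - 1 - int j - 8 * v"

text \<open>Multiplication by 8 as three doublings, since expressions can only add and
  subtract.\<close>

definition loc_expr :: "nat \<Rightarrow> expr \<Rightarrow> expr" where
  "loc_expr j e = Sub (Const (- 1 - int j))
     (let e2 = Add e e; e4 = Add e2 e2 in Add e4 e4)"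

definition Arr :: "nat \<Rightarrow> expr \<Rightarrow> expr" where "Arr j e = Load (loc_expr j e)"

lemma loc_expr_val [simp]: "expr_val (loc_expr j e) s = loc j (expr_val e s)"
  by (simp add: loc_expr_def loc_def Let_def)

lemma Arr_val [simp]: "expr_val (Arr j e) s = snd s (loc j (expr_val e s))"
  by (simp add: Arr_def)

lemma loc_eq_iff [simp]: "j < 8 \<Longrightarrow> j' < 8 \<Longrightarrow> loc j v = loc j' v' \<longleftrightarrow> j = j' \<and> v = v'"
  by (cases v v' rule: linorder_cases) (auto simp: loc_def)

lemma loc_neg [simp]: "v \<ge> 0 \<Longrightarrow> loc j v < 0"
  by (simp add: loc_def)

primrec writes :: "prog \<Rightarrow> nat set" where
  "writes Nop = {}"
| "writes (Set x e) = {x}"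
| "writes (Put j e e') = {}"
| "writes (p ;; q) = writes p \<union> writes q"
| "writes (When e p q) = writes p \<union> writes q"
| "writes (Times i b p) = insert i (writes p)"

primrec arrays :: "prog \<Rightarrow> nat set" where
  "arrays Nop = {}"
| "arrays (Set x e) = {}"
| "arrays (Put j e e') = {j}"
| "arrays (p ;; q) = arrays p \<union> arrays q"
| "arrays (When e p q) = arrays p \<union> arrays q"
| "arrays (Times i b p) = arrays p"

primrec well_formed :: "prog \<Rightarrow> bool" where
  "well_formed Nop = True"
| "well_formed (Set x e) = True"
| "well_formed (Put j e e') = (j < 8)"
| "well_formed (p ;; q) = (well_formed p \<and> well_formed q)"
| "well_formed (When e p q) = (well_formed p \<and> well_formed q)"
| "well_formed (Times i b p) = (well_formed p \<and> i \<noteq> b \<and> i \<notin> writes p \<and> b \<notin> writes p)"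

definition set_reg :: "nat \<Rightarrow> int \<Rightarrow> config \<Rightarrow> config" where
  "set_reg x v s = ((fst s)(x := v), snd s)"

lemma set_reg_simps [simp]:
  "fst (set_reg x v s) = (fst s)(x := v)" "snd (set_reg x v s) = snd s"
  by (simp_all add: set_reg_def)

primrec sem :: "prog \<Rightarrow> config \<Rightarrow> config" where
  "sem Nop = (\<lambda>s. s)"
| "sem (Set x e) = (\<lambda>s. set_reg x (expr_val e s) s)"
| "sem (Put j e e') = (\<lambda>s. (fst s, (snd s)(loc j (expr_val e s) := expr_val e' s)))"
| "sem (p ;; q) = (\<lambda>s. sem q (sem p s))"
| "sem (When e p q) = (\<lambda>s. if expr_val e s > 0 then sem p s else sem q s)"
| "sem (Times i b p) = (\<lambda>s. iter (\<lambda>k t. set_reg i (int k + 1) (sem p t)) (nat (fst s b)) (set_reg i 0 s))"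

text \<open>For \<open>Times\<close>, 6 pays for clearing the counter (2) and for the last, failing
  test (4); each iteration adds 4 for its test and 4 for incrementing the counter.\<close>

primrec cost :: "prog \<Rightarrow> config \<Rightarrow> nat" where
  "cost Nop = (\<lambda>s. 1)"
| "cost (Set x e) = (\<lambda>s. expr_cost e + 1)"
| "cost (Put j e e') = (\<lambda>s. expr_cost (loc_expr j e) + expr_cost e' + 1)"
| "cost (p ;; q) = (\<lambda>s. cost p s + cost q (sem p s))"
| "cost (When e p q) = (\<lambda>s. expr_cost e + 1 + (if expr_val e s > 0 then cost p s else cost q s))"
| "cost (Times i b p) = (\<lambda>s. 6 + (\<Sum>j<nat (fst s b).
     8 + cost p (iter (\<lambda>k t. set_reg i (int k + 1) (sem p t)) j (set_reg i 0 s))))"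

primrec compile :: "prog \<Rightarrow> com" where
  "compile Nop = Skip"
| "compile (Set x e) = Assign x e"
| "compile (Put j e e') = Store (loc_expr j e) e'"
| "compile (p ;; q) = Seq (compile p) (compile q)"
| "compile (When e p q) = IfPos e (compile p) (compile q)"
| "compile (Times i b p) = Seq (Assign i (Const 0))
     (WhilePos (Sub (Reg b) (Reg i)) (Seq (compile p) (Assign i (Add (Reg i) (Const 1)))))"

lemma sem_not_writes: "x \<notin> writes p \<Longrightarrow> fst (sem p s) x = fst s x"
proof (induction p arbitrary: s)
  case (Times i b p)
  show ?case using Times.prems
    by simp (rule iter_invariant[where P = "\<lambda>_ t. fst t x = fst s x"], use Times.IH in auto)
qed auto

lemma compile_correct: "well_formed p \<Longrightarrow> exec (compile p) s (cost p s) (sem p s)"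
proof (induction p arbitrary: s)
  case Nop
  show ?case using exec.Skip[of s] by simp
next
  case (Set x e)
  show ?case using exec.Assign[of x e s] by (simp add: set_reg_def)
next
  case (Put j e e')
  show ?case using exec.Store[of "loc_expr j e" e' s] by simp
next
  case (Then p q)
  show ?case using exec.Seq[OF Then.IH(1) Then.IH(2)] Then.prems by simp
next
  case (When e p q)
  show ?case
  proof (cases "expr_val e s > 0")
    case True
    then show ?thesis using exec.IfTrue[OF True When.IH(1)] When.prems by simp
  next
    case False
    then show ?thesis using exec.IfFalse[OF False When.IH(2)] When.prems by simp
  qed
next
  case (Times i b p)
  let ?body = "Seq (compile p) (Assign i (Add (Reg i) (Const 1)))"
  let ?while = "WhilePos (Sub (Reg b) (Reg i)) ?body"
  define m where "m = nat (fst s b)"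
  define st where "st j = iter (\<lambda>k t. set_reg i (int k + 1) (sem p t)) j (set_reg i 0 s)" for j
  have i: "fst (st j) i = int j" for j by (cases j) (simp_all add: st_def)
  have b: "fst (st j) b = fst s b" for j
    unfolding st_def
    by (rule iter_invariant[where P = "\<lambda>_ t. fst t b = fst s b"]) (use Times.prems in \<open>auto simp: sem_not_writes\<close>)
  have body: "exec ?body (st j) (cost p (st j) + 4) (st (Suc j))" for j
  proof -
    have "exec (Assign i (Add (Reg i) (Const 1))) (sem p (st j)) 4 (st (Suc j))"
      using exec.Assign[of i "Add (Reg i) (Const 1)" "sem p (st j)"] i[of j] Times.prems
      by (simp add: sem_not_writes set_reg_def st_def numeral_eq_Suc)
    from exec.Seq[OF Times.IH this] show ?thesis using Times.prems by simp
  qed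
  \<comment> \<open>Induction on the number \<open>d\<close> of iterations still to come, because
    \<open>exec.WhileTrue\<close> peels off the first one.\<close>
  have loop: "exec ?while (st (m - d)) (4 + (\<Sum>j\<in>{m - d..<m}. 8 + cost p (st j))) (st m)" if "d \<le> m" for d
    using that
  proof (induction d)
    case 0
    have "\<not> expr_val (Sub (Reg b) (Reg i)) (st m) > 0" using i[of m] b[of m] by (simp add: m_def)
    from exec.WhileFalse[OF this] show ?case by (simp add: numeral_eq_Suc)
  next
    case (Suc d)
    let ?j = "m - Suc d"
    have j: "Suc ?j = m - d" "?j < m" using Suc.prems by auto
    have "expr_val (Sub (Reg b) (Reg i)) (st ?j) > 0"
    proof -
      have "int ?j < fst s b" using j(2) unfolding m_def by linarith
      then show ?thesis using i[of ?j] b[of ?j] by simp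
    qed
    from exec.WhileTrue[OF this body[of ?j, unfolded j(1)] Suc.IH]
    have "exec ?while (st ?j) (4 + (cost p (st ?j) + 4) + (4 + (\<Sum>j\<in>{m - d..<m}. 8 + cost p (st j)))) (st m)"
      using Suc.prems by (simp add: numeral_eq_Suc)
    moreover have "(\<Sum>j\<in>{?j..<m}. 8 + cost p (st j)) = 8 + cost p (st ?j) + (\<Sum>j\<in>{m - d..<m}. 8 + cost p (st j))"
      using sum.atLeast_Suc_lessThan[OF j(2)] j(1) by simp
    ultimately show ?case by (simp add: algebra_simps)
  qed
  have "exec (Assign i (Const 0)) s 2 (st 0)"
    using exec.Assign[of i "Const 0" s] by (simp add: st_def set_reg_def numeral_2_eq_2)
  from exec.Seq[OF this loop[of m, simplified]]
  show ?case by (simp add: st_def m_def lessThan_atLeast0 numeral_eq_Suc)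
qed

section \<open>Frame conditions, cost bounds and loop invariants\<close>

definition frame :: "prog \<Rightarrow> config \<Rightarrow> config \<Rightarrow> bool" where
  "frame p s t \<longleftrightarrow> (\<forall>x. x \<notin> writes p \<longrightarrow> fst t x = fst s x) \<and>
     (\<forall>j v. j < 8 \<longrightarrow> j \<notin> arrays p \<longrightarrow> snd t (loc j v) = snd s (loc j v))"

text \<open>\<open>r\<close> stands for upper bounds on the registers that serve as loop bounds.
  Adding the costs of both branches of \<open>When\<close> keeps the expression polynomial in these
  bounds.\<close>

primrec static_cost :: "prog \<Rightarrow> (nat \<Rightarrow> nat) \<Rightarrow> nat" where
  "static_cost Nop r = 1"
| "static_cost (Set x e) r = expr_cost e + 1"
| "static_cost (Put j e e') r = expr_cost (loc_expr j e) + expr_cost e' + 1"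
| "static_cost (p ;; q) r = static_cost p r + static_cost q r"
| "static_cost (When e p q) r = expr_cost e + 1 + (static_cost p r + static_cost q r)"
| "static_cost (Times i b p) r = 6 + r b * (8 + static_cost p r)"

primrec loop_bounds :: "prog \<Rightarrow> nat set" where
  "loop_bounds Nop = {}"
| "loop_bounds (Set x e) = {}"
| "loop_bounds (Put j e e') = {}"
| "loop_bounds (p ;; q) = loop_bounds p \<union> loop_bounds q"
| "loop_bounds (When e p q) = loop_bounds p \<union> loop_bounds q"
| "loop_bounds (Times i b p) = insert b (loop_bounds p)"

lemma cost_Times_le:
  assumes "fst s b \<le> int m"
    and "\<And>j. j < nat (fst s b) \<Longrightarrow> cost p (iter (\<lambda>k t. set_reg i (int k + 1) (sem p t)) j (set_reg i 0 s)) \<le> C"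
  shows "cost (Times i b p) s \<le> 6 + m * (8 + C)"
proof -
  have "cost (Times i b p) s \<le> 6 + (\<Sum>j<nat (fst s b). 8 + C)"
    using assms(2) by (simp only: cost.simps add_le_cancel_left) (intro sum_mono, simp)
  also have "\<dots> \<le> 6 + m * (8 + C)" using assms(1) by simp
  finally show ?thesis .
qed

text \<open>As no loop bound is overwritten, the initial values govern all loops, including nested
  and later ones.\<close>

lemma cost_le_static_cost:
  assumes "loop_bounds p \<inter> writes p = {}" "\<And>b. b \<in> loop_bounds p \<Longrightarrow> fst s b \<le> int (r b)"
  shows "cost p s \<le> static_cost p r"
  using assms
proof (induction p arbitrary: s)
  case (Then p q)
  have "cost p s \<le> static_cost p r" using Then.prems by (intro Then.IH) auto
  moreover have "cost q (sem p s) \<le> static_cost q r"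
  proof (rule Then.IH)
    fix b assume b: "b \<in> loop_bounds q"
    then have "b \<notin> writes p" using Then.prems(1) by auto
    then show "fst (sem p s) b \<le> int (r b)" using b Then.prems(2) by (simp add: sem_not_writes)
  qed (use Then.prems in auto)
  ultimately show ?case by simp
next
  case (When e p q)
  have "cost p s \<le> static_cost p r" "cost q s \<le> static_cost q r"
    using When.prems by (intro When.IH; auto)+
  then show ?case by simp
next
  case (Times i b p)
  show ?case unfolding static_cost.simps
  proof (rule cost_Times_le)
    fix j
    let ?t = "iter (\<lambda>k t. set_reg i (int k + 1) (sem p t)) j (set_reg i 0 s)"
    show "cost p ?t \<le> static_cost p r"
    proof (rule Times.IH)
      fix c assume c: "c \<in> loop_bounds p"
      then have "c \<noteq> i" "c \<notin> writes p" using Times.prems(1) by auto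
      then have "fst ?t c = fst s c"
        by (intro iter_invariant[where P = "\<lambda>_ t. fst t c = fst s c"]) (auto simp: sem_not_writes)
      then show "fst ?t c \<le> int (r c)" using c Times.prems(2) by simp
    qed (use Times.prems in auto)
  qed (use Times.prems in auto)
qed auto

lemma sem_not_arrays:
  "well_formed p \<Longrightarrow> j < 8 \<Longrightarrow> j \<notin> arrays p \<Longrightarrow> snd (sem p s) (loc j v) = snd s (loc j v)"
proof (induction p arbitrary: s)
  case (Times i b p)
  show ?case using Times.prems
    by simp (rule iter_invariant[where P = "\<lambda>_ t. snd t (loc j v) = snd s (loc j v)"], use Times.IH in auto)
qed auto

lemma frame_sem: "well_formed p \<Longrightarrow> frame p s (sem p s)"
  by (simp add: frame_def sem_not_writes sem_not_arrays)

text \<open>The invariant is claimed after every number \<open>k \<le> m\<close> of iterations, so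
  that it can also bound the cost of a single iteration. The frame condition comes for free in each
  step, and invariants need to mention only what the body changes.\<close>

lemma loop_invariant:
  assumes well_formed: "well_formed (Times i b p)" and k: "k \<le> m"
    and init: "I 0 (set_reg i 0 s)"
    and step: "\<And>k t. k < m \<Longrightarrow> frame (Times i b p) s t \<Longrightarrow> fst t i = int k \<Longrightarrow> I k t \<Longrightarrow>
      I (Suc k) (set_reg i (int k + 1) (sem p t))"
  shows "I k (iter (\<lambda>k t. set_reg i (int k + 1) (sem p t)) k (set_reg i 0 s))"
proof -
  have "k \<le> m \<longrightarrow> I k t \<and> fst t i = int k \<and> frame (Times i b p) s t"
    if "t = iter (\<lambda>k t. set_reg i (int k + 1) (sem p t)) k (set_reg i 0 s)" for k t
    unfolding that
  proof (rule iter_invariant)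
    show "0 \<le> m \<longrightarrow> I 0 (set_reg i 0 s) \<and> fst (set_reg i 0 s) i = int 0 \<and> frame (Times i b p) s (set_reg i 0 s)"
      using init by (simp add: frame_def)
  next
    fix k t assume *: "k \<le> m \<longrightarrow> I k t \<and> fst t i = int k \<and> frame (Times i b p) s t"
    show "Suc k \<le> m \<longrightarrow> I (Suc k) (set_reg i (int k + 1) (sem p t)) \<and>
        fst (set_reg i (int k + 1) (sem p t)) i = int (Suc k) \<and>
        frame (Times i b p) s (set_reg i (int k + 1) (sem p t))"
      using * step[of k t] well_formed by (auto simp: frame_def sem_not_writes sem_not_arrays)
  qed
  then show ?thesis using k by blast
qed

lemma sem_Times_invariant:
  assumes "well_formed (Times i b p)" "fst s b = int m" "I 0 (set_reg i 0 s)"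
    "\<And>k t. k < m \<Longrightarrow> frame (Times i b p) s t \<Longrightarrow> fst t i = int k \<Longrightarrow> I k t \<Longrightarrow>
      I (Suc k) (set_reg i (int k + 1) (sem p t))"
  shows "I m (sem (Times i b p) s)"
proof -
  have "I m (iter (\<lambda>k t. set_reg i (int k + 1) (sem p t)) m (set_reg i 0 s))"
    by (rule loop_invariant[where I = I, OF assms(1) order_refl assms(3)]) (rule assms(4))
  then show ?thesis by (simp only: sem.simps assms(2) nat_int)
qed

text \<open>For bodies whose cost depends on values left by earlier iterations, where
  \<open>cost_le_static_cost\<close> does not apply.\<close>

lemma cost_Times_invariant:
  assumes "well_formed (Times i b p)" "fst s b = int m" "I 0 (set_reg i 0 s)"
    "\<And>k t. k < m \<Longrightarrow> frame (Times i b p) s t \<Longrightarrow> fst t i = int k \<Longrightarrow> I k t \<Longrightarrow>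
      I (Suc k) (set_reg i (int k + 1) (sem p t))"
    "\<And>k t. k < m \<Longrightarrow> I k t \<Longrightarrow> cost p t \<le> C"
  shows "cost (Times i b p) s \<le> 6 + m * (8 + C)"
proof (rule cost_Times_le)
  fix j assume "j < nat (fst s b)"
  then have "j < m" using assms(2) by simp
  moreover have "I j (iter (\<lambda>k t. set_reg i (int k + 1) (sem p t)) j (set_reg i 0 s))"
    by (rule loop_invariant[where I = I and m = m, OF assms(1)])
      (use \<open>j < m\<close> in simp, rule assms(3), rule assms(4))
  ultimately show "cost p (iter (\<lambda>k t. set_reg i (int k + 1) (sem p t)) j (set_reg i 0 s)) \<le> C"
    by (rule assms(5))
qed (simp add: assms(2))

lemma static_cost_polynomial:
  "\<exists>W d. \<forall>r M. M \<ge> 1 \<longrightarrow> (\<forall>b\<in>loop_bounds p. r b \<le> M) \<longrightarrow> static_cost p r \<le> W * M ^ d"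
proof (induction p)
  case Nop
  show ?case by (intro exI[of _ 1] exI[of _ 0]) simp
next
  case (Set x e)
  show ?case by (intro exI[of _ "expr_cost e + 1"] exI[of _ 0]) simp
next
  case (Put j e e')
  show ?case by (intro exI[of _ "expr_cost (loc_expr j e) + expr_cost e' + 1"] exI[of _ 0]) simp
next
  case (Then p q)
  then obtain V c W d where
    *: "\<And>r M. M \<ge> 1 \<Longrightarrow> (\<forall>b\<in>loop_bounds p. r b \<le> M) \<Longrightarrow> static_cost p r \<le> V * M ^ c"
       "\<And>r M. M \<ge> 1 \<Longrightarrow> (\<forall>b\<in>loop_bounds q. r b \<le> M) \<Longrightarrow> static_cost q r \<le> W * M ^ d" by metis
  have "static_cost (p ;; q) r \<le> (V + W) * M ^ (c + d)" if "M \<ge> 1" "\<forall>b\<in>loop_bounds (p ;; q). r b \<le> M" for r M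
  proof -
    have "static_cost p r + static_cost q r \<le> V * M ^ c + W * M ^ d"
      using * that by (intro add_mono) auto
    also have "\<dots> \<le> V * M ^ (c + d) + W * M ^ (c + d)"
      using that(1) by (intro add_mono mult_left_mono power_increasing) auto
    finally show ?thesis by (simp add: algebra_simps)
  qed
  then show ?case by blast
next
  case (When e p q)
  then obtain V c W d where
    *: "\<And>r M. M \<ge> 1 \<Longrightarrow> (\<forall>b\<in>loop_bounds p. r b \<le> M) \<Longrightarrow> static_cost p r \<le> V * M ^ c"
       "\<And>r M. M \<ge> 1 \<Longrightarrow> (\<forall>b\<in>loop_bounds q. r b \<le> M) \<Longrightarrow> static_cost q r \<le> W * M ^ d" by metis
  have "static_cost (When e p q) r \<le> (expr_cost e + 1 + V + W) * M ^ (c + d)"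
    if "M \<ge> 1" "\<forall>b\<in>loop_bounds (When e p q). r b \<le> M" for r M
  proof -
    have "static_cost p r + static_cost q r \<le> V * M ^ c + W * M ^ d"
      using * that by (intro add_mono) auto
    also have "\<dots> \<le> V * M ^ (c + d) + W * M ^ (c + d)"
      using that(1) by (intro add_mono mult_left_mono power_increasing) auto
    moreover have "(expr_cost e + 1) * 1 \<le> (expr_cost e + 1) * M ^ (c + d)"
      using that(1) by (intro mult_le_mono2) simp
    ultimately show ?thesis unfolding static_cost.simps distrib_right mult_1_right by linarith
  qed
  then show ?case by blast
next
  case (Times i b p)
  then obtain V c where
    *: "\<And>r M. M \<ge> 1 \<Longrightarrow> (\<forall>b\<in>loop_bounds p. r b \<le> M) \<Longrightarrow> static_cost p r \<le> V * M ^ c" by metis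
  have "static_cost (Times i b p) r \<le> (14 + V) * M ^ (Suc c)"
    if M: "M \<ge> 1" "\<forall>b\<in>loop_bounds (Times i b p). r b \<le> M" for r M
  proof -
    have "r b * (8 + static_cost p r) \<le> M * (8 + V * M ^ c)"
      using * M by (intro mult_mono add_mono) auto
    moreover have "M * (8 + V * M ^ c) = 8 * M + V * M ^ Suc c" by (simp add: algebra_simps)
    moreover have "M \<le> M ^ Suc c" "1 \<le> M ^ Suc c" using M(1) by simp_all
    ultimately show ?thesis unfolding static_cost.simps distrib_right by linarith
  qed
  then show ?case by blast
qed

lemma cost_polynomial:
  assumes "loop_bounds p \<inter> writes p = {}"
  shows "\<exists>W d. \<forall>s M. M \<ge> 1 \<longrightarrow> (\<forall>b\<in>loop_bounds p. fst s b \<le> int M) \<longrightarrow> cost p s \<le> W * M ^ d"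
proof -
  obtain W d where *: "\<And>r M. M \<ge> 1 \<Longrightarrow> (\<forall>b\<in>loop_bounds p. r b \<le> M) \<Longrightarrow> static_cost p r \<le> W * M ^ d"
    using static_cost_polynomial by metis
  have "cost p s \<le> W * M ^ d" if "M \<ge> 1" "\<forall>b\<in>loop_bounds p. fst s b \<le> int M" for s M
    using cost_le_static_cost[OF assms, of s "\<lambda>_. M"] *[of M "\<lambda>_. M"] that by force
  then show ?thesis by blast
qed

text \<open>Positivity is the only test of the machine, so a comparison for equality takes two
  tests.\<close>

definition Neq :: "expr \<Rightarrow> expr \<Rightarrow> prog \<Rightarrow> prog" where
  "Neq e e' p = When (Sub e e') p (When (Sub e' e) p Nop)"

definition Eq :: "expr \<Rightarrow> expr \<Rightarrow> prog \<Rightarrow> prog" where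
  "Eq e e' p = When (Sub e e') Nop (When (Sub e' e) Nop p)"

lemma Neq_simps [simp]:
  "sem (Neq e e' p) s = (if expr_val e s = expr_val e' s then s else sem p s)"
  "writes (Neq e e' p) = writes p" "arrays (Neq e e' p) = arrays p"
  "well_formed (Neq e e' p) = well_formed p" "loop_bounds (Neq e e' p) = loop_bounds p"
  by (auto simp: Neq_def)

lemma Eq_simps [simp]:
  "sem (Eq e e' p) s = (if expr_val e s = expr_val e' s then sem p s else s)"
  "writes (Eq e e' p) = writes p" "arrays (Eq e e' p) = arrays p"
  "well_formed (Eq e e' p) = well_formed p" "loop_bounds (Eq e e' p) = loop_bounds p"
  by (auto simp: Eq_def)

lemma cost_Eq: "cost (Eq e e' p) s \<le> 2 * expr_cost e + 2 * expr_cost e' + 5 + cost p s"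
  by (simp add: Eq_def)

section \<open>The program\<close>

abbreviation (input) "rOut \<equiv> 0 :: nat"
abbreviation (input) "rN \<equiv> 1 :: nat"
abbreviation (input) "rBudget \<equiv> 2 :: nat"
abbreviation (input) "rLen \<equiv> 3 :: nat"
abbreviation (input) "rX \<equiv> 4 :: nat"
abbreviation (input) "rH \<equiv> 5 :: nat"
abbreviation (input) "rK \<equiv> 6 :: nat"
abbreviation (input) "rRounds \<equiv> 7 :: nat"
abbreviation (input) "iU \<equiv> 8 :: nat"
abbreviation (input) "iV \<equiv> 9 :: nat"
abbreviation (input) "iW \<equiv> 10 :: nat"
abbreviation (input) "iA \<equiv> 11 :: nat"
abbreviation (input) "iB \<equiv> 12 :: nat"
abbreviation (input) "iR \<equiv> 13 :: nat"
abbreviation (input) "rRowU \<equiv> 14 :: nat"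
abbreviation (input) "rRowV \<equiv> 15 :: nat"
abbreviation (input) "rFlag \<equiv> 16 :: nat"
abbreviation (input) "rBest \<equiv> 17 :: nat"
abbreviation (input) "rY \<equiv> 18 :: nat"
abbreviation (input) "rZ \<equiv> 19 :: nat"
abbreviation (input) "rQ \<equiv> 20 :: nat"
abbreviation (input) "rTotNew \<equiv> 21 :: nat"
abbreviation (input) "rTotOld \<equiv> 22 :: nat"
abbreviation (input) "rSum \<equiv> 23 :: nat"

abbreviation (input) "aRep \<equiv> 0 :: nat"
abbreviation (input) "aDigit \<equiv> 1 :: nat"
abbreviation (input) "aOld \<equiv> 2 :: nat"
abbreviation (input) "aCount \<equiv> 3 :: nat"
abbreviation (input) "aNew \<equiv> 4 :: nat"
abbreviation (input) "aAdj \<equiv> 5 :: nat"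

definition "read_size =
  Set rN (Load (Const 0)) ;; Set rBudget (Load (Const 1)) ;; Set rRounds (Add (Reg rN) (Const 1)) ;;
  Set rLen (Const 0) ;; Times iV rN (Set rLen (Add (Reg rLen) (Reg rN)))"

text \<open>
  The matrix is copied to an array since stores into the other arrays are known statically not to
  affect it.
\<close>

definition "copy_matrix = Times iV rLen (Put aAdj (Reg iV) (Load (Add (Const 2) (Reg iV))))"

text \<open>In place of products, the row offsets \<open>u * n\<close> and \<open>v * n\<close> are
  held in \<open>rRowU\<close> and \<open>rRowV\<close>, which the enclosing loops advance by
  additions.\<close>

definition "twin_loop = Times iW rN
  (Neq (Reg iW) (Reg iU) (Neq (Reg iW) (Reg iV)
    (Neq (Arr aAdj (Add (Reg rRowU) (Reg iW))) (Arr aAdj (Add (Reg rRowV) (Reg iW))) (Set rFlag (Const 0)))))"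

text \<open>\<open>rBest\<close> starts as \<open>v\<close> and only smaller \<open>u\<close> are
  tried. As \<open>u\<close> increases, the first twin found is the least one and blocks all later
  tests.\<close>

definition "least_twin_loop = Times iU rN
  (When (Sub (Reg rBest) (Reg iU))
     (Set rFlag (Const 1) ;; twin_loop ;; When (Reg rFlag) (Set rBest (Reg iU)) Nop) Nop ;;
   Set rRowU (Add (Reg rRowU) (Reg rN)))"

definition "find_reps = Set rRowV (Const 0) ;; Times iV rN
  (Set rBest (Reg iV) ;; Set rRowU (Const 0) ;; least_twin_loop ;;
   Put aRep (Reg iV) (Reg rBest) ;; Set rRowV (Add (Reg rRowV) (Reg rN)))"

text \<open>The bracketing isolates a part that leaves its loop bound \<open>rX\<close> unchanged,
  to which \<open>cost_polynomial\<close> applies.\<close>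

definition "square = (Set rY (Const 0) ;; Times iU rX (Set rY (Add (Reg rY) (Reg rX)))) ;; Set rX (Reg rY)"

text \<open>Here the number \<open>t\<close> of classes enters the computation: one squaring per
  representative raises \<open>rX\<close> to the power \<open>2 ^ t\<close>.\<close>

definition "square_per_rep = Times iV rN (Eq (Arr aRep (Reg iV)) (Reg iV) square)"

definition "powers = Set rX (Const 3) ;; square_per_rep ;; Set rH (Reg rX) ;;
  square_per_rep ;; square ;; Set rK (Reg rX)"

text \<open>Division with remainder by \<open>2 * H\<close>, by subtraction. The added 1 turns the
  strict test into \<open>rZ \<ge> 2 * H\<close>. \<open>rK\<close> iterations suffice because the
  quotient of a number up to \<open>K\<close> is at most \<open>K\<close>.\<close>

definition "div_loop = Times iU rK
  (When (Add (Sub (Sub (Reg rZ) (Reg rH)) (Reg rH)) (Const 1))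
     (Set rZ (Sub (Sub (Reg rZ) (Reg rH)) (Reg rH)) ;; Set rQ (Add (Reg rQ) (Const 1))) Nop)"

definition "decode i = Set rZ (Reg i) ;; Times iV rN
  (Eq (Arr aRep (Reg iV)) (Reg iV)
     (Set rQ (Const 0) ;; div_loop ;; Put aDigit (Reg iV) (Sub (Reg rZ) (Reg rH)) ;; Set rZ (Reg rQ)))"

definition "init_signs = Times iV rN
  (Put aOld (Reg iV) (Const 1) ;;
   Eq (Arr aRep (Reg iV)) (Reg iV) (When (Arr aDigit (Reg iV)) (Put aOld (Reg iV) (Const (-1))) Nop))"

text \<open>The counters start from the digits instead of 0, so a class ends with its present count
  plus the proposed change. Later only the cells of representatives are read.\<close>

definition "count_negs = Times iV rN (Put aCount (Reg iV) (Arr aDigit (Reg iV))) ;;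
  Times iV rN (When (Sub (Const 0) (Arr aOld (Reg iV)))
    (Put aCount (Arr aRep (Reg iV)) (Add (Arr aCount (Arr aRep (Reg iV))) (Const 1))) Nop)"

text \<open>The counter of a class is its remaining supply of values -1 and is decreased at each of
  its vertices, also below 0. It is positive exactly when the rank of the vertex is below the
  desired count.\<close>

definition "make_canonical = Times iV rN
  (When (Arr aCount (Arr aRep (Reg iV))) (Put aNew (Reg iV) (Const (-1))) (Put aNew (Reg iV) (Const 1)) ;;
   Put aCount (Arr aRep (Reg iV)) (Sub (Arr aCount (Arr aRep (Reg iV))) (Const 1)))"

definition "sum_loop = Times iU rN
  (When (Arr aAdj (Add (Reg rRowV) (Reg iU))) (Set rSum (Add (Reg rSum) (Arr aNew (Reg iU))))
     (Eq (Reg iU) (Reg iV) (Set rSum (Add (Reg rSum) (Arr aNew (Reg iU))))))"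

definition "check_new = Set rFlag (Const 1) ;; Set rTotNew (Const 0) ;; Set rTotOld (Const 0) ;;
  Set rRowV (Const 0) ;; Times iV rN
  (Set rTotNew (Add (Reg rTotNew) (Arr aNew (Reg iV))) ;;
   Set rTotOld (Add (Reg rTotOld) (Arr aOld (Reg iV))) ;;
   Eq (Arr aRep (Reg iV)) (Reg iV) (Neq (Arr aNew (Reg iV)) (Arr aOld (Reg iV)) (Set rFlag (Const 0))) ;;
   Set rSum (Const 0) ;; sum_loop ;; When (Sub (Const 1) (Reg rSum)) (Set rFlag (Const 0)) Nop ;;
   Set rRowV (Add (Reg rRowV) (Reg rN)))"

text \<open>The added 1 turns the strict test into \<open>rTotNew \<le> rBudget\<close>.\<close>

definition "update = When (Reg rFlag)
  (When (Add (Sub (Reg rBudget) (Reg rTotNew)) (Const 1)) (Set rOut (Const 1)) Nop ;;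
   When (Sub (Reg rTotOld) (Reg rTotNew)) (Times iV rN (Put aOld (Reg iV) (Arr aNew (Reg iV)))) Nop) Nop"

definition "trial = count_negs ;; make_canonical ;; check_new ;; update"

definition "main_loop = Times iA rK (decode iA ;; init_signs ;;
  Times iR rRounds (Times iB rK (decode iB ;; trial)))"

definition "sd_prog = read_size ;; copy_matrix ;; find_reps ;; powers ;; main_loop"

lemmas prog_defs = read_size_def copy_matrix_def twin_loop_def least_twin_loop_def find_reps_def
  square_def square_per_rep_def powers_def div_loop_def decode_def init_signs_def count_negs_def
  make_canonical_def sum_loop_def check_new_def update_def trial_def main_loop_def

section \<open>Correctness of the preprocessing\<close>

lemma frame_regs: "frame p s t \<Longrightarrow> x \<notin> writes p \<Longrightarrow> fst t x = fst s x"
  and frame_arrays: "frame p s t \<Longrightarrow> j \<notin> arrays p \<Longrightarrow> j < 8 \<Longrightarrow> snd t (loc j v) = snd s (loc j v)"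
  by (auto simp: frame_def)

lemma well_formed_sd_prog: "well_formed sd_prog"
  by (simp add: sd_prog_def prog_defs)

lemma read_size:
  assumes "snd s 0 = int n" "snd s 1 = k"
  shows "fst (sem read_size s) rN = int n" "fst (sem read_size s) rBudget = k"
    "fst (sem read_size s) rRounds = int n + 1" "fst (sem read_size s) rLen = int n * int n"
    "snd (sem read_size s) = snd s" "fst (sem read_size s) rOut = fst s rOut"
proof -
  let ?p = "Times iV rN (Set rLen (Add (Reg rLen) (Reg rN)))"
  have *: "fst (sem ?p t) rLen = int n * int n \<and> snd (sem ?p t) = snd t"
    if "fst t rN = int n" "fst t rLen = 0" for t
  proof (rule sem_Times_invariant[where m = n and I = "\<lambda>k t'. fst t' rLen = int k * int n \<and> snd t' = snd t"])
    fix j u assume "frame ?p t u" "fst u rLen = int j * int n \<and> snd u = snd t"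
    then show "fst (set_reg iV (int j + 1) (sem (Set rLen (Add (Reg rLen) (Reg rN))) u)) rLen = int (Suc j) * int n \<and>
        snd (set_reg iV (int j + 1) (sem (Set rLen (Add (Reg rLen) (Reg rN))) u)) = snd t"
      using that by (simp add: frame_regs algebra_simps)
  qed (use that in auto)
  define s' where "s' = sem (Set rN (Load (Const 0)) ;; Set rBudget (Load (Const 1)) ;;
    Set rRounds (Add (Reg rN) (Const 1)) ;; Set rLen (Const 0)) s"
  have s': "fst s' rN = int n" "fst s' rBudget = k" "fst s' rRounds = int n + 1" "fst s' rLen = 0"
      "snd s' = snd s" "fst s' rOut = fst s rOut"
    using assms by (simp_all add: s'_def)
  have "sem read_size s = sem ?p s'" by (simp add: read_size_def s'_def)
  then show "fst (sem read_size s) rN = int n" "fst (sem read_size s) rBudget = k"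
    "fst (sem read_size s) rRounds = int n + 1" "fst (sem read_size s) rLen = int n * int n"
    "snd (sem read_size s) = snd s" "fst (sem read_size s) rOut = fst s rOut"
    using *[OF s'(1,4)] s' by (simp_all add: sem_not_writes del: sem.simps)
qed

lemma copy_matrix:
  assumes "fst s rLen = int m" "i < m"
  shows "snd (sem copy_matrix s) (loc aAdj (int i)) = snd s (2 + int i)"
proof -
  let ?b = "Put aAdj (Reg iV) (Load (Add (Const 2) (Reg iV)))"
  have "(\<forall>i<m. snd (sem copy_matrix s) (loc aAdj (int i)) = snd s (2 + int i)) \<and>
      (\<forall>a\<ge>0. snd (sem copy_matrix s) a = snd s a)"
    unfolding copy_matrix_def
  proof (rule sem_Times_invariant[where I = "\<lambda>k t. (\<forall>i<k. snd t (loc aAdj (int i)) = snd s (2 + int i)) \<and>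
      (\<forall>a\<ge>0. snd t a = snd s a)"])
    fix k t assume *: "fst t iV = int k"
      "(\<forall>i<k. snd t (loc aAdj (int i)) = snd s (2 + int i)) \<and> (\<forall>a\<ge>0. snd t a = snd s a)"
    have "loc aAdj (int k) \<noteq> a" if "a \<ge> 0" for a using loc_neg[of "int k" aAdj] that by linarith
    then show "(\<forall>i<Suc k. snd (set_reg iV (int k + 1) (sem ?b t)) (loc aAdj (int i)) = snd s (2 + int i)) \<and>
      (\<forall>a\<ge>0. snd (set_reg iV (int k + 1) (sem ?b t)) a = snd s a)"
      using * by (auto simp: less_Suc_eq)
  qed (use assms in auto)
  then show ?thesis using assms(2) by blast
qed

lemma square:
  assumes "fst s rX = int x"
  shows "fst (sem square s) rX = int (x * x)"
proof -
  let ?p = "Times iU rX (Set rY (Add (Reg rY) (Reg rX)))"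
  have *: "fst (sem ?p t) rY = int x * int x" if "fst t rX = int x" "fst t rY = 0" for t
  proof (rule sem_Times_invariant[where m = x and I = "\<lambda>k t'. fst t' rY = int k * int x"])
    fix j u assume "frame ?p t u" "fst u rY = int j * int x"
    then show "fst (set_reg iU (int j + 1) (sem (Set rY (Add (Reg rY) (Reg rX))) u)) rY = int (Suc j) * int x"
      using that by (simp add: frame_regs algebra_simps)
  qed (use that in auto)
  have "sem square s = set_reg rX (fst (sem ?p (set_reg rY 0 s)) rY) (sem ?p (set_reg rY 0 s))"
    by (simp add: square_def)
  then show ?thesis using *[of "set_reg rY 0 s"] assms by simp
qed

context index_graph
begin

definition graph_loaded :: "config \<Rightarrow> bool" where
  "graph_loaded t \<longleftrightarrow> fst t rN = int n \<and>
     (\<forall>u<n. \<forall>v<n. snd t (loc aAdj (int u * int n + int v)) = (if a u v then 1 else 0))"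

definition reps_loaded :: "config \<Rightarrow> bool" where
  "reps_loaded t \<longleftrightarrow> (\<forall>v<n. snd t (loc aRep (int v)) = int (rep v))"

lemma graph_loaded_frame:
  "graph_loaded s \<Longrightarrow> frame p s t \<Longrightarrow> rN \<notin> writes p \<Longrightarrow> aAdj \<notin> arrays p \<Longrightarrow> graph_loaded t"
  by (simp add: graph_loaded_def frame_def)

lemma reps_loaded_frame:
  "reps_loaded s \<Longrightarrow> frame p s t \<Longrightarrow> aRep \<notin> arrays p \<Longrightarrow> reps_loaded t"
  by (simp add: reps_loaded_def frame_def)

lemma graph_loadedD:
  "graph_loaded t \<Longrightarrow> fst t rN = int n"
  "graph_loaded t \<Longrightarrow> u < n \<Longrightarrow> v < n \<Longrightarrow>
    snd t (loc aAdj (int u * int n + int v)) = (if a u v then 1 else 0)"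
  by (simp_all add: graph_loaded_def)

lemma twin_loop:
  assumes g: "graph_loaded s" and u: "u < n" "fst s iU = int u" "fst s rRowU = int u * int n"
    and v: "v < n" "fst s iV = int v" "fst s rRowV = int v * int n" and flag: "fst s rFlag = 1"
  shows "fst (sem twin_loop s) rFlag = (if twin u v then 1 else 0)"
  unfolding twin_loop_def twin_def
proof (rule sem_Times_invariant[where m = n and I =
    "\<lambda>k t. fst t rFlag = (if \<forall>w<k. w \<noteq> u \<longrightarrow> w \<noteq> v \<longrightarrow> a u w = a v w then 1 else 0)"], goal_cases)
  case (4 k t)
  note fr = 4(2)
  have r: "fst t iU = int u" "fst t iV = int v" "fst t rRowU = int u * int n" "fst t rRowV = int v * int n"
    using u v frame_regs[OF fr] by simp_all
  have gt: "graph_loaded t" using graph_loaded_frame[OF g fr] by simp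
  have split: "(\<forall>w<Suc k. w \<noteq> u \<longrightarrow> w \<noteq> v \<longrightarrow> a u w = a v w) \<longleftrightarrow>
      (\<forall>w<k. w \<noteq> u \<longrightarrow> w \<noteq> v \<longrightarrow> a u w = a v w) \<and> \<not> (k \<noteq> u \<and> k \<noteq> v \<and> a u k \<noteq> a v k)"
    by (simp only: less_Suc_eq) blast
  let ?b = "Neq (Reg iW) (Reg iU) (Neq (Reg iW) (Reg iV)
      (Neq (Arr aAdj (Add (Reg rRowU) (Reg iW))) (Arr aAdj (Add (Reg rRowV) (Reg iW))) (Set rFlag (Const 0))))"
  have "fst (set_reg iW (int k + 1) (sem ?b t)) rFlag =
      (if k \<noteq> u \<and> k \<noteq> v \<and> a u k \<noteq> a v k then 0 else fst t rFlag)"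
    using 4(1,3) r graph_loadedD(2)[OF gt u(1), of k] graph_loadedD(2)[OF gt v(1), of k] by simp
  moreover have "(if A then 0 else if P then 1 else 0) = (if P \<and> \<not> A then 1 else 0 :: int)" for A P by simp
  ultimately show ?case unfolding split 4(4) by (rule trans)
qed (use g flag in \<open>auto simp: graph_loaded_def\<close>)

lemma twin_loop_meta [simp]:
  "writes twin_loop = {iW, rFlag}" "arrays twin_loop = {}" "well_formed twin_loop"
  by (auto simp: twin_loop_def)

lemma least_twin_loop:
  assumes g: "graph_loaded s" and v: "v < n" "fst s iV = int v" "fst s rRowV = int v * int n"
    and init: "fst s rBest = int v" "fst s rRowU = 0"
  shows "fst (sem least_twin_loop s) rBest = int (rep v)"
proof -
  have "fst (sem least_twin_loop s) rBest = (if rep v < n then int (rep v) else int v) \<and>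
      fst (sem least_twin_loop s) rRowU = int n * int n"
    unfolding least_twin_loop_def
  \<comment> \<open>No vertex below \<open>rep v\<close> is a twin of \<open>v\<close>, so
    \<open>rBest\<close> keeps its initial value until the counter has passed
    \<open>rep v\<close>.\<close>
  proof (rule sem_Times_invariant[where I = "\<lambda>k t. fst t rBest = (if rep v < k then int (rep v) else int v) \<and>
      fst t rRowU = int k * int n"], goal_cases)
    case (4 k t)
    note fr = 4(2)
    have r: "fst t iV = int v" "fst t rRowV = int v * int n" using v frame_regs[OF fr] by simp_all
    have gt: "graph_loaded t" using graph_loaded_frame[OF g fr] by simp
    let ?t = "set_reg rFlag 1 t"
    have tw: "fst (sem twin_loop ?t) rFlag = (if twin k v then 1 else 0)"
      using 4 r v gt by (intro twin_loop) (auto simp: graph_loaded_def)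
    have k: "twin k v \<Longrightarrow> rep v \<le> k" by (simp add: rep_def Least_le)
    have k': "rep v = k \<Longrightarrow> twin k v" using twin_rep by metis
    show ?case
    proof (cases "rep v < k")
      case True
      then show ?thesis using 4 graph_loadedD(1)[OF gt] by (simp add: algebra_simps)
    next
      case False
      show ?thesis
      proof (cases "k < v")
        case True
        then show ?thesis
          using False 4 graph_loadedD(1)[OF gt] tw k k'
          by (auto simp: sem_not_writes algebra_simps)
      next
        case F: False
        then have "rep v = v \<and> k = v \<or> v < k" using False rep_le[of v] by auto
        then show ?thesis using False F 4 graph_loadedD(1)[OF gt] rep_le[of v]
          by (auto simp: algebra_simps)
      qed
    qed
  qed (use g init in \<open>auto simp: graph_loaded_def\<close>)
  then show ?thesis using v by simp
qed

lemma least_twin_loop_meta [simp]: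
  "writes least_twin_loop = {iU, rBest, iW, rFlag, rRowU}" "arrays least_twin_loop = {}" "well_formed least_twin_loop"
  by (auto simp: least_twin_loop_def)

lemma find_reps:
  assumes "graph_loaded s"
  shows "reps_loaded (sem find_reps s)"
proof -
  let ?b = "Set rBest (Reg iV) ;; Set rRowU (Const 0) ;; least_twin_loop ;;
   Put aRep (Reg iV) (Reg rBest) ;; Set rRowV (Add (Reg rRowV) (Reg rN))"
  let ?p = "Times iV rN ?b"
  let ?s = "set_reg rRowV 0 s"
  have gs: "graph_loaded ?s" using assms by (simp add: graph_loaded_def)
  have "(\<forall>v<n. snd (sem ?p ?s) (loc aRep (int v)) = int (rep v)) \<and> fst (sem ?p ?s) rRowV = int n * int n"
  proof (rule sem_Times_invariant[where I = "\<lambda>k t. (\<forall>v<k. snd t (loc aRep (int v)) = int (rep v)) \<and>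
      fst t rRowV = int k * int n"], goal_cases)
    case (4 k t)
    have gt: "graph_loaded t" using graph_loaded_frame[OF gs 4(2)] by simp
    let ?t = "set_reg rRowU 0 (set_reg rBest (int k) t)"
    have "fst (sem least_twin_loop ?t) rBest = int (rep k)"
      using gt 4 by (intro least_twin_loop) (auto simp: graph_loaded_def)
    then show ?case using 4 graph_loadedD(1)[OF gt]
      by (auto simp: sem_not_writes sem_not_arrays less_Suc_eq algebra_simps)
  qed (use gs in \<open>auto simp: graph_loaded_def\<close>)
  then show ?thesis by (simp add: find_reps_def reps_loaded_def)
qed

end

lemma square_meta [simp]:
  "writes square = {rY, iU, rX}" "arrays square = {}" "well_formed square"
  by (auto simp: square_def)

lemma div_loop_meta [simp]:
  "writes div_loop = {iU, rZ, rQ}" "arrays div_loop = {}" "well_formed div_loop"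
  by (auto simp: div_loop_def)

lemma square_per_rep_meta [simp]:
  "writes square_per_rep = {iV, rY, iU, rX}" "arrays square_per_rep = {}" "well_formed square_per_rep"
  by (auto simp: square_per_rep_def)

lemma cost_square: "\<exists>W d. \<forall>s M. M \<ge> 1 \<longrightarrow> fst s rX \<le> int M \<longrightarrow> cost square s \<le> W * M ^ d"
proof -
  let ?p = "Set rY (Const 0) ;; Times iU rX (Set rY (Add (Reg rY) (Reg rX)))"
  have "loop_bounds ?p \<inter> writes ?p = {}" by simp
  from cost_polynomial[OF this] obtain W d where
    *: "\<And>s M. M \<ge> 1 \<Longrightarrow> fst s rX \<le> int M \<Longrightarrow> cost ?p s \<le> W * M ^ d" by auto
  have "cost square s \<le> (W + 2) * M ^ d" if "M \<ge> 1" "fst s rX \<le> int M" for s M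
  proof -
    have "cost square s = cost ?p s + 2" by (simp add: square_def)
    also have "\<dots> \<le> W * M ^ d + 2 * M ^ d" using *[OF that] that(1) by (intro add_mono) auto
    finally show ?thesis by (simp add: algebra_simps)
  qed
  then show ?thesis by blast
qed

section \<open>Bounds by repeated squaring and the enumeration by digits\<close>

context index_graph
begin

text \<open>For a representative \<open>c\<close>, \<open>nrep c\<close> is the position of its
  digit.\<close>

definition nrep :: "nat \<Rightarrow> nat" where "nrep k = card {v. v < k \<and> rep v = v}"

lemma nrep_0 [simp]: "nrep 0 = 0" by (simp add: nrep_def)

lemma nrep_Suc: "nrep (Suc k) = (if rep k = k then Suc (nrep k) else nrep k)"
proof -
  have "{v. v < Suc k \<and> rep v = v} = (if rep k = k then insert k {v. v < k \<and> rep v = v} else {v. v < k \<and> rep v = v})"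
    by (auto simp: less_Suc_eq)
  then show ?thesis by (simp add: nrep_def)
qed

lemma nrep_n: "nrep n = card reps" by (simp add: nrep_def reps_def)

lemma nrep_mono: "k \<le> l \<Longrightarrow> nrep k \<le> nrep l"
  unfolding nrep_def by (rule card_mono) auto

text \<open>The bound of the inner loop changes from one squaring to the next, so the cost needs the
  invariant on \<open>rX\<close>; value and cost therefore share one proof.\<close>

lemma square_per_rep:
  assumes s: "graph_loaded s" "reps_loaded s" "fst s rX = 3 ^ 2 ^ m"
  shows "fst (sem square_per_rep s) rX = 3 ^ 2 ^ (m + card reps)"
    and "(\<And>t M. M \<ge> 1 \<Longrightarrow> fst t rX \<le> int M \<Longrightarrow> cost square t \<le> W * M ^ d) \<Longrightarrow>
      3 ^ 2 ^ (m + card reps) \<le> M \<Longrightarrow> cost square_per_rep s \<le> 6 + n * (57 + W * M ^ d)"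
proof -
  let ?b = "Eq (Arr aRep (Reg iV)) (Reg iV) square"
  let ?I = "\<lambda>k t. fst t rX = 3 ^ 2 ^ (m + nrep k)"
  have well_formed: "well_formed (Times iV rN ?b)" and n: "fst s rN = int n" and init: "?I 0 (set_reg iV 0 s)"
    using s by (auto simp: graph_loaded_def)
  have step: "?I (Suc k) (set_reg iV (int k + 1) (sem ?b t))"
    if "k < n" "frame (Times iV rN ?b) s t" "fst t iV = int k" "?I k t" for k t
  proof -
    have "reps_loaded t" using reps_loaded_frame[OF s(2) that(2)] by simp
    then have "snd t (loc aRep (int k)) = int (rep k)" using that(1) by (simp add: reps_loaded_def)
    moreover have "fst (sem square t) rX = 3 ^ 2 ^ (m + Suc (nrep k))"
      using square[of t "3 ^ 2 ^ (m + nrep k)"] that(4) by (simp add: power_add[symmetric] mult_2)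
    ultimately show ?thesis using that by (simp add: nrep_Suc)
  qed
  show "fst (sem square_per_rep s) rX = 3 ^ 2 ^ (m + card reps)"
  proof -
    have "?I n (sem (Times iV rN ?b) s)"
      by (rule sem_Times_invariant[where I = ?I, OF well_formed n init]) (rule step)
    then show ?thesis by (simp only: square_per_rep_def nrep_n)
  qed
  assume W: "\<And>t M. M \<ge> 1 \<Longrightarrow> fst t rX \<le> int M \<Longrightarrow> cost square t \<le> W * M ^ d"
    and M: "3 ^ 2 ^ (m + card reps) \<le> M"
  \<comment> \<open>The equality test costs less than 49, and the loop overhead of 8 then makes
    57.\<close>
  have "cost ?b t \<le> 49 + W * M ^ d" if "k < n" "?I k t" for k t
  proof -
    have "fst t rX \<le> 3 ^ 2 ^ (m + card reps)"
      using that nrep_mono[of k n] by (simp add: nrep_n)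
    also have "\<dots> \<le> int M" using of_nat_mono[OF M, where 'a = int]
      by (simp only: of_nat_power of_nat_numeral)
    finally have "cost square t \<le> W * M ^ d"
      using W M order_trans[OF _ M, of 1] by simp
    moreover have "cost ?b t \<le> 2 * expr_cost (Arr aRep (Reg iV)) + 2 * expr_cost (Reg iV) + 5 + cost square t"
      by (rule cost_Eq)
    moreover have "2 * expr_cost (Arr aRep (Reg iV)) + 2 * expr_cost (Reg iV) + 5 \<le> 49"
      by (simp add: Arr_def loc_expr_def Let_def)
    ultimately show ?thesis by linarith
  qed
  then have "cost (Times iV rN ?b) s \<le> 6 + n * (8 + (49 + W * M ^ d))"
    by (intro cost_Times_invariant[where I = ?I, OF well_formed n init]) (rule step)
  then show "cost square_per_rep s \<le> 6 + n * (57 + W * M ^ d)"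
    by (simp only: square_per_rep_def) simp
qed

definition H :: nat where "H = 3 ^ 2 ^ card reps"
definition K :: nat where "K = 3 ^ 2 ^ (2 * card reps + 1)"

lemma powers:
  assumes s: "graph_loaded s" "reps_loaded s"
  shows "fst (sem powers s) rH = int H" "fst (sem powers s) rK = int K"
proof -
  define s1 where "s1 = set_reg rX 3 s"
  define s2 where "s2 = sem square_per_rep s1"
  define s3 where "s3 = set_reg rH (fst s2 rX) s2"
  define s4 where "s4 = sem square_per_rep s3"
  define s5 where "s5 = sem square s4"
  have "graph_loaded s1" "reps_loaded s1" using s by (auto simp: s1_def graph_loaded_def reps_loaded_def)
  then have 2: "fst s2 rX = 3 ^ 2 ^ card reps" "graph_loaded s3" "reps_loaded s3"
    using square_per_rep(1)[of s1 0] unfolding s2_def s3_def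
    by (auto simp: s1_def graph_loaded_def reps_loaded_def sem_not_writes sem_not_arrays)
  then have 4: "fst s4 rX = 3 ^ 2 ^ (2 * card reps)" "fst s4 rH = int H"
    using square_per_rep(1)[of s3 "card reps"] unfolding s4_def
    by (auto simp: s3_def sem_not_writes H_def mult_2)
  then have "fst s5 rX = int K" "fst s5 rH = int H"
    using square[of s4 "3 ^ 2 ^ (2 * card reps)"] unfolding s5_def
    by (auto simp: sem_not_writes K_def power_add[symmetric] mult_2)
  moreover have "sem powers s = set_reg rK (fst s5 rX) s5"
    by (simp add: powers_def s1_def s2_def s3_def s4_def s5_def)
  ultimately show "fst (sem powers s) rH = int H" "fst (sem powers s) rK = int K" by simp_all
qed

lemma H_pos: "H > 0" by (simp add: H_def)

text \<open>The shift by \<open>H\<close> gives digits from \<open>- H\<close> to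
  \<open>H - 1\<close>, so that moves can change counts in both directions.\<close>

definition digit :: "nat \<Rightarrow> nat \<Rightarrow> int" where
  "digit j v = int (j div (2 * H) ^ nrep v mod (2 * H)) - int H"

text \<open>The digits are attached from the least significant one upwards. A new top digit adds a
  multiple of \<open>b ^ Suc (nrep c)\<close> for each earlier representative \<open>c\<close>,
  which leaves the digit of \<open>c\<close> unchanged.\<close>

lemma digits_exist:
  assumes "\<forall>c\<in>reps. \<bar>d c\<bar> < int H"
  shows "\<exists>j<(2 * H) ^ nrep m. \<forall>c<m. c \<in> reps \<longrightarrow> digit j c = d c"
proof (induction m)
  case (Suc m)
  then obtain j where j: "j < (2 * H) ^ nrep m" "\<forall>c<m. c \<in> reps \<longrightarrow> digit j c = d c" by blast
  show ?case
  proof (cases "m \<in> reps")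
    case False
    have "(2 * H) ^ nrep m \<le> (2 * H) ^ nrep (Suc m)" using H_pos nrep_mono[of m "Suc m"] by (intro power_increasing) auto
    then show ?thesis using j False by (auto simp: less_Suc_eq intro!: exI[of _ j])
  next
    case True
    define b where "b = 2 * H"
    have b: "b > 0" using H_pos by (simp add: b_def)
    have digit: "digit j v = int (j div b ^ nrep v mod b) - int H" for j v
      by (simp add: digit_def b_def)
    note j = j[folded b_def]
    define x where "x = nat (d m + int H)"
    have dm: "\<bar>d m\<bar> < int H" using assms True by blast
    then have x: "x < b" "int x - int H = d m" by (auto simp: x_def b_def)
    let ?j = "j + x * b ^ nrep m"
    have "(x + 1) * b ^ nrep m \<le> b * b ^ nrep m" using x by (intro mult_right_mono) auto
    then have "?j < b ^ nrep (Suc m)" using j(1) True by (simp add: nrep_Suc rep_reps)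
    moreover have "digit ?j c = d c" if c: "c < Suc m" "c \<in> reps" for c
    proof (cases "c = m")
      case True
      then show ?thesis using j(1) x b by (simp add: digit)
    next
      case False
      then have "c < m" using c by simp
      have "nrep (Suc c) \<le> nrep m" using nrep_mono \<open>c < m\<close> by simp
      then obtain e where e: "nrep m = nrep c + Suc e"
        using c(2) by (auto simp: nrep_Suc rep_reps dest: le_Suc_ex)
      have "?j = j + b ^ nrep c * (b * (x * b ^ e))" by (simp add: e power_add)
      moreover have "(j + b ^ nrep c * (b * (x * b ^ e))) div b ^ nrep c = b * (x * b ^ e) + j div b ^ nrep c"
        by (rule div_mult_self2) (use b in simp)
      ultimately have "?j div b ^ nrep c = b * (x * b ^ e) + j div b ^ nrep c" by (simp only:)
      then have "?j div b ^ nrep c mod b = j div b ^ nrep c mod b" by simp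
      then show ?thesis using j(2) \<open>c < m\<close> c by (simp add: digit)
    qed
    ultimately show ?thesis unfolding b_def by blast
  qed
qed simp

text \<open>Since \<open>H \<ge> 3\<close>, \<open>2 * H \<le> H * H\<close>. Raising the resulting
  exponent from \<open>2 * t\<close> to \<open>2 * 2 ^ t\<close>, with \<open>t = card reps\<close>,
  gives a number that is reached from 3 by squarings alone.\<close>

lemma K_ge: "(2 * H) ^ card reps \<le> K"
proof -
  have "3 ^ 1 \<le> (3::nat) ^ 2 ^ card reps" by (intro power_increasing) auto
  then have "2 * H \<le> H * H" unfolding H_def by (intro mult_right_mono) auto
  then have "(2 * H) ^ card reps \<le> (H * H) ^ card reps" by (rule power_mono) simp
  also have "\<dots> = H ^ (2 * card reps)" by (simp add: power_mult power2_eq_square)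
  also have "\<dots> \<le> H ^ (2 * 2 ^ card reps)"
    using H_pos less_exp[of "card reps"] by (intro power_increasing) auto
  also have "\<dots> = K" by (simp add: H_def K_def power_mult[symmetric] power_add mult_2 ac_simps)
  finally show ?thesis .
qed

lemma digits_cover:
  assumes "\<forall>c\<in>reps. \<bar>d c\<bar> \<le> int (block_bound (card reps))"
  shows "\<exists>j<K. \<forall>c\<in>reps. digit j c = d c"
proof -
  have "block_bound (card reps) < H"
    using block_bound_le[of "card reps"] H_pos unfolding H_def[symmetric] by linarith
  then have "\<forall>c\<in>reps. \<bar>d c\<bar> < int H" using assms by fastforce
  from digits_exist[OF this, of n] obtain j where "j < (2 * H) ^ card reps" "\<forall>c<n. c \<in> reps \<longrightarrow> digit j c = d c"
    by (auto simp: nrep_n)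
  then show ?thesis using K_ge reps_less by (intro exI[of _ j]) auto
qed

lemma div_loop:
  assumes z: "fst s rZ = int z" "z \<le> k" and "fst s rQ = 0" "fst s rH = int H" "fst s rK = int k"
  shows "fst (sem div_loop s) rZ = int (z mod (2 * H))" "fst (sem div_loop s) rQ = int (z div (2 * H))"
proof -
  let ?b = "2 * int H"
  \<comment> \<open>The quotient grows by 1 per iteration until it reaches its final value, and the
    remaining iterations do nothing.\<close>
  have "fst (sem div_loop s) rQ = min (int k) (int (z div (2 * H))) \<and>
    fst (sem div_loop s) rZ = int z - fst (sem div_loop s) rQ * ?b"
    unfolding div_loop_def
  proof (rule sem_Times_invariant[where I = "\<lambda>k t. fst t rQ = min (int k) (int (z div (2 * H))) \<and>
    fst t rZ = int z - fst t rQ * ?b"], goal_cases)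
    case (4 j t)
    have H: "fst t rH = int H" using frame_regs[OF 4(2), of rH] assms by simp
    let ?q = "z div (2 * H)"
    have le: "m \<le> ?q \<longleftrightarrow> int m * ?b \<le> int z" for m
    proof -
      have "m \<le> ?q \<longleftrightarrow> m * (2 * H) \<le> z" using H_pos by (intro less_eq_div_iff_mult_less_eq) simp
      also have "\<dots> \<longleftrightarrow> int (m * (2 * H)) \<le> int z" by (simp only: of_nat_le_iff)
      also have "int (m * (2 * H)) = int m * ?b" by (simp only: of_nat_mult of_nat_numeral)
      finally show ?thesis .
    qed
    show ?case
    proof (cases "j < ?q")
      case True
      then have "(int j + 1) * ?b \<le> int z" using le[of "Suc j"] by (simp add: add.commute)
      moreover have "fst t rQ = int j" "fst t rZ = int z - int j * ?b" using 4 True by simp_all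
      ultimately show ?thesis using H True by (simp add: distrib_right)
    next
      case False
      then have "\<not> (int ?q + 1) * ?b \<le> int z" using le[of "Suc ?q"] by (simp add: add.commute)
      moreover have "fst t rQ = int ?q" "fst t rZ = int z - int ?q * ?b" using 4 False by simp_all
      ultimately show ?thesis using H False by (simp add: distrib_right)
    qed
  qed (use assms in auto)
  moreover have "z div (2 * H) \<le> k" using z div_le_dividend le_trans by blast
  ultimately have *: "fst (sem div_loop s) rQ = int (z div (2 * H))"
      "fst (sem div_loop s) rZ = int z - int (z div (2 * H)) * ?b" by auto
  show "fst (sem div_loop s) rQ = int (z div (2 * H))" by fact
  show "fst (sem div_loop s) rZ = int (z mod (2 * H))"
    using *(2) by (simp add: minus_div_mult_eq_mod[symmetric] of_nat_mod zdiv_int)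
qed

definition digits_loaded :: "config \<Rightarrow> (nat \<Rightarrow> int) \<Rightarrow> bool" where
  "digits_loaded t z \<longleftrightarrow> (\<forall>c\<in>reps. snd t (loc aDigit (int c)) = z c)"

definition stored :: "nat \<Rightarrow> config \<Rightarrow> (nat \<Rightarrow> int) \<Rightarrow> bool" where
  "stored j t f \<longleftrightarrow> (\<forall>v<n. snd t (loc j (int v)) = f v)"

lemma reps_loadedD: "reps_loaded t \<Longrightarrow> v < n \<Longrightarrow> snd t (loc aRep (int v)) = int (rep v)"
  by (simp add: reps_loaded_def)

lemma decode:
  assumes s: "graph_loaded s" "reps_loaded s" and j: "fst s i = int j" "j \<le> K"
    and r: "fst s rH = int H" "fst s rK = int K"
  shows "digits_loaded (sem (decode i) s) (digit j)"
proof -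
  let ?b = "Eq (Arr aRep (Reg iV)) (Reg iV)
     (Set rQ (Const 0) ;; div_loop ;; Put aDigit (Reg iV) (Sub (Reg rZ) (Reg rH)) ;; Set rZ (Reg rQ))"
  let ?s = "set_reg rZ (fst s i) s"
  \<comment> \<open>\<open>rZ\<close> holds what is left of \<open>j\<close> after removing the
    digits of the representatives already passed.\<close>
  let ?I = "\<lambda>k t. fst t rZ = int (j div (2 * H) ^ nrep k) \<and>
    (\<forall>v<k. rep v = v \<longrightarrow> snd t (loc aDigit (int v)) = digit j v)"
  have "?I n (sem (Times iV rN ?b) ?s)"
  proof (rule sem_Times_invariant[where I = ?I], goal_cases)
    case (4 k t)
    have "reps_loaded t" using reps_loaded_frame[OF s(2), of "Times iV rN ?b" t] 4(2) by (simp add: frame_def)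
    then have rep: "snd t (loc aRep (int k)) = int (rep k)" using 4(1) by (rule reps_loadedD)
    have regs: "fst t rH = int H" "fst t rK = int K" using frame_regs[OF 4(2)] r by simp_all
    show ?case
    proof (cases "rep k = k")
      case False
      then show ?thesis using rep 4 by (auto simp: nrep_Suc less_Suc_eq)
    next
      case True
      let ?z = "j div (2 * H) ^ nrep k"
      let ?t = "sem div_loop (set_reg rQ 0 t)"
      have "?z \<le> K" using j(2) div_le_dividend le_trans by blast
      then have "fst ?t rZ = int (?z mod (2 * H))" "fst ?t rQ = int (?z div (2 * H))"
        using div_loop[of "set_reg rQ 0 t" ?z K] 4 regs by auto
      moreover have "?z div (2 * H) = j div (2 * H) ^ nrep (Suc k)"
      proof -
        have "nrep (Suc k) = Suc (nrep k)" using True by (simp add: nrep_Suc)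
        then show ?thesis by (simp only: power_Suc2 div_mult2_eq[of j _ "2 * H"])
      qed
      moreover have "fst ?t iV = int k" "fst ?t rH = int H" using 4 regs by (simp_all add: sem_not_writes)
      moreover have "\<forall>v<k. rep v = v \<longrightarrow> snd ?t (loc aDigit (int v)) = digit j v"
        using 4(4) by (simp add: sem_not_arrays)
      moreover have "digit j k = int (?z mod (2 * H)) - int H" by (simp add: digit_def)
      moreover have "sem ?b t = sem (Put aDigit (Reg iV) (Sub (Reg rZ) (Reg rH)) ;; Set rZ (Reg rQ)) ?t"
        using rep True 4(3) by simp
      ultimately show ?thesis by (auto simp: less_Suc_eq)
    qed
  qed (use s j in \<open>auto simp: graph_loaded_def\<close>)
  moreover have "sem (decode i) s = sem (Times iV rN ?b) ?s" by (simp add: decode_def del: sem.simps(6))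
  ultimately show ?thesis by (auto simp: digits_loaded_def reps_def)
qed

section \<open>Correctness of the search program\<close>

lemma init_signs:
  assumes "graph_loaded s" "reps_loaded s" "digits_loaded s z"
  shows "stored aOld (sem init_signs s) (start z)"
  unfolding init_signs_def stored_def
proof (rule sem_Times_invariant[where m = n and I = "\<lambda>k t. \<forall>v<k. snd t (loc aOld (int v)) = start z v"], goal_cases)
  case (4 k t)
  have "snd t (loc aRep (int k)) = int (rep k)"
    using reps_loadedD[OF reps_loaded_frame[OF assms(2) 4(2)] 4(1)] by simp
  moreover have "rep k = k \<Longrightarrow> snd t (loc aDigit (int k)) = z k"
    using assms(3) 4(1) frame_arrays[OF 4(2), of aDigit] by (simp add: digits_loaded_def reps_def)
  ultimately show ?case using 4 by (auto simp: less_Suc_eq start_def)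
qed (use assms in \<open>auto simp: graph_loaded_def\<close>)

lemma count_negs:
  assumes s: "graph_loaded s" "reps_loaded s" "digits_loaded s z" "stored aOld s f" "signs f" and c: "c \<in> reps"
  shows "snd (sem count_negs s) (loc aCount (int c)) = negs f c + z c"
proof -
  let ?p = "Times iV rN (Put aCount (Reg iV) (Arr aDigit (Reg iV)))"
  let ?b = "When (Sub (Const 0) (Arr aOld (Reg iV)))
    (Put aCount (Arr aRep (Reg iV)) (Add (Arr aCount (Arr aRep (Reg iV))) (Const 1))) Nop"
  let ?q = "Times iV rN ?b"
  define s' where "s' = sem ?p s"
  have fr: "frame ?p s s'" unfolding s'_def by (rule frame_sem) simp
  have "\<forall>v<n. snd s' (loc aCount (int v)) = snd s (loc aDigit (int v))"
    unfolding s'_def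
  proof (rule sem_Times_invariant[where m = n and
      I = "\<lambda>k t. \<forall>v<k. snd t (loc aCount (int v)) = snd s (loc aDigit (int v))"], goal_cases)
    case (4 k t)
    then show ?case using frame_arrays[OF 4(2), of aDigit] by (auto simp: less_Suc_eq)
  qed (use s in \<open>auto simp: graph_loaded_def\<close>)
  then have z: "snd s' (loc aCount (int c)) = z c" if "c \<in> reps" for c
    using s(3) that by (simp add: digits_loaded_def reps_def)
  have s': "graph_loaded s'" "reps_loaded s'" using graph_loaded_frame[OF s(1) fr] reps_loaded_frame[OF s(2) fr] by simp_all
  let ?I = "\<lambda>k t. \<forall>c\<in>reps. snd t (loc aCount (int c)) = z c + int (card {v. v < k \<and> rep v = c \<and> f v = -1})"
  have "?I n (sem ?q s')"
  proof (rule sem_Times_invariant[where I = ?I], goal_cases)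
    case (4 k t)
    have rep: "snd t (loc aRep (int k)) = int (rep k)"
      using reps_loadedD[OF reps_loaded_frame[OF s'(2) 4(2)] 4(1)] by simp
    have old: "snd t (loc aOld (int k)) = f k"
      using frame_arrays[OF 4(2), of aOld] frame_arrays[OF fr, of aOld] s(4) 4(1) by (simp add: stored_def)
    have fk: "f k = -1 \<or> f k = 1" using s(5) 4(1) by (simp add: signs_def)
    have "{v. v < Suc k \<and> rep v = c \<and> f v = -1} =
        (if rep k = c \<and> f k = -1 then insert k {v. v < k \<and> rep v = c \<and> f v = -1}
         else {v. v < k \<and> rep v = c \<and> f v = -1})" for c
      by (auto simp: less_Suc_eq)
    then have "card {v. v < Suc k \<and> rep v = c \<and> f v = -1} =
        (if rep k = c \<and> f k = -1 then 1 else 0) + card {v. v < k \<and> rep v = c \<and> f v = -1}" for c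
      by simp
    then show ?case using 4 rep old fk rep_in_reps[OF 4(1)] by auto
  qed (use s' z in \<open>auto simp: graph_loaded_def\<close>)
  moreover have "sem count_negs s = sem ?q s'" by (simp add: count_negs_def s'_def)
  ultimately show ?thesis using c by (simp add: negs_def)
qed

lemma make_canonical:
  assumes s: "graph_loaded s" "reps_loaded s" "\<And>c. c \<in> reps \<Longrightarrow> snd s (loc aCount (int c)) = y c"
  shows "stored aNew (sem make_canonical s) (canon y)"
proof -
  let ?I = "\<lambda>k t. (\<forall>v<k. snd t (loc aNew (int v)) = canon y v) \<and>
    (\<forall>c\<in>reps. snd t (loc aCount (int c)) = y c - int (card {v. v < k \<and> rep v = c}))"
  have "?I n (sem make_canonical s)"
    unfolding make_canonical_def
  proof (rule sem_Times_invariant[where m = n and I = ?I], goal_cases)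
    case (4 k t)
    have rep: "snd t (loc aRep (int k)) = int (rep k)"
      using reps_loadedD[OF reps_loaded_frame[OF s(2) 4(2)] 4(1)] by simp
    have "{v. v < Suc k \<and> rep v = c} = (if rep k = c then insert k {v. v < k \<and> rep v = c} else {v. v < k \<and> rep v = c})" for c
      by (auto simp: less_Suc_eq)
    then have card: "card {v. v < Suc k \<and> rep v = c} = (if rep k = c then 1 else 0) + card {v. v < k \<and> rep v = c}" for c
      by simp
    have cnt: "snd t (loc aCount (int (rep k))) = y (rep k) - int (card {v. v < k \<and> rep v = rep k})"
      using 4(1,4) by simp
    show ?case using 4 rep cnt card by (auto simp: canon_def less_Suc_eq)
  qed (use s in \<open>auto simp: graph_loaded_def\<close>)
  then show ?thesis by (simp add: stored_def)
qed

end

lemma trial_meta [simp]: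
  "writes sum_loop = {iU, rSum}" "arrays sum_loop = {}" "well_formed sum_loop"
  "writes count_negs = {iV}" "arrays count_negs = {aCount}" "well_formed count_negs"
  "writes make_canonical = {iV}" "arrays make_canonical = {aNew, aCount}" "well_formed make_canonical"
  "writes check_new = {iV, iU, rFlag, rTotNew, rTotOld, rRowV, rSum}" "arrays check_new = {}" "well_formed check_new"
  "writes update = {rOut, iV}" "arrays update = {aOld}" "well_formed update"
  by (auto simp: sum_loop_def count_negs_def make_canonical_def check_new_def update_def)

lemma main_meta [simp]:
  "writes trial = {iV, iU, rFlag, rTotNew, rTotOld, rRowV, rSum, rOut}"
  "arrays trial = {aCount, aNew, aOld}" "well_formed trial"
  "writes init_signs = {iV}" "arrays init_signs = {aOld}" "well_formed init_signs"
  "writes (decode i) = {rZ, iV, rQ, iU}" "arrays (decode i) = {aDigit}" "well_formed (decode i)"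
  by (auto simp: trial_def init_signs_def decode_def)

context index_graph
begin

lemma stored_frame:
  "stored j s f \<Longrightarrow> frame p s t \<Longrightarrow> j \<notin> arrays p \<Longrightarrow> j < 8 \<Longrightarrow> stored j t f"
  by (simp add: stored_def frame_def)

lemma storedD: "stored j t f \<Longrightarrow> v < n \<Longrightarrow> snd t (loc j (int v)) = f v"
  by (simp add: stored_def)

lemma sum_loop:
  assumes s: "graph_loaded s" "stored aNew s f" "v < n" "fst s iV = int v" "fst s rRowV = int v * int n" "fst s rSum = 0"
  shows "fst (sem sum_loop s) rSum = closed_sum f v"
  unfolding sum_loop_def closed_sum_def
proof (rule sem_Times_invariant[where m = n and
    I = "\<lambda>k t. fst t rSum = (\<Sum>u<k. if u = v \<or> a v u then f u else 0)"], goal_cases)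
  case (4 k t)
  have "graph_loaded t" using graph_loaded_frame[OF s(1) 4(2)] by simp
  then have "snd t (loc aAdj (int v * int n + int k)) = (if a v k then 1 else 0)"
    using s(3) 4(1) by (rule graph_loadedD(2))
  moreover have "snd t (loc aNew (int k)) = f k"
    using storedD[OF stored_frame[OF s(2) 4(2)] 4(1)] by simp
  moreover have "fst t iV = int v" "fst t rRowV = int v * int n" using frame_regs[OF 4(2)] s by simp_all
  ultimately show ?case using 4(3,4) by (cases "k = v") simp_all
qed (use s in \<open>auto simp: graph_loaded_def\<close>)

lemma check_new:
  assumes s: "graph_loaded s" "reps_loaded s" "stored aNew s f'" "stored aOld s f" "signs f'"
  shows "fst (sem check_new s) rFlag = of_bool (acceptable f f')"
    "fst (sem check_new s) rTotNew = total_sign f'" "fst (sem check_new s) rTotOld = total_sign f"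
proof -
  let ?b = "Set rTotNew (Add (Reg rTotNew) (Arr aNew (Reg iV))) ;;
   Set rTotOld (Add (Reg rTotOld) (Arr aOld (Reg iV))) ;;
   Eq (Arr aRep (Reg iV)) (Reg iV) (Neq (Arr aNew (Reg iV)) (Arr aOld (Reg iV)) (Set rFlag (Const 0))) ;;
   Set rSum (Const 0) ;; sum_loop ;; When (Sub (Const 1) (Reg rSum)) (Set rFlag (Const 0)) Nop ;;
   Set rRowV (Add (Reg rRowV) (Reg rN))"
  let ?s = "set_reg rRowV 0 (set_reg rTotOld 0 (set_reg rTotNew 0 (set_reg rFlag 1 s)))"
  have s': "graph_loaded ?s" "reps_loaded ?s" "stored aNew ?s f'" "stored aOld ?s f"
    using s by (simp_all add: graph_loaded_def reps_loaded_def stored_def)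
  let ?ok = "\<lambda>u. closed_sum f' u \<ge> 1 \<and> (rep u = u \<longrightarrow> f' u = f u)"
  let ?I = "\<lambda>k t. fst t rFlag = of_bool (\<forall>u<k. ?ok u) \<and>
    fst t rTotNew = (\<Sum>v<k. f' v) \<and> fst t rTotOld = (\<Sum>v<k. f v) \<and> fst t rRowV = int k * int n"
  have "?I n (sem (Times iV rN ?b) ?s)"
  proof (rule sem_Times_invariant[where I = ?I], goal_cases)
    case (4 k t)
    have gt: "graph_loaded t" using graph_loaded_frame[OF s'(1) 4(2)] by simp
    have rep: "snd t (loc aRep (int k)) = int (rep k)"
      using reps_loadedD[OF reps_loaded_frame[OF s'(2) 4(2)] 4(1)] by simp
    have new: "stored aNew t f'" using stored_frame[OF s'(3) 4(2)] by simp
    have old: "snd t (loc aOld (int k)) = f k"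
      using storedD[OF stored_frame[OF s'(4) 4(2)] 4(1)] by simp
    define t1 where "t1 = sem (Set rTotNew (Add (Reg rTotNew) (Arr aNew (Reg iV))) ;;
      Set rTotOld (Add (Reg rTotOld) (Arr aOld (Reg iV))) ;;
      Eq (Arr aRep (Reg iV)) (Reg iV) (Neq (Arr aNew (Reg iV)) (Arr aOld (Reg iV)) (Set rFlag (Const 0))) ;;
      Set rSum (Const 0)) t"
    have t1: "fst t1 rFlag = (if rep k = k \<and> f' k \<noteq> f k then 0 else fst t rFlag)"
      "fst t1 rTotNew = fst t rTotNew + f' k" "fst t1 rTotOld = fst t rTotOld + f k"
      "fst t1 rRowV = int k * int n" "fst t1 iV = int k" "fst t1 rSum = 0" "fst t1 rN = int n" "snd t1 = snd t"
      using rep old storedD[OF new 4(1)] 4(3,4) graph_loadedD(1)[OF gt] by (simp_all add: t1_def)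
    define t2 where "t2 = sem sum_loop t1"
    have "graph_loaded t1" "stored aNew t1 f'" using gt new t1 by (simp_all add: graph_loaded_def stored_def)
    then have t2: "fst t2 rSum = closed_sum f' k" "\<And>x. x \<notin> {iU, rSum} \<Longrightarrow> fst t2 x = fst t1 x"
      using 4(1) t1 by (auto simp: t2_def sum_loop sem_not_writes)
    have eq: "sem ?b t = sem (When (Sub (Const 1) (Reg rSum)) (Set rFlag (Const 0)) Nop ;;
        Set rRowV (Add (Reg rRowV) (Reg rN))) t2"
      by (simp add: t1_def t2_def)
    have all: "(\<forall>u<Suc k. ?ok u) \<longleftrightarrow> (\<forall>u<k. ?ok u) \<and> ?ok k"
      by (simp only: less_Suc_eq) blast
    show ?case unfolding eq all using t1 t2 4(4) by (auto simp: algebra_simps)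
  qed (use s' in \<open>auto simp: graph_loaded_def\<close>)
  moreover have "sem check_new s = sem (Times iV rN ?b) ?s" by (simp add: check_new_def del: sem.simps(6))
  moreover have "acceptable f f' \<longleftrightarrow> (\<forall>u<n. ?ok u)"
    using s(5) by (auto simp: acceptable_def sd_def reps_def)
  ultimately show "fst (sem check_new s) rFlag = of_bool (acceptable f f')"
    "fst (sem check_new s) rTotNew = total_sign f'" "fst (sem check_new s) rTotOld = total_sign f"
    by (simp_all only: total_sign_def simp_thms)
qed

lemma copy_signs:
  assumes "graph_loaded s" "stored aNew s f"
  shows "stored aOld (sem (Times iV rN (Put aOld (Reg iV) (Arr aNew (Reg iV)))) s) f"
  unfolding stored_def
proof (rule sem_Times_invariant[where m = n and I = "\<lambda>k t. \<forall>v<k. snd t (loc aOld (int v)) = f v"], goal_cases)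
  case (4 k t)
  then show ?case using storedD[OF stored_frame[OF assms(2) 4(2)] 4(1)] by (auto simp: less_Suc_eq)
qed (use assms in \<open>auto simp: graph_loaded_def\<close>)

definition represents :: "config \<Rightarrow> (nat \<Rightarrow> int) \<times> bool \<Rightarrow> bool" where
  "represents t st \<longleftrightarrow> stored aOld t (fst st) \<and> signs (fst st) \<and> fst t rOut = of_bool (snd st)"

lemma trial:
  assumes s: "graph_loaded s" "reps_loaded s" "digits_loaded s z" "fst s rBudget = k" "represents s (f, b)"
  shows "represents (sem trial s) (step k z (f, b))"
proof -
  define f' where "f' = move f z"
  have f: "stored aOld s f" "signs f" "fst s rOut = of_bool b" using s(5) by (simp_all add: represents_def)
  define s1 where "s1 = sem count_negs s"
  have fr1: "frame count_negs s s1" unfolding s1_def by (rule frame_sem) simp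
  have 1: "graph_loaded s1" "reps_loaded s1" "stored aOld s1 f"
    using graph_loaded_frame[OF s(1) fr1] reps_loaded_frame[OF s(2) fr1] stored_frame[OF f(1) fr1] by simp_all
  define s2 where "s2 = sem make_canonical s1"
  have fr2: "frame make_canonical s1 s2" unfolding s2_def by (rule frame_sem) simp
  have 2: "graph_loaded s2" "reps_loaded s2" "stored aOld s2 f" "stored aNew s2 f'"
    using graph_loaded_frame[OF 1(1) fr2] reps_loaded_frame[OF 1(2) fr2] stored_frame[OF 1(3) fr2]
      make_canonical[OF 1(1,2), of "\<lambda>c. negs f c + z c"] count_negs[OF s(1-3) f(1,2)]
    by (simp_all add: s1_def s2_def f'_def move_def)
  define s3 where "s3 = sem check_new s2"
  have fr3: "frame check_new s2 s3" unfolding s3_def by (rule frame_sem) simp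
  have 3: "graph_loaded s3" "stored aOld s3 f" "stored aNew s3 f'"
    using graph_loaded_frame[OF 2(1) fr3] stored_frame[OF 2(3) fr3] stored_frame[OF 2(4) fr3] by simp_all
  have sf': "signs f'" by (simp add: f'_def move_def)
  have c: "fst s3 rFlag = of_bool (acceptable f f')" "fst s3 rTotNew = total_sign f'" "fst s3 rTotOld = total_sign f"
    using check_new[OF 2(1,2,4,3) sf'] by (simp_all add: s3_def)
  have r: "fst s3 rOut = of_bool b" "fst s3 rBudget = k"
    using f s(4) frame_regs[OF fr1] frame_regs[OF fr2] frame_regs[OF fr3] by simp_all
  have eq: "sem trial s = sem update s3" by (simp add: trial_def s1_def s2_def s3_def)
  let ?copy = "Times iV rN (Put aOld (Reg iV) (Arr aNew (Reg iV)))"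
  let ?out = "sem (When (Add (Sub (Reg rBudget) (Reg rTotNew)) (Const 1)) (Set rOut (Const 1)) Nop) s3"
  show ?thesis
  proof (cases "acceptable f f'")
    case False
    then have "sem update s3 = s3" using c by (simp add: update_def)
    then show ?thesis using False 3 r f(2) eq by (simp add: represents_def f'_def)
  next
    case True
    have o: "fst ?out rOut = of_bool (b \<or> total_sign f' \<le> k)" "fst ?out rTotNew = total_sign f'" "fst ?out rTotOld = total_sign f"
        "graph_loaded ?out" "stored aOld ?out f" "stored aNew ?out f'"
      using c r 3 by (auto simp: graph_loaded_def stored_def)
    define s4 where "s4 = ?out"
    have o4: "fst s4 rOut = of_bool (b \<or> total_sign f' \<le> k)" "fst s4 rTotNew = total_sign f'" "fst s4 rTotOld = total_sign f"
        "graph_loaded s4" "stored aOld s4 f" "stored aNew s4 f'"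
      using o by (simp_all only: s4_def)
    have "sem (When (Reg rFlag) (p ;; q) Nop) s3 = sem q (sem p s3)" for p q
      using True c(1) by simp
    moreover have "sem (When (Sub (Reg rTotOld) (Reg rTotNew)) q Nop) s4 =
        (if total_sign f' < total_sign f then sem q s4 else s4)" for q
      using o4(2,3) by simp
    ultimately have up: "sem update s3 = (if total_sign f' < total_sign f then sem ?copy s4 else s4)"
      by (simp only: update_def s4_def)
    have "represents (sem ?copy s4) (f', b \<or> total_sign f' \<le> k)"
      using copy_signs[of s4 f'] o4 sf' by (simp add: represents_def sem_not_writes del: sem.simps)
    moreover have "represents s4 (f, b \<or> total_sign f' \<le> k)"
      using o4 f(2) by (simp add: represents_def)
    ultimately show ?thesis using True by (simp add: eq up f'_def Let_def del: sem.simps)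
  qed
qed

text \<open>What the preprocessing has set up and the search only reads.\<close>

definition env :: "int \<Rightarrow> config \<Rightarrow> bool" where
  "env k t \<longleftrightarrow> graph_loaded t \<and> reps_loaded t \<and> fst t rH = int H \<and> fst t rK = int K \<and>
     fst t rBudget = k \<and> fst t rRounds = int n + 1"

lemma env_frame:
  assumes "env k s" "frame p s t" "{rN, rH, rK, rBudget, rRounds} \<inter> writes p = {}"
    "{aAdj, aRep} \<inter> arrays p = {}"
  shows "env k t"
proof -
  have "graph_loaded t"
    by (rule graph_loaded_frame[OF _ assms(2)]) (use assms in \<open>auto simp: env_def\<close>)
  moreover have "reps_loaded t"
    by (rule reps_loaded_frame[OF _ assms(2)]) (use assms in \<open>auto simp: env_def\<close>)
  moreover have "fst t x = fst s x" if "x \<in> {rN, rH, rK, rBudget, rRounds}" for x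
    by (rule frame_regs[OF assms(2)]) (use assms(3) that in blast)
  ultimately show ?thesis using assms(1) by (simp add: env_def)
qed

lemma env_sem:
  "env k s \<Longrightarrow> well_formed p \<Longrightarrow> {rN, rH, rK, rBudget, rRounds} \<inter> writes p = {} \<Longrightarrow>
    {aAdj, aRep} \<inter> arrays p = {} \<Longrightarrow> env k (sem p s)"
  by (rule env_frame[OF _ frame_sem])

lemma decode_trial:
  assumes "env k s" "fst s iB = int j" "j < K" "represents s st"
  shows "represents (sem (decode iB ;; trial) s) (step k (digit j) st)"
proof -
  obtain f b where st: "st = (f, b)" by force
  let ?t = "sem (decode iB) s"
  have "env k ?t" using assms(1) by (rule env_sem) auto
  moreover have "digits_loaded ?t (digit j)"
    using assms by (intro decode) (auto simp: env_def)
  moreover have "represents ?t st"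
    using assms(4) by (simp add: represents_def stored_def sem_not_writes sem_not_arrays)
  ultimately have "represents (sem trial ?t) (step k (digit j) st)"
    unfolding st by (intro trial) (auto simp: env_def)
  then show ?thesis by simp
qed

abbreviation "round_prog \<equiv> Times iB rK (decode iB ;; trial)"

lemma round_prog:
  assumes "env k s" "represents s st"
  shows "represents (sem round_prog s) (search_round k digit K st)"
  unfolding search_round_def
proof (rule sem_Times_invariant[where m = K and I = "\<lambda>j t. represents t (iter (\<lambda>j. step k (digit j)) j st)"], goal_cases)
  case (4 j t)
  have "env k t" using assms(1) 4(2) by (rule env_frame) auto
  from decode_trial[OF this 4(3,1,4)] show ?case by (simp add: represents_def stored_def)
qed (use assms in \<open>auto simp: env_def represents_def stored_def\<close>)

lemma rounds_prog:
  assumes "env k s" "represents s st"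
  shows "represents (sem (Times iR rRounds round_prog) s) (iter (\<lambda>_. search_round k digit K) (Suc n) st)"
proof (rule sem_Times_invariant[where m = "Suc n" and I = "\<lambda>j t. represents t (iter (\<lambda>_. search_round k digit K) j st)"], goal_cases)
  case (4 j t)
  have "env k t" using assms(1) 4(2) by (rule env_frame) auto
  from round_prog[OF this 4(4)] show ?case by (simp add: represents_def stored_def del: sem.simps)
qed (use assms in \<open>auto simp: env_def represents_def stored_def\<close>)

lemma main_loop:
  assumes "env k s" "fst s rOut = 0"
  shows "fst (sem main_loop s) rOut = of_bool (search k digit K)"
  unfolding main_loop_def search_def
proof (rule sem_Times_invariant[where m = K and I = "\<lambda>j t. fst t rOut =
    of_bool (iter (\<lambda>i b. snd (iter (\<lambda>_. search_round k digit K) (Suc n) (start (digit i), b))) j False)"], goal_cases)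
  case (4 j t)
  have env: "env k t" using assms(1) 4(2) by (rule env_frame) auto
  let ?b = "iter (\<lambda>i b. snd (iter (\<lambda>_. search_round k digit K) (Suc n) (start (digit i), b))) j False"
  let ?t1 = "sem (decode iA) t" and ?t2 = "sem init_signs (sem (decode iA) t)"
  have e1: "env k ?t1" using env by (rule env_sem) auto
  have "digits_loaded ?t1 (digit j)" using env 4 by (intro decode) (auto simp: env_def)
  then have "stored aOld ?t2 (start (digit j))" using e1 by (intro init_signs) (auto simp: env_def)
  moreover have "fst ?t2 rOut = of_bool ?b" using 4(4) by (simp add: sem_not_writes)
  moreover have "signs (start (digit j))" by (simp add: signs_def start_def)
  ultimately have "represents ?t2 (start (digit j), ?b)" by (simp add: represents_def)
  moreover have "env k ?t2" using e1 by (rule env_sem) auto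
  ultimately have "represents (sem (Times iR rRounds round_prog) ?t2)
      (iter (\<lambda>_. search_round k digit K) (Suc n) (start (digit j), ?b))" by (intro rounds_prog)
  then show ?case by (simp add: represents_def del: sem.simps(6) iter.simps(2)) (simp del: sem.simps(6))
qed (use assms in \<open>auto simp: env_def\<close>)

end

section \<open>Running time and encoding\<close>

lemma copy_matrix_meta [simp]:
  "writes copy_matrix = {iV}" "arrays copy_matrix = {aAdj}" "well_formed copy_matrix" "loop_bounds copy_matrix = {rLen}"
  by (auto simp: copy_matrix_def)

lemma find_reps_meta [simp]:
  "writes find_reps = {rRowV, iV, rBest, rRowU, iU, iW, rFlag}" "arrays find_reps = {aRep}" "well_formed find_reps"
  "loop_bounds find_reps = {rN}"
  by (auto simp: find_reps_def least_twin_loop_def twin_loop_def)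

lemma powers_meta [simp]:
  "writes powers = {rX, iV, rY, iU, rH, rK}" "arrays powers = {}" "well_formed powers"
  by (auto simp: powers_def)

lemma main_loop_meta:
  "loop_bounds main_loop = {rK, rN, rRounds}"
  "writes main_loop = {iA, iB, iR, iV, iU, rFlag, rTotNew, rTotOld, rRowV, rSum, rOut, rZ, rQ}"
  by (auto simp: main_loop_def trial_def init_signs_def decode_def div_loop_def count_negs_def make_canonical_def
    check_new_def sum_loop_def update_def)

context index_graph
begin

definition input_loaded :: "int \<Rightarrow> config \<Rightarrow> bool" where
  "input_loaded k s \<longleftrightarrow> snd s 0 = int n \<and> snd s 1 = k \<and> fst s rOut = 0 \<and>
     (\<forall>u<n. \<forall>v<n. snd s (2 + int (u * n + v)) = (if a u v then 1 else 0))"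

lemma loaded_after_copy:
  assumes "input_loaded k s"
  defines "t \<equiv> sem copy_matrix (sem read_size s)"
  shows "graph_loaded t" "fst t rBudget = k" "fst t rRounds = int n + 1" "fst t rOut = 0"
proof -
  have s: "snd s 0 = int n" "snd s 1 = k" "fst s rOut = 0"
    using assms by (simp_all add: input_loaded_def)
  note rs = read_size[OF s(1,2)]
  have *: "snd t (loc aAdj (int u * int n + int v)) = (if a u v then 1 else 0)" if "u < n" "v < n" for u v
  proof -
    have "u * n + v < n * n"
    proof -
      have "u * n + v < (u + 1) * n" using that by simp
      also have "\<dots> \<le> n * n" using that by (intro mult_le_mono) auto
      finally show ?thesis .
    qed
    then have "snd t (loc aAdj (int (u * n + v))) = snd s (2 + int (u * n + v))"
      unfolding t_def using rs(4,5) by (subst copy_matrix[where m = "n * n"]) auto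
    then show ?thesis using assms(1) that by (simp add: input_loaded_def)
  qed
  show "graph_loaded t" "fst t rBudget = k" "fst t rRounds = int n + 1" "fst t rOut = 0"
    using * rs s(3) by (simp_all add: graph_loaded_def t_def sem_not_writes)
qed

lemma env_after_powers:
  assumes "input_loaded k s"
  defines "t \<equiv> sem powers (sem find_reps (sem copy_matrix (sem read_size s)))"
  shows "env k t" "fst t rOut = 0"
proof -
  let ?s = "sem copy_matrix (sem read_size s)"
  note l = loaded_after_copy[OF assms(1)]
  have "graph_loaded (sem find_reps ?s)" by (rule graph_loaded_frame[OF l(1) frame_sem]) auto
  moreover have "reps_loaded (sem find_reps ?s)" by (rule find_reps[OF l(1)])
  ultimately have "graph_loaded t" "reps_loaded t" "fst t rH = int H" "fst t rK = int K"
    using graph_loaded_frame[OF _ frame_sem] reps_loaded_frame[OF _ frame_sem] powers by (auto simp: t_def)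
  then show "env k t" "fst t rOut = 0" using l by (auto simp: env_def t_def sem_not_writes)
qed

lemma sd_prog_correct:
  assumes "input_loaded k s"
  shows "fst (sem sd_prog s) rOut = of_bool (\<exists>f. sd f \<and> total_sign f \<le> k)"
  using main_loop[OF env_after_powers[OF assms]] search_correct[OF digits_cover]
  by (simp add: sd_prog_def)

text \<open>\<open>powers\<close> overwrites \<open>rX\<close>, the bound of its inner loops, so
  \<open>cost_polynomial\<close> does not cover it. Instead, the exact values of \<open>rX\<close>
  show that it is at most \<open>K\<close> before every squaring.\<close>

lemma cost_powers:
  assumes s: "graph_loaded s" "reps_loaded s" and M: "K \<le> M" "n \<le> M"
    and W: "\<And>t M. M \<ge> 1 \<Longrightarrow> fst t rX \<le> int M \<Longrightarrow> cost square t \<le> W * M ^ d"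
  shows "cost powers s \<le> (132 + 3 * W) * M ^ Suc d"
proof -
  have K1: "K \<ge> 1" by (simp add: K_def)
  then have M1: "M \<ge> 1" using M by simp
  define s1 where "s1 = set_reg rX 3 s"
  define s2 where "s2 = sem square_per_rep s1"
  define s3 where "s3 = set_reg rH (fst s2 rX) s2"
  define s4 where "s4 = sem square_per_rep s3"
  have 1: "graph_loaded s1" "reps_loaded s1" "fst s1 rX = 3 ^ 2 ^ 0"
    using s by (auto simp: s1_def graph_loaded_def reps_loaded_def)
  have 3: "graph_loaded s3" "reps_loaded s3" "fst s3 rX = 3 ^ 2 ^ card reps"
    using 1 square_per_rep(1)[OF 1] unfolding s2_def s3_def
    by (auto simp: graph_loaded_def reps_loaded_def sem_not_writes sem_not_arrays)
  have le: "3 ^ 2 ^ (card reps + card reps) \<le> M"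
  proof -
    have "(3::nat) ^ 2 ^ (card reps + card reps) \<le> K" unfolding K_def by (intro power_increasing) auto
    then show ?thesis using M by simp
  qed
  have le0: "3 ^ 2 ^ (0 + card reps) \<le> M"
    by (rule order_trans[OF _ le]) (intro power_increasing, auto)
  have c1: "cost square_per_rep s1 \<le> 6 + n * (57 + W * M ^ d)"
    by (rule square_per_rep(2)[OF 1 W le0])
  have c2: "cost square_per_rep s3 \<le> 6 + n * (57 + W * M ^ d)"
    by (rule square_per_rep(2)[OF 3 W le])
  have "fst s4 rX = 3 ^ 2 ^ (card reps + card reps)" unfolding s4_def by (rule square_per_rep(1)[OF 3])
  also have "\<dots> \<le> int M" using of_nat_mono[OF le, where 'a = int] by (simp only: of_nat_power of_nat_numeral)
  finally have c3: "cost square s4 \<le> W * M ^ d" using W M1 by simp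
  have "cost powers s = 2 + (cost square_per_rep s1 + (2 + (cost square_per_rep s3 + (cost square s4 + 2))))"
    by (simp add: powers_def s1_def s2_def s3_def s4_def)
  also have "\<dots> \<le> 18 + 2 * (n * (57 + W * M ^ d)) + W * M ^ d" using c1 c2 c3 by linarith
  \<comment> \<open>The constants are \<open>132 = 18 + 2 * 57\<close> and
    \<open>3 * W = 2 * W + W\<close>.\<close>
  also have "\<dots> \<le> 18 * M ^ Suc d + 2 * (M * (57 * M ^ d + W * M ^ d)) + W * M ^ Suc d"
    using M M1 by (intro add_mono mult_mono mult_le_mono2) auto
  also have "\<dots> = (132 + 3 * W) * M ^ Suc d" by (simp add: algebra_simps)
  finally show ?thesis .
qed

end

text \<open>\<open>W\<close> and \<open>D\<close> are chosen before the graph, as they depend on the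
  program alone. The base of the power dominates all loop bounds; its square accounts for the matrix
  length \<open>n * n\<close>.\<close>

lemma cost_sd_prog:
  "\<exists>W D. \<forall>n a k s. index_graph a \<longrightarrow> index_graph.input_loaded n a k s \<longrightarrow>
     cost sd_prog s \<le> W * ((index_graph.K n a * (n + 1)) ^ 2) ^ D"
proof -
  let ?p = "Times iV rN (Set rLen (Add (Reg rLen) (Reg rN)))"
  have "loop_bounds ?p \<inter> writes ?p = {}" by simp
  from cost_polynomial[OF this] obtain W1 d1 where
    "\<forall>s M. M \<ge> 1 \<longrightarrow> (\<forall>b\<in>loop_bounds ?p. fst s b \<le> int M) \<longrightarrow> cost ?p s \<le> W1 * M ^ d1" by blast
  then have 1: "cost ?p s \<le> W1 * M ^ d1" if "M \<ge> 1" "fst s rN \<le> int M" for s M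
    using that by (simp del: cost.simps split_paired_All)
  have "loop_bounds copy_matrix \<inter> writes copy_matrix = {}" by simp
  from cost_polynomial[OF this] obtain W2 d2 where
    "\<forall>s M. M \<ge> 1 \<longrightarrow> (\<forall>b\<in>loop_bounds copy_matrix. fst s b \<le> int M) \<longrightarrow> cost copy_matrix s \<le> W2 * M ^ d2" by blast
  then have 2: "cost copy_matrix s \<le> W2 * M ^ d2" if "M \<ge> 1" "fst s rLen \<le> int M" for s M
    using that by (simp del: split_paired_All)
  have "loop_bounds find_reps \<inter> writes find_reps = {}" by simp
  from cost_polynomial[OF this] obtain W3 d3 where
    "\<forall>s M. M \<ge> 1 \<longrightarrow> (\<forall>b\<in>loop_bounds find_reps. fst s b \<le> int M) \<longrightarrow> cost find_reps s \<le> W3 * M ^ d3" by blast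
  then have 3: "cost find_reps s \<le> W3 * M ^ d3" if "M \<ge> 1" "fst s rN \<le> int M" for s M
    using that by (simp del: split_paired_All)
  obtain W4 d4 where
    4: "\<And>t M. M \<ge> 1 \<Longrightarrow> fst t rX \<le> int M \<Longrightarrow> cost square t \<le> W4 * M ^ d4" using cost_square by blast
  have "loop_bounds main_loop \<inter> writes main_loop = {}" by (simp add: main_loop_meta)
  from cost_polynomial[OF this] obtain W5 d5 where
    "\<forall>s M. M \<ge> 1 \<longrightarrow> (\<forall>b\<in>loop_bounds main_loop. fst s b \<le> int M) \<longrightarrow> cost main_loop s \<le> W5 * M ^ d5" by blast
  then have 5: "cost main_loop s \<le> W5 * M ^ d5"
    if "M \<ge> 1" "fst s rK \<le> int M" "fst s rN \<le> int M" "fst s rRounds \<le> int M" for s M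
    using that by (simp add: main_loop_meta del: split_paired_All)
  let ?D = "d1 + d2 + d3 + Suc d4 + d5"
  let ?W = "12 + W1 + W2 + W3 + (132 + 3 * W4) + W5"
  have "cost sd_prog s \<le> ?W * ((index_graph.K n a * (n + 1)) ^ 2) ^ ?D"
    if "index_graph a" "index_graph.input_loaded n a k s" for n a k s
  proof -
    interpret index_graph n a by fact
    define M where "M = (K * (n + 1)) ^ 2"
    have K1: "K \<ge> 1" by (simp add: K_def)
    then have le1: "n + 1 \<le> K * (n + 1)" "K \<le> K * (n + 1)"
      using mult_le_mono1[OF K1, of "n + 1"] by simp_all
    then have sq: "(n + 1) ^ 2 \<le> M" unfolding M_def by (intro power_mono) auto
    have "K * (n + 1) \<le> M" unfolding M_def using K1 by (simp add: power2_eq_square)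
    then have M: "K \<le> M" "n + 1 \<le> M" "n \<le> M" "n * n \<le> M" "M \<ge> 1"
      using le1 sq K1 by (auto simp: power2_eq_square)
    have pow: "w * M ^ e \<le> w * M ^ ?D" if "e \<le> ?D" for w e
      using M(5) that by (intro mult_le_mono2 power_increasing) auto
    define s1 where "s1 = sem read_size s"
    define s2 where "s2 = sem copy_matrix s1"
    define s3 where "s3 = sem find_reps s2"
    define s4 where "s4 = sem powers s3"
    have io: "snd s 0 = int n" "snd s 1 = k" using that(2) by (simp_all add: input_loaded_def)
    note rs = read_size[OF io]
    have l: "graph_loaded s2" using loaded_after_copy[OF that(2)] by (simp add: s2_def s1_def)
    have g3: "graph_loaded s3" unfolding s3_def by (rule graph_loaded_frame[OF l frame_sem]) auto
    have r3: "reps_loaded s3" unfolding s3_def by (rule find_reps[OF l])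
    have e4: "env k s4" using env_after_powers[OF that(2)] by (simp add: s1_def s2_def s3_def s4_def)
    have "cost read_size s \<le> 12 + W1 * M ^ d1"
    proof -
      let ?s = "sem (Set rN (Load (Const 0)) ;; Set rBudget (Load (Const 1)) ;;
        Set rRounds (Add (Reg rN) (Const 1)) ;; Set rLen (Const 0)) s"
      have "cost ?p ?s \<le> W1 * M ^ d1" using 1[of M ?s] M io by simp
      moreover have "cost read_size s = 12 + cost ?p ?s"
        by (simp add: read_size_def del: cost.simps(6))
      ultimately show ?thesis by simp
    qed
    moreover have "cost copy_matrix s1 \<le> W2 * M ^ d2"
      using M(4,5) rs(4) by (intro 2) (auto simp: s1_def simp flip: of_nat_mult)
    moreover have "cost find_reps s2 \<le> W3 * M ^ d3"
      using M graph_loadedD(1)[OF l] by (intro 3) auto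
    moreover have "cost powers s3 \<le> (132 + 3 * W4) * M ^ Suc d4"
      by (rule cost_powers[OF g3 r3 M(1,3) 4])
    moreover have "cost main_loop s4 \<le> W5 * M ^ d5"
      using M e4 by (intro 5) (auto simp: env_def graph_loaded_def)
    moreover have "cost sd_prog s = cost read_size s + (cost copy_matrix s1 + (cost find_reps s2 + (cost powers s3 + cost main_loop s4)))"
      by (simp add: sd_prog_def s1_def s2_def s3_def s4_def)
    moreover have "12 \<le> 12 * M ^ ?D" using M(5) by simp
    moreover note pow[of d1 W1] pow[of d2 W2] pow[of d3 W3] pow[of "Suc d4" "132 + 3 * W4"] pow[of d5 W5]
    ultimately show ?thesis unfolding M_def[symmetric] distrib_right by linarith
  qed
  then show ?thesis by blast
qed

section \<open>Computability of the time bound\<close>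

primrec squares :: "nat \<Rightarrow> prog" where
  "squares 0 = Nop"
| "squares (Suc c) = square ;; squares c"

lemma squares: "fst s rX = 3 ^ 2 ^ m \<Longrightarrow> fst (sem (squares c) s) rX = 3 ^ 2 ^ (m + c)"
proof (induction c arbitrary: s m)
  case (Suc c)
  have "fst (sem square s) rX = 3 ^ 2 ^ Suc m"
    using square[of s "3 ^ 2 ^ m"] Suc.prems by (simp add: power_add[symmetric] mult_2)
  from Suc.IH[OF this] show ?case by simp
qed simp

lemma well_formed_squares: "well_formed (squares c)" by (induction c) auto

text \<open>Two squarings are made for each unit of \<open>t\<close>; the constant \<open>c\<close>
  is built into the program text as \<open>c\<close> further squarings.\<close>

lemma computable_double_exponential: "computable (\<lambda>t. 3 ^ 2 ^ (2 * t + c))"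
proof -
  let ?loop = "Times iV rN (square ;; square)"
  let ?p = "Set rN (Load (Const 0)) ;; Set rX (Const 3) ;; ?loop ;; squares c ;; Set rOut (Reg rX)"
  have "outputs_within (compile ?p) [int t] (int (3 ^ 2 ^ (2 * t + c))) (cost ?p (initial_config [int t]))" for t
  proof -
    let ?s = "initial_config [int t]"
    define s1 where "s1 = set_reg rX 3 (set_reg rN (int t) ?s)"
    have "fst (sem ?loop s1) rX = 3 ^ 2 ^ (2 * t)"
    proof (rule sem_Times_invariant[where m = t and I = "\<lambda>j u. fst u rX = 3 ^ 2 ^ (2 * j)"], goal_cases)
      case (4 j u)
      from squares[OF 4(4), of 2] show ?case by (simp add: numeral_2_eq_2)
    qed (auto simp: s1_def)
    from squares[OF this] have "fst (sem (squares c) (sem ?loop s1)) rX = 3 ^ 2 ^ (2 * t + c)" .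
    moreover have "sem ?p ?s = sem (Set rOut (Reg rX)) (sem (squares c) (sem ?loop s1))"
      by (simp add: s1_def initial_config_def del: sem.simps(6))
    ultimately have "fst (sem ?p ?s) rOut = int (3 ^ 2 ^ (2 * t + c))" by simp
    moreover have "exec (compile ?p) ?s (cost ?p ?s) (sem ?p ?s)"
      by (rule compile_correct) (simp add: well_formed_squares)
    ultimately show ?thesis unfolding outputs_within_def by blast
  qed
  then show ?thesis unfolding computable_def by blast
qed

lemma nth_concat_uniform:
  assumes "\<And>xs. xs \<in> set xss \<Longrightarrow> length xs = m" "i < length xss" "j < m"
  shows "concat xss ! (i * m + j) = xss ! i ! j"
  using assms
proof (induction xss arbitrary: i)
  case (Cons xs xss)
  then show ?case by (cases i) (auto simp: nth_append)
qed simp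

section \<open>Encoded graphs as graphs on indices\<close>

locale encoded_graph = pair_graph G for G :: "nat pair_pre_digraph"
begin

definition vs :: "nat list" where "vs = sorted_list_of_set (pverts G)"

definition adj :: "nat \<Rightarrow> nat \<Rightarrow> bool" where
  "adj u v \<longleftrightarrow> u < length vs \<and> v < length vs \<and> (vs ! u, vs ! v) \<in> parcs G"

lemma set_vs: "set vs = pverts G" and distinct_vs: "distinct vs"
  by (simp_all add: vs_def pair_finite_verts)

lemma bij_vs: "bij_betw ((!) vs) {..<length vs} (pverts G)"
  using bij_betw_nth[OF distinct_vs] set_vs by auto

sublocale index_graph "length vs" adj
proof
  show "adj v u" if "adj u v" for u v using that arcs_symmetric by (simp add: adj_def)
  show "\<not> adj u u" for u using pair_no_loops[of "(vs ! u, vs ! u)"] by (auto simp: adj_def)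
qed

lemma closed_neighbourhood_sum:
  assumes "u < length vs"
  shows "(\<Sum>v\<in>closed_neighbourhood G (vs ! u). f v) = closed_sum (\<lambda>i. f (vs ! i)) u"
proof -
  let ?P = "\<lambda>v. v = vs ! u \<or> (vs ! u, v) \<in> parcs G"
  have "closed_neighbourhood G (vs ! u) = {v\<in>pverts G. ?P v}"
    using assms set_vs in_arcsD2 by (auto simp: closed_neighbourhood_def neighbourhood_def)
  then have "(\<Sum>v\<in>closed_neighbourhood G (vs ! u). f v) = (\<Sum>v\<in>pverts G. if ?P v then f v else 0)"
    using pair_finite_verts by (simp add: sum.inter_filter)
  also have "\<dots> = (\<Sum>i<length vs. if ?P (vs ! i) then f (vs ! i) else 0)"
    by (rule sum.reindex_bij_betw[OF bij_vs, symmetric])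
  also have "\<dots> = closed_sum (\<lambda>i. f (vs ! i)) u"
    unfolding closed_sum_def
    by (rule sum.cong) (use assms distinct_vs in \<open>auto simp: adj_def nth_eq_iff_index_eq\<close>)
  finally show ?thesis .
qed

lemma all_pverts: "(\<forall>v\<in>pverts G. P v) \<longleftrightarrow> (\<forall>i<length vs. P (vs ! i))"
  using set_vs by (metis in_set_conv_nth)

lemma signed_dominating_iff: "signed_dominating G f \<longleftrightarrow> sd (\<lambda>i. f (vs ! i))"
  unfolding signed_dominating_def sd_def signs_def all_pverts
  by (simp add: closed_neighbourhood_sum)

lemma weight_eq: "weight G f = total_sign (\<lambda>i. f (vs ! i))"
  unfolding weight_def total_sign_def by (rule sum.reindex_bij_betw[OF bij_vs, symmetric])

lemma yes_iff: "(\<exists>f. signed_dominating G f \<and> weight G f \<le> k) \<longleftrightarrow> (\<exists>f. sd f \<and> total_sign f \<le> k)"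
proof
  assume "\<exists>f. sd f \<and> total_sign f \<le> k"
  then obtain f where f: "sd f" "total_sign f \<le> k" by blast
  define h where "h v = f (inv_into {..<length vs} ((!) vs) v)" for v
  have "h (vs ! i) = f i" if "i < length vs" for i
    using that bij_vs by (simp add: h_def bij_betw_def inv_into_f_f)
  then have "sd (\<lambda>i. h (vs ! i)) \<longleftrightarrow> sd f" "total_sign (\<lambda>i. h (vs ! i)) = total_sign f"
    using sd_cong[of "\<lambda>i. h (vs ! i)" f] total_sign_cong[of "\<lambda>i. h (vs ! i)" f] by simp_all
  then show "\<exists>f. signed_dominating G f \<and> weight G f \<le> k"
    using f by (intro exI[of _ h]) (simp add: signed_dominating_iff weight_eq)
qed (use signed_dominating_iff weight_eq in metis)

lemma twin_if_same_type:
  assumes "same_type G (vs ! u) (vs ! v)" "u < length vs" "v < length vs"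
  shows "twin u v"
  unfolding twin_def
proof (intro allI impI)
  fix w assume w: "w < length vs" "w \<noteq> u" "w \<noteq> v"
  then have "vs ! w \<noteq> vs ! u" "vs ! w \<noteq> vs ! v"
    using assms distinct_vs by (simp_all add: nth_eq_iff_index_eq)
  then have "(vs ! u, vs ! w) \<in> parcs G \<longleftrightarrow> (vs ! v, vs ! w) \<in> parcs G"
    using assms(1) unfolding same_type_def neighbourhood_def by blast
  then show "adj u w \<longleftrightarrow> adj v w" using w assms by (simp add: adj_def)
qed

text \<open>Two representatives in one block of a same-type partition would be twins and hence
  equal, so every such partition has at least \<open>card reps\<close> blocks. This links the
  numbers computed by the program to the parameter.\<close>

lemma card_reps_le: "card reps \<le> neighbourhood_diversity G"
proof -
  let ?ok = "\<lambda>P. \<forall>A\<in>P. \<forall>u\<in>A. \<forall>v\<in>A. same_type G u v"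
  \<comment> \<open>The partition into singletons shows that the \<open>LEAST\<close> is
    attained.\<close>
  have "?ok ((\<lambda>x. {x}) ` pverts G)" by (auto simp: same_type_def)
  then have "\<exists>P. partition_on (pverts G) P \<and> card P = card ((\<lambda>x. {x}) ` pverts G) \<and> ?ok P"
    using partition_on_singletons by blast
  then have "\<exists>P. partition_on (pverts G) P \<and> card P = neighbourhood_diversity G \<and> ?ok P"
    unfolding neighbourhood_diversity_def by (rule LeastI)
  then obtain P where P: "partition_on (pverts G) P" "card P = neighbourhood_diversity G" "?ok P" by blast
  have "\<exists>A\<in>P. vs ! c \<in> A" if "c \<in> reps" for c
    using reps_less[OF that] set_vs partition_onD1[OF P(1)] by (metis UnionE nth_mem)
  then obtain block where block: "\<And>c. c \<in> reps \<Longrightarrow> block c \<in> P \<and> vs ! c \<in> block c" by metis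
  have "inj_on block reps"
  proof
    fix c d assume cd: "c \<in> reps" "d \<in> reps" "block c = block d"
    then have "same_type G (vs ! c) (vs ! d)" using block P(3) by metis
    then have "twin c d" using cd reps_less by (intro twin_if_same_type)
    then show "c = d" using rep_eq cd reps_less rep_reps by metis
  qed
  then have "card reps \<le> card P"
    using finite_elements[OF pair_finite_verts P(1)] block by (intro card_inj_on_le[of block]) auto
  then show ?thesis using P(2) by simp
qed

definition rows :: "int list list" where
  "rows = map (\<lambda>u. map (\<lambda>v. if (u, v) \<in> parcs G then 1 else 0) vs) vs"

lemma encode_eq: "sd_encode (G, k) = int (length vs) # k # concat rows"
  by (simp add: sd_encode_def vs_def rows_def Let_def)

lemma length_encode: "length (sd_encode (G, k)) = length vs * length vs + 2"
  by (simp add: encode_eq rows_def length_concat o_def sum_list_triv)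

lemma input_loaded: "input_loaded k (initial_config (sd_encode (G, k)))"
proof -
  have "snd (initial_config (sd_encode (G, k))) (2 + int (u * length vs + v)) = (if adj u v then 1 else 0)"
    if "u < length vs" "v < length vs" for u v
  proof -
    let ?i = "u * length vs + v"
    have "?i < (u + 1) * length vs" using that by simp
    also have "\<dots> \<le> length vs * length vs" using that by (intro mult_le_mono) auto
    finally have "Suc (Suc ?i) < length (sd_encode (G, k))" by (simp add: length_encode)
    moreover have "snd (initial_config w) (2 + int m) = w ! Suc (Suc m)" if "Suc (Suc m) < length w" for w m
    proof -
      have "nat (2 + int m) = Suc (Suc m)" "2 + int m < int (length w)" using that by simp_all
      then show ?thesis by (simp add: initial_config_def)
    qed
    ultimately have "snd (initial_config (sd_encode (G, k))) (2 + int ?i) = sd_encode (G, k) ! Suc (Suc ?i)"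
      by blast
    also have "\<dots> = concat rows ! ?i" by (simp add: encode_eq)
    also have "\<dots> = rows ! u ! v" using that by (intro nth_concat_uniform) (auto simp: rows_def)
    also have "\<dots> = (if adj u v then 1 else 0)" using that by (simp add: rows_def adj_def)
    finally show ?thesis .
  qed
  then show ?thesis by (simp add: input_loaded_def initial_config_def encode_eq)
qed

text \<open>Every entry, even 0, contributes at least its sign bit.\<close>

lemma input_size_ge: "length vs * length vs + 2 \<le> input_size (sd_encode (G, k))"
proof -
  have "length w \<le> input_size w" for w by (induction w) (auto simp: input_size_def)
  then show ?thesis by (metis length_encode)
qed

end

theorem theorem7:
  shows "fixed_parameter_tractable sd_instances sd_encode sd_yes_instances
           (\<lambda>(G, k). neighbourhood_diversity G)"
proof -
  obtain W D where WD: "\<And>n a k s. index_graph a \<Longrightarrow> index_graph.input_loaded n a k s \<Longrightarrow>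
     cost sd_prog s \<le> W * ((index_graph.K n a * (n + 1)) ^ 2) ^ D"
    using cost_sd_prog by blast
  \<comment> \<open>The exponent comes from enlarging \<open>K ^ (2 * D)\<close> to
    \<open>K ^ 2 ^ (2 * D)\<close>, which adds \<open>2 * D\<close> to the upper exponent
    \<open>2 * t + 1\<close> of \<open>K\<close> and keeps the double exponential form.\<close>
  define g :: "nat \<Rightarrow> nat" where "g t = 3 ^ 2 ^ (2 * t + (2 * D + 1))" for t
  have "computable g" unfolding g_def by (rule computable_double_exponential)
  moreover have "outputs_within (compile sd_prog) (sd_encode (G, k)) (if (G, k) \<in> sd_yes_instances then 1 else 0)
      (g (neighbourhood_diversity G) * input_size (sd_encode (G, k)) ^ (W + 2 * D))"
    if G: "pair_graph G" for G k
  proof -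
    interpret encoded_graph G using G by (simp add: encoded_graph_def)
    let ?s = "initial_config (sd_encode (G, k))" and ?size = "input_size (sd_encode (G, k))"
    let ?n = "length vs"
    have size: "?n + 1 \<le> ?size" "2 \<le> ?size"
      using input_size_ge[of k] le_square[of ?n] by linarith+
    have "K ^ (2 * D) \<le> K ^ 2 ^ (2 * D)"
      by (rule power_increasing) (auto simp: K_def intro: less_imp_le less_exp)
    also have "\<dots> = 3 ^ 2 ^ (2 * card reps + (2 * D + 1))"
      by (simp add: K_def power_mult[symmetric] power_add ac_simps)
    also have "\<dots> \<le> g (neighbourhood_diversity G)"
      unfolding g_def using card_reps_le by (intro power_increasing) auto
    finally have K: "K ^ (2 * D) \<le> g (neighbourhood_diversity G)" .
    \<comment> \<open>The constant factor is absorbed by the degree, as the input size is at least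
      2; so \<open>g\<close> keeps the form whose computability has been shown.\<close>
    have "W \<le> 2 ^ W" by (rule less_imp_le[OF less_exp])
    also have "\<dots> \<le> ?size ^ W" using size(2) by (rule power_mono) simp
    finally have W: "W \<le> ?size ^ W" .
    have "cost sd_prog ?s \<le> W * ((K * (?n + 1)) ^ 2) ^ D"
      by (rule WD[OF index_graph_axioms input_loaded])
    also have "\<dots> = W * (K ^ (2 * D) * (?n + 1) ^ (2 * D))"
      by (simp only: power_mult[symmetric] power_mult_distrib)
    also have "\<dots> \<le> ?size ^ W * (g (neighbourhood_diversity G) * ?size ^ (2 * D))"
      using W K size by (intro mult_le_mono power_mono) auto
    also have "\<dots> = g (neighbourhood_diversity G) * ?size ^ (W + 2 * D)"
      by (simp add: power_add)
    finally have time: "cost sd_prog ?s \<le> g (neighbourhood_diversity G) * ?size ^ (W + 2 * D)" .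
    have "(G, k) \<in> sd_yes_instances \<longleftrightarrow> (\<exists>f. sd f \<and> total_sign f \<le> k)"
      using G yes_iff by (simp add: sd_yes_instances_def)
    then have "fst (sem sd_prog ?s) rOut = (if (G, k) \<in> sd_yes_instances then 1 else 0)"
      using sd_prog_correct[OF input_loaded, of k] by simp
    then show ?thesis
      using compile_correct[OF well_formed_sd_prog, of ?s] time unfolding outputs_within_def by blast
  qed
  ultimately show ?thesis
    unfolding fixed_parameter_tractable_def sd_instances_def by fast
qed

end
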